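(* Let $n\ge2$, $\Omega\subset\mathbb{C}^n$ open, $K\subset\Omega$ compact, $Y\neq\{0\}$ a sequentially complete Hausdorff complex locally convex space, $f\in\mathcal{H}(\Omega\setminus K,Y)$, and let $\tilde f\in\mathcal{H}(\Omega,Y)$ be the unique map with $\tilde f|_{C_{K,\Omega}}=f|_{C_{K,\Omega}}$ (the Hartogs companion of $f$). Then for every domain of holomorphy $D\subset Y$: if $f(\Omega\setminus K)\subset D$, then $\tilde f(\Omega)\subset D$.
   Context: $\mathcal{H}(U,Y)$ for $U\subset\mathbb{C}^n$ open: continuous maps $U\to Y$ such that $\varphi\circ f$ is holomorphic for all $\varphi\in Y^*$. Coincidence set: $C_{K,\Omega}:=\bigcup_\omega(\omega\cap K^{\mathrm u}_\omega)$ over connected components $\omega$ of $\Omega$, where $K^{\mathrm u}_\omega$ is the unbounded component of $\mathbb{C}^n\setminus(K\cap\omega)$. Existence and uniqueness of $\tilde f$ are known. For open $D\subset Y$, $\mathcal{H}(D)$ denotes continuous Gâteaux holomorphic maps $D\to\mathbb{C}$ (i.e. $\lambda\mapsto g(y+\lambda v)$ holomorphic near $0$ for all $y\in D$, $v\in Y$). An open set $D\subset Y$ is a domain of holomorphy if there do not exist open sets $C,D_1\subset Y$ such that $\emptyset\neq C\subset D\cap D_1$, $D_1$ is connected with $D_1\not\subset D$, and for every $g\in\mathcal{H}(D)$ the restriction $g|_C$ has an extension $\bar g\in\mathcal{H}(D_1)$. *)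

theory Defs
  imports "HOL-Analysis.Analysis"
begin

text \<open>A complex vector space is a type 'y :: ab_group_add together with a scalar
  multiplication sc :: complex => 'y => 'y satisfying vector_space sc.
  A locally convex topology is represented by a family P of seminorms.\<close>

definition seminorm :: "(complex \<Rightarrow> 'y::ab_group_add \<Rightarrow> 'y) \<Rightarrow> ('y \<Rightarrow> real) \<Rightarrow> bool" where
  "seminorm sc p \<longleftrightarrow> (\<forall>x. 0 \<le> p x) \<and> (\<forall>x y. p (x + y) \<le> p x + p y)
      \<and> (\<forall>c x. p (sc c x) = cmod c * p x)"

definition lc_open :: "('y::ab_group_add \<Rightarrow> real) set \<Rightarrow> 'y set \<Rightarrow> bool" where
  "lc_open P S \<longleftrightarrow> (\<forall>x\<in>S. \<exists>F e. finite F \<and> F \<subseteq> P \<and> e > 0 \<and>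
      {y. \<forall>p\<in>F. p (y - x) < e} \<subseteq> S)"

lemma istopology_lc_open: "istopology (lc_open P)"
  unfolding istopology_def lc_open_def
proof (intro conjI allI impI ballI)
  fix S T x assume S: "\<forall>x\<in>S. \<exists>F e. finite F \<and> F \<subseteq> P \<and> e > 0 \<and> {y. \<forall>p\<in>F. p (y - x) < e} \<subseteq> S"
    and T: "\<forall>x\<in>T. \<exists>F e. finite F \<and> F \<subseteq> P \<and> e > 0 \<and> {y. \<forall>p\<in>F. p (y - x) < e} \<subseteq> T"
    and x: "x \<in> S \<inter> T"
  have xS: "x \<in> S" and xT: "x \<in> T" using x by auto
  obtain F e where F: "finite F" "F \<subseteq> P" "e > 0" "{y. \<forall>p\<in>F. p (y - x) < e} \<subseteq> S"
    using bspec[OF S xS] by (elim exE conjE) (rule that)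
  obtain G d where G: "finite G" "G \<subseteq> P" "d > 0" "{y. \<forall>p\<in>G. p (y - x) < d} \<subseteq> T"
    using bspec[OF T xT] by (elim exE conjE) (rule that)
  show "\<exists>F e. finite F \<and> F \<subseteq> P \<and> e > 0 \<and> {y. \<forall>p\<in>F. p (y - x) < e} \<subseteq> S \<inter> T"
  proof (intro exI conjI)
    show "finite (F \<union> G)" "F \<union> G \<subseteq> P" "min e d > 0" using F G by auto
    show "{y. \<forall>p\<in>F \<union> G. p (y - x) < min e d} \<subseteq> S \<inter> T"
    proof
      fix y assume "y \<in> {y. \<forall>p\<in>F \<union> G. p (y - x) < min e d}"
      then have "y \<in> {y. \<forall>p\<in>F. p (y - x) < e}" "y \<in> {y. \<forall>p\<in>G. p (y - x) < d}" by auto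
      then show "y \<in> S \<inter> T" using F(4) G(4) by blast
    qed
  qed
next
  fix K x assume K: "\<forall>S\<in>K. \<forall>x\<in>S. \<exists>F e. finite F \<and> F \<subseteq> P \<and> e > 0 \<and> {y. \<forall>p\<in>F. p (y - x) < e} \<subseteq> S"
    and x: "x \<in> \<Union>K"
  then obtain S where SK: "S \<in> K" and xS: "x \<in> S" by blast
  obtain F e where "finite F" "F \<subseteq> P" "e > 0" "{y. \<forall>p\<in>F. p (y - x) < e} \<subseteq> S"
    using bspec[OF bspec[OF K SK] xS] by (elim exE conjE) (rule that)
  then show "\<exists>F e. finite F \<and> F \<subseteq> P \<and> e > 0 \<and> {y. \<forall>p\<in>F. p (y - x) < e} \<subseteq> \<Union>K"
    using \<open>S \<in> K\<close> by blast
qed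

definition lc_topology :: "('y::ab_group_add \<Rightarrow> real) set \<Rightarrow> 'y topology" where
  "lc_topology P = topology (lc_open P)"

definition lc_space ::
  "(complex \<Rightarrow> 'y::ab_group_add \<Rightarrow> 'y) \<Rightarrow> ('y \<Rightarrow> real) set \<Rightarrow> bool" where
  "lc_space sc P \<longleftrightarrow> vector_space sc \<and> (\<forall>p\<in>P. seminorm sc p)"

definition lc_hausdorff :: "('y::ab_group_add \<Rightarrow> real) set \<Rightarrow> bool" where
  "lc_hausdorff P \<longleftrightarrow> (\<forall>x. x \<noteq> 0 \<longrightarrow> (\<exists>p\<in>P. p x \<noteq> 0))"

definition lc_seq_complete :: "('y::ab_group_add \<Rightarrow> real) set \<Rightarrow> bool" where
  "lc_seq_complete P \<longleftrightarrow> (\<forall>s::nat \<Rightarrow> 'y.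
      (\<forall>p\<in>P. \<forall>e>0. \<exists>N. \<forall>m\<ge>N. \<forall>n\<ge>N. p (s m - s n) < e) \<longrightarrow>
      (\<exists>y. \<forall>p\<in>P. (\<lambda>n. p (s n - y)) \<longlonglongrightarrow> 0))"

definition lc_dual ::
  "(complex \<Rightarrow> 'y::ab_group_add \<Rightarrow> 'y) \<Rightarrow> ('y \<Rightarrow> real) set \<Rightarrow> ('y \<Rightarrow> complex) \<Rightarrow> bool" where
  "lc_dual sc P \<phi> \<longleftrightarrow> Vector_Spaces.linear sc (*) \<phi> \<and> continuous_map (lc_topology P) euclidean \<phi>"

definition holo_n :: "(complex ^ 'n \<Rightarrow> complex) \<Rightarrow> (complex ^ 'n) set \<Rightarrow> bool" where
  "holo_n g U \<longleftrightarrow> (\<forall>z\<in>U. \<exists>L. (g has_derivative L) (at z) \<and> (\<forall>c v. L (c *s v) = c * L v))"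

definition holo_vec ::
  "(complex \<Rightarrow> 'y::ab_group_add \<Rightarrow> 'y) \<Rightarrow> ('y \<Rightarrow> real) set \<Rightarrow> (complex ^ 'n) set
    \<Rightarrow> (complex ^ 'n \<Rightarrow> 'y) \<Rightarrow> bool" where
  "holo_vec sc P U f \<longleftrightarrow> continuous_map (top_of_set U) (lc_topology P) f \<and>
      (\<forall>\<phi>. lc_dual sc P \<phi> \<longrightarrow> holo_n (\<phi> \<circ> f) U)"

text \<open>Union of the unbounded components of the complement (for compact S in C^n, n>=2,
  there is exactly one).\<close>
definition unbounded_comp :: "(complex ^ 'n) set \<Rightarrow> (complex ^ 'n) set" where
  "unbounded_comp S = \<Union>{c \<in> components (- S). \<not> bounded c}"

definition coincidence_set :: "(complex ^ 'n) set \<Rightarrow> (complex ^ 'n) set \<Rightarrow> (complex ^ 'n) set" where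
  "coincidence_set K \<Omega> = (\<Union>\<omega>\<in>components \<Omega>. \<omega> \<inter> unbounded_comp (K \<inter> \<omega>))"

definition gateaux_hol ::
  "(complex \<Rightarrow> 'y::ab_group_add \<Rightarrow> 'y) \<Rightarrow> ('y \<Rightarrow> real) set \<Rightarrow> 'y set \<Rightarrow> ('y \<Rightarrow> complex) \<Rightarrow> bool" where
  "gateaux_hol sc P D g \<longleftrightarrow> continuous_map (subtopology (lc_topology P) D) euclidean g \<and>
     (\<forall>y\<in>D. \<forall>v. \<exists>r>0. (\<forall>t\<in>ball 0 r. y + sc t v \<in> D) \<and>
         (\<lambda>t. g (y + sc t v)) holomorphic_on ball 0 r)"

definition domain_of_holomorphy ::
  "(complex \<Rightarrow> 'y::ab_group_add \<Rightarrow> 'y) \<Rightarrow> ('y \<Rightarrow> real) set \<Rightarrow> 'y set \<Rightarrow> bool" where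
  "domain_of_holomorphy sc P D \<longleftrightarrow> openin (lc_topology P) D \<and>
     \<not> (\<exists>C D1. openin (lc_topology P) C \<and> openin (lc_topology P) D1 \<and>
          C \<noteq> {} \<and> C \<subseteq> D \<inter> D1 \<and> connectedin (lc_topology P) D1 \<and> \<not> D1 \<subseteq> D \<and>
          (\<forall>g. gateaux_hol sc P D g \<longrightarrow>
              (\<exists>gb. gateaux_hol sc P D1 gb \<and> (\<forall>y\<in>C. gb y = g y))))"

end

theory Submission
  imports Defs "HOL-Complex_Analysis.Complex_Analysis"
begin

text \<open>Suppose \<open>ft\<close> leaves \<open>D\<close> and follow a path from the coincidence set to the first point
  \<open>z\<^sub>0\<close> with \<open>ft z\<^sub>0 \<notin> D\<close>. Around \<open>K\<close> there is a compact shell \<open>L\<close>, and a neighbourhood \<open>V\<close> of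
  \<open>0\<close> with \<open>f L + V \<subseteq> D\<close>. For \<open>g\<close> holomorphic on \<open>D\<close> and \<open>y \<in> V\<close> the scalar function
  \<open>z \<mapsto> g (f z + y)\<close> has a Hartogs extension \<open>h\<^sub>y\<close> across \<open>K\<close>, given by a Cauchy integral
  over \<open>L\<close>, hence holomorphic in \<open>y\<close> too; by the identity theorem along the path
  \<open>h\<^sub>y z = g (ft z + y)\<close> for small \<open>y\<close> as long as the path has not reached \<open>z\<^sub>0\<close>. For such
  \<open>z\<close> close to \<open>z\<^sub>0\<close>, every \<open>g\<close> thus extends from near \<open>ft z\<close> to \<open>ft z + V\<close>, which
  contains \<open>ft z\<^sub>0\<close>, so \<open>D\<close> is not a domain of holomorphy.

  The scalar Hartogs extension comes from the one-variable splitting of a function on a slice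
  into an inner and an outer Cauchy integral: the outer part is holomorphic off \<open>K\<close> and vanishes
  on slices missing \<open>K\<close>, hence on the unbounded component.\<close>

section \<open>Dual functionals and strong differentiability\<close>

text \<open>The map \<open>f\<close> is only continuous and weakly holomorphic, and a member of
  \<open>gateaux_hol\<close> is only holomorphic along complex lines, so even holomorphy of
  \<open>z \<mapsto> g (f z + y)\<close> along a line needs an argument: the difference quotients of
  \<open>f\<close> must converge in the seminorms. Norming functionals transfer scalar Cauchy
  estimates to each seminorm, and sequential completeness supplies the limit. From then on
  continuity and holomorphy along lines carry the proof. The path starts off \<open>K\<close> but
  may run through it. A Cauchy integral around the slices of a set is controlled only away from the
  shell that carries the edges of integration; hence the integration set is a neighbourhood
  \<open>N\<close> of \<open>K\<close> together with the whole path. Slices change shape with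
  \<open>z\<close>, so contours are boundaries of finite unions of grid squares, which can be held
  fixed for nearby \<open>z\<close>. Comparing the squares meeting \<open>N\<close> with those
  meeting a thickened \<open>K\<close> leaves a single Cauchy integral about the point in
  question.\<close>

definition sublinear :: "(complex \<Rightarrow> 'y::ab_group_add \<Rightarrow> 'y) \<Rightarrow> ('y \<Rightarrow> real) \<Rightarrow> bool" where
  "sublinear sc q \<longleftrightarrow> (\<forall>x y. q (x + y) \<le> q x + q y) \<and>
     (\<forall>t x. 0 < t \<longrightarrow> q (sc (of_real t) x) = t * q x)"

locale lcs =
  fixes sc :: "complex \<Rightarrow> 'y::ab_group_add \<Rightarrow> 'y" and P :: "('y \<Rightarrow> real) set"
  assumes lc_space: "lc_space sc P"
begin

lemma vs: "vector_space sc" and seminorm_P: "p \<in> P \<Longrightarrow> seminorm sc p"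
  using lc_space by (auto simp: lc_space_def)

lemmas sc_simps =
  vector_space.vector_space_assms(1)[OF vs] vector_space.vector_space_assms(2)[OF vs]
  vector_space.vector_space_assms(3)[OF vs] vector_space.vector_space_assms(4)[OF vs]

lemma sc_one [simp]: "sc 1 x = x" and sc_sc [simp]: "sc a (sc b x) = sc (a * b) x"
  by (simp_all add: sc_simps)

lemma sc_zero_left [simp]: "sc 0 x = 0" and sc_zero_right [simp]: "sc a 0 = 0"
  using sc_simps(1)[of a 0 0] sc_simps(2)[of 0 0 x] by simp_all

lemma sc_minus_right: "sc a (- x) = - sc a x"
  using sc_simps(1)[of a x "- x"] by (simp add: eq_neg_iff_add_eq_0 add.commute)

lemma sc_minus_left: "sc (- a) x = - sc a x"
  using sc_simps(2)[of a "- a" x] by (simp add: eq_neg_iff_add_eq_0 add.commute)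

lemma sc_diff_right: "sc a (x - y) = sc a x - sc a y"
  using sc_simps(1)[of a x "- y"] by (simp add: sc_minus_right)

lemma sc_diff_left: "sc (a - b) x = sc a x - sc b x"
  using sc_simps(2)[of a "- b" x] by (simp add: sc_minus_left)

section \<open>Sublinear functionals and the Hahn-Banach theorem for seminorms\<close>

lemma sublinear_zero: "sublinear sc q \<Longrightarrow> q 0 = 0"
proof -
  assume "sublinear sc q"
  then have "q (sc (of_real 2) 0) = 2 * q 0" unfolding sublinear_def by (meson zero_less_numeral)
  then show ?thesis by simp
qed

lemma sublinear_neg: "sublinear sc q \<Longrightarrow> - q (- x) \<le> q x"
  using sublinear_zero[of q] by (force simp: sublinear_def dest: spec[of _ x] spec[of _ "- x"])

lemma sublinear_homog: "sublinear sc q \<Longrightarrow> 0 \<le> t \<Longrightarrow> q (sc (of_real t) x) = t * q x"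
  by (cases "t = 0") (auto simp: sublinear_zero sublinear_def)

lemma sublinear_seminorm: "seminorm sc p \<Longrightarrow> sublinear sc p"
  by (auto simp: sublinear_def seminorm_def)

text \<open>For an additive, real-homogeneous \<open>l\<close> below \<open>q\<close> with
  \<open>l a = q a\<close>, each term bounds \<open>l y\<close>, because
  \<open>l y = l (y + sc (of_real t) a) - t * q a\<close>. The infimum is thus an upper bound for
  every such functional.\<close>

definition shift_inf :: "('y \<Rightarrow> real) \<Rightarrow> 'y \<Rightarrow> 'y \<Rightarrow> real" where
  "shift_inf q a y = (INF t\<in>{0..}. q (y + sc (of_real t) a) - t * q a)"

lemma shift_inf:
  assumes q: "sublinear sc q"
  shows "sublinear sc (shift_inf q a)" "shift_inf q a \<le> q" "shift_inf q a (- a) \<le> - q a"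
proof -
  define f where "f y t = q (y + sc (of_real t) a) - t * q a" for y t
  have sub: "q (x + y) \<le> q x + q y" for x y using q by (simp add: sublinear_def)
  \<comment> \<open>Subadditivity applied to \<open>y + sc (of_real t) a\<close> and
    \<open>- y\<close>, whose sum is \<open>sc (of_real t) a\<close>, gives a bound free of
    \<open>t\<close>; so the infimum is finite.\<close>
  have low: "- q (- y) \<le> f y t" if "0 \<le> t" for y t
    using sub[of "y + sc (of_real t) a" "- y"] sublinear_homog[OF q that, of a]
    by (simp add: f_def algebra_simps)
  have bdd: "bdd_below (f y ` {0..})" for y
    by (rule bdd_belowI2[of _ "- q (- y)"]) (use low in auto)
  have le: "shift_inf q a y \<le> f y t" if "0 \<le> t" for y t
    using cINF_lower[OF bdd[of y], of t] that by (simp add: shift_inf_def f_def)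
  have ge: "c \<le> shift_inf q a y" if "\<And>t. 0 \<le> t \<Longrightarrow> c \<le> f y t" for c y
    unfolding shift_inf_def using that by (intro cINF_greatest) (auto simp: f_def)
  show "shift_inf q a \<le> q" using le[of 0] by (auto simp: f_def le_fun_def)
  show "shift_inf q a (- a) \<le> - q a" using le[of 1 "- a"] sublinear_zero[OF q] by (simp add: f_def)
  have hom: "shift_inf q a (sc (of_real r) y) \<le> r * shift_inf q a y" if r: "0 < r" for r y
  proof -
    have "shift_inf q a (sc (of_real r) y) / r \<le> shift_inf q a y"
    proof (rule ge)
      fix t :: real assume t: "0 \<le> t"
      have "sc (of_real r) y + sc (of_real (r * t)) a = sc (of_real r) (y + sc (of_real t) a)"
        by (simp add: sc_simps)
      then have "f (sc (of_real r) y) (r * t) = r * f y t"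
        using sublinear_homog[OF q, of r] r by (simp add: f_def algebra_simps)
      then show "shift_inf q a (sc (of_real r) y) / r \<le> f y t"
        using le[of "r * t" "sc (of_real r) y"] r t by (simp add: field_simps)
    qed
    then show ?thesis using r by (simp add: field_simps)
  qed
  have hom': "shift_inf q a (sc (of_real r) y) = r * shift_inf q a y" if r: "0 < r" for r y
  proof (rule antisym[OF hom[OF r]])
    have "shift_inf q a y \<le> inverse r * shift_inf q a (sc (of_real r) y)"
      using hom[of "inverse r" "sc (of_real r) y"] r
      by (simp flip: of_real_mult)
    then show "r * shift_inf q a y \<le> shift_inf q a (sc (of_real r) y)"
      using r by (simp add: field_simps)
  qed
  have add: "shift_inf q a (x + y) \<le> shift_inf q a x + shift_inf q a y" for x y
  proof -
    have *: "shift_inf q a (x + y) \<le> f x s + f y t" if "0 \<le> s" "0 \<le> t" for s t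
      using le[of "s + t" "x + y"] that sub[of "x + sc (of_real s) a" "y + sc (of_real t) a"]
      by (simp add: f_def algebra_simps sc_simps)
    have "shift_inf q a (x + y) - f x s \<le> shift_inf q a y" if "0 \<le> s" for s
      by (rule ge) (use *[OF that] in force)
    then have "shift_inf q a (x + y) - shift_inf q a y \<le> shift_inf q a x"
      by (intro ge) force
    then show ?thesis by simp
  qed
  show "sublinear sc (shift_inf q a)"
    using add hom' by (simp add: sublinear_def)
qed

text \<open>A pointwise minimal sublinear functional is additive, because passing to
  \<^const>\<open>shift_inf\<close> cannot make it smaller.\<close>

lemma minimal_sublinear:
  assumes p: "sublinear sc p"
  obtains q where "sublinear sc q" "q \<le> p" "\<And>r. sublinear sc r \<Longrightarrow> r \<le> q \<Longrightarrow> r = q"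
proof -
  define A where "A = {q. sublinear sc q \<and> q \<le> p}"
  \<comment> \<open>Reversed order: Zorn's maximal element is then a minimal functional.\<close>
  define R where "R = (\<lambda>a b :: 'y \<Rightarrow> real. b \<le> a)"
  have "\<exists>m\<in>A. \<forall>a\<in>A. R m a \<longrightarrow> a = m"
  proof (rule predicate_Zorn)
    show "partial_order_on A (relation_of R A)"
      by (auto simp: partial_order_on_def preorder_on_def relation_of_def R_def refl_on_def
          trans_def antisym_def)
    fix C assume C: "C \<in> Chains (relation_of R A)"
    have CA: "q \<in> A" if "q \<in> C" for q using C that by (auto simp: Chains_def relation_of_def)
    have tot: "q \<le> r \<or> r \<le> q" if "q \<in> C" "r \<in> C" for q r
      using C that by (auto simp: Chains_def relation_of_def R_def)
    show "\<exists>u\<in>A. \<forall>a\<in>C. R a u"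
    proof (cases "C = {}")
      case True then show ?thesis using p by (auto simp: A_def)
    next
      case False
      define u where "u y = (INF q\<in>C. q y)" for y
      \<comment> \<open>Members of the chain lie below \<open>p\<close> and satisfy
        \<open>- q (- y) \<le> q y\<close>, so \<open>- p (- y)\<close> bounds the whole chain from
        below at \<open>y\<close>.\<close>
      have low: "- p (- y) \<le> q y" if "q \<in> C" for q y
      proof -
        have "q (- y) \<le> p (- y)" "sublinear sc q" using CA[OF that] by (auto simp: A_def le_fun_def)
        then show ?thesis using sublinear_neg[of q y] by linarith
      qed
      have bdd: "bdd_below ((\<lambda>q. q y) ` C)" for y
        by (rule bdd_belowI2[of _ "- p (- y)"]) (use low in auto)
      have le: "u y \<le> q y" if "q \<in> C" for q y
        using cINF_lower[OF bdd that] by (simp add: u_def)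
      have ge: "c \<le> u y" if "\<And>q. q \<in> C \<Longrightarrow> c \<le> q y" for c y
        unfolding u_def using that False by (intro cINF_greatest) auto
      have "u (x + y) \<le> u x + u y" for x y
      proof -
        have *: "u (x + y) \<le> q x + r y" if qr: "q \<in> C" "r \<in> C" for q r
        proof -
          obtain s where s: "s \<in> C" "s \<le> q" "s \<le> r" using tot[OF qr] qr by blast
          have "u (x + y) \<le> s x + s y"
          proof -
            have "s (x + y) \<le> s x + s y" using CA[OF s(1)] by (simp add: A_def sublinear_def)
            then show ?thesis using le[OF s(1), of "x + y"] by linarith
          qed
          moreover have "s x \<le> q x" "s y \<le> r y" using s(2,3) by (auto simp: le_fun_def)
          ultimately show ?thesis by linarith
        qed
        have "u (x + y) - q x \<le> u y" if "q \<in> C" for q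
        proof (rule ge)
          show "u (x + y) - q x \<le> r y" if "r \<in> C" for r
            using *[OF \<open>q \<in> C\<close> that] by linarith
        qed
        then have "u (x + y) - u y \<le> q x" if "q \<in> C" for q using that by (simp add: algebra_simps)
        then have "u (x + y) - u y \<le> u x" by (intro ge) auto
        then show ?thesis by linarith
      qed
      moreover have "u (sc (of_real t) x) = t * u x" if t: "0 < t" for t x
      proof (rule antisym)
        have eq: "q (sc (of_real t) x) = t * q x" if "q \<in> C" for q
          using CA[OF that] t by (simp add: A_def sublinear_def)
        show "t * u x \<le> u (sc (of_real t) x)"
          by (rule ge) (simp add: le eq t)
        have "u (sc (of_real t) x) / t \<le> u x"
        proof (rule ge)
          show "u (sc (of_real t) x) / t \<le> q x" if "q \<in> C" for q
            using le[OF that, of "sc (of_real t) x"] eq[OF that] t by (simp add: field_simps)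
        qed
        then show "u (sc (of_real t) x) \<le> t * u x" using t by (simp add: field_simps)
      qed
      moreover have "u \<le> p"
      proof -
        obtain q where "q \<in> C" using False by blast
        then have "q \<le> p" "u \<le> q" using CA le by (auto simp: A_def le_fun_def)
        then show ?thesis by (rule order_trans[rotated])
      qed
      ultimately have "u \<in> A" by (simp add: A_def sublinear_def)
      then show ?thesis using le by (auto simp: R_def le_fun_def)
    qed
  qed
  then show thesis using that by (force simp: A_def R_def)
qed

text \<open>Taking a minimal functional below \<open>shift_inf p a\<close> instead of
  \<open>p\<close> yields \<open>q (- a) \<le> - p a\<close> and so forces equality at
  \<open>a\<close>. For every \<open>b\<close>, minimality gives \<open>shift_inf q b = q\<close>,
  whose value at \<open>- b\<close> is at most \<open>- q b\<close>; so \<open>q\<close> is odd, and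
  an odd subadditive functional is additive.\<close>

lemma real_linear_below_seminorm:
  assumes p: "seminorm sc p"
  obtains q where "\<And>x y. q (x + y) = q x + q y" "\<And>t x. q (sc (of_real t) x) = t * q x"
    "\<And>x. q x \<le> p x" "q a = p a"
proof -
  note sp = sublinear_seminorm[OF p]
  obtain q where q: "sublinear sc q" "q \<le> shift_inf p a"
    and min: "\<And>r. sublinear sc r \<Longrightarrow> r \<le> q \<Longrightarrow> r = q"
    using minimal_sublinear[OF shift_inf(1)[OF sp, of a]] by blast
  have neg: "q (- b) = - q b" for b
  proof -
    have "shift_inf q b = q" by (rule min) (use shift_inf[OF q(1)] in auto)
    then show ?thesis using shift_inf(3)[OF q(1), of b] sublinear_neg[OF q(1), of b] by simp
  qed
  have le: "q x \<le> p x" for x using q(2) shift_inf(2)[OF sp, of a] by (meson le_fun_def order_trans)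
  have sub: "q (x + y) \<le> q x + q y" for x y using q(1) by (simp add: sublinear_def)
  have add: "q (x + y) = q x + q y" for x y
    using sub[of x y] sub[of "- x" "- y"] neg[of x] neg[of y] neg[of "x + y"] by simp
  have hom: "q (sc (of_real t) x) = t * q x" for t x
  proof (cases "0 \<le> t")
    case False
    have "sc (of_real t) x = - sc (of_real (- t)) x" by (simp add: sc_minus_left)
    then show ?thesis using False sublinear_homog[OF q(1), of "- t" x] neg by simp
  qed (use sublinear_homog[OF q(1)] in auto)
  have "q (- a) \<le> - p a" using q(2) shift_inf(3)[OF sp, of a] by (meson le_fun_def order_trans)
  then have "q a = p a" using neg[of a] le[of a] by simp
  then show thesis using that add hom le by blast
qed

lemma hahn_banach:
  assumes p: "seminorm sc p"
  obtains \<phi> where "Vector_Spaces.linear sc (*) \<phi>" "\<And>x. cmod (\<phi> x) \<le> p x" "\<phi> a = of_real (p a)"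
proof -
  obtain q where add: "\<And>x y. q (x + y) = q x + q y" and hom: "\<And>t x. q (sc (of_real t) x) = t * q x"
    and le: "\<And>x. q x \<le> p x" and qa: "q a = p a"
    using real_linear_below_seminorm[OF p, of a] by blast
  \<comment> \<open>A complex-linear functional is determined by its real part; this is the only
    candidate with real part \<open>q\<close>.\<close>
  define \<phi> where "\<phi> x = Complex (q x) (- q (sc \<i> x))" for x
  have ps: "p (sc c x) = cmod c * p x" for c x using p by (simp add: seminorm_def)
  have neg: "q (- x) = - q x" for x using hom[of "-1" x] by (simp add: sc_minus_left)
  have phadd: "\<phi> (x + y) = \<phi> x + \<phi> y" for x y by (simp add: \<phi>_def add sc_simps complex_eq_iff)
  have phr: "\<phi> (sc (of_real t) x) = of_real t * \<phi> x" for t x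
  proof -
    have "sc \<i> (sc (of_real t) x) = sc (of_real t) (sc \<i> x)" by (simp add: mult.commute)
    then show ?thesis using hom[of t "sc \<i> x"] hom[of t x]
      by (simp add: \<phi>_def complex_eq_iff del: sc_sc)
  qed
  have phi: "\<phi> (sc \<i> x) = \<i> * \<phi> x" for x
    by (simp add: \<phi>_def complex_eq_iff sc_minus_left neg)
  have phc: "\<phi> (sc c x) = c * \<phi> x" for c x
  proof -
    have "sc c x = sc (of_real (Re c)) x + sc (of_real (Im c)) (sc \<i> x)"
      by (simp add: mult.commute flip: sc_simps(2) complex_eq)
    then have "\<phi> (sc c x) = of_real (Re c) * \<phi> x + of_real (Im c) * (\<i> * \<phi> x)"
      by (simp add: phadd phr phi del: sc_sc)
    also have "\<dots> = (of_real (Re c) + \<i> * of_real (Im c)) * \<phi> x" by (simp add: algebra_simps)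
    finally show ?thesis by (simp flip: complex_eq)
  qed
  have bound: "cmod (\<phi> x) \<le> p x" for x
  proof (cases "\<phi> x = 0")
    case True then show ?thesis using p by (simp add: seminorm_def)
  next
    case False
    \<comment> \<open>Rotation by the unimodular \<open>c\<close> makes the value at
      \<open>sc c x\<close> real and equal to \<open>cmod (\<phi> x)\<close>, so the bound on the
      real part applies.\<close>
    define c where "c = cnj (\<phi> x) / cmod (\<phi> x)"
    have "\<phi> (sc c x) = of_real (cmod (\<phi> x))"
      using False complex_norm_square[of "\<phi> x"]
      by (simp add: phc c_def power2_eq_square field_simps)
    then have "q (sc c x) = cmod (\<phi> x)" by (simp add: \<phi>_def complex_eq_iff)
    moreover have "cmod c = 1" using False by (simp add: c_def norm_divide)
    ultimately show ?thesis using le[of "sc c x"] ps[of c x] by simp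
  qed
  have "Re (\<phi> a) = p a" by (simp add: \<phi>_def qa)
  \<comment> \<open>The modulus is at most \<open>p a\<close>, which the real part already attains;
    no room is left for an imaginary part.\<close>
  moreover have "\<bar>Im (\<phi> a)\<bar>\<^sup>2 \<le> 0"
    using power_mono[OF bound[of a], of 2] \<open>Re (\<phi> a) = p a\<close> by (simp add: cmod_power2)
  ultimately have "\<phi> a = of_real (p a)" by (simp add: complex_eq_iff)
  moreover have "Vector_Spaces.linear sc (*) \<phi>"
    using vs vector_space_over_itself.vector_space_axioms[where ?'a=complex] phadd phc
    by (intro Vector_Spaces.linear_iff[THEN iffD2]) auto
  ultimately show thesis using that bound by blast
qed

end

section \<open>Cauchy estimates for difference quotients in one variable\<close>

lemma holomorphic_lipschitz_at_0:
  assumes k: "k holomorphic_on ball 0 \<rho>" and B: "\<And>t. t \<in> ball 0 \<rho> \<Longrightarrow> cmod (k t) \<le> B"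
    and h: "cmod h < \<rho> / 2"
  shows "cmod (k h - k 0) \<le> 4 * B / \<rho> * cmod h"
proof -
  have \<rho>: "0 < \<rho>" using h by (smt (verit) norm_ge_zero field_sum_of_halves)
  \<comment> \<open>Cauchy's inequality on the disc of radius \<open>\<rho> / 4\<close> about
    \<open>w\<close>, which stays inside \<open>ball 0 \<rho>\<close>.\<close>
  have der: "cmod (deriv k w) \<le> 4 * B / \<rho>" if "w \<in> ball 0 (\<rho> / 2)" for w
  proof -
    have sub: "cball w (\<rho> / 4) \<subseteq> ball 0 \<rho>"
    proof
      fix x assume "x \<in> cball w (\<rho> / 4)"
      then show "x \<in> ball 0 \<rho>" using that \<rho> norm_triangle_ineq4[of w "w - x"] by (auto simp: dist_norm)
    qed
    have "cmod ((deriv ^^ 1) k w) \<le> fact 1 * B / (\<rho> / 4) ^ 1"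
    proof (rule Cauchy_inequality)
      show "k holomorphic_on ball w (\<rho> / 4)"
        using k sub by (meson ball_subset_cball holomorphic_on_subset order_trans)
      show "continuous_on (cball w (\<rho> / 4)) k"
        using k sub by (meson holomorphic_on_imp_continuous_on holomorphic_on_subset)
      show "cmod (k x) \<le> B" if "cmod (w - x) = \<rho> / 4" for x
        using that sub by (intro B) (auto simp: dist_norm)
    qed (use \<rho> in auto)
    then show ?thesis by (simp add: mult.commute)
  qed
  have "cmod (k h - k 0) \<le> 4 * B / \<rho> * cmod (h - 0)"
  proof (rule field_differentiable_bound[where f' = "deriv k" and S = "ball 0 (\<rho> / 2)"])
    show "(k has_field_derivative deriv k z) (at z within ball 0 (\<rho> / 2))" if "z \<in> ball 0 (\<rho> / 2)" for z
      using holomorphic_derivI[OF k, of z] that \<rho> by (auto intro: has_field_derivative_at_within)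
  qed (use der h \<rho> in auto)
  then show ?thesis by simp
qed

text \<open>The difference quotient, completed by the derivative at 0, is itself holomorphic and
  bounded by \<open>4 * M / \<rho>\<close> on the half disc; the Lipschitz bound applied to it, now
  with radius \<open>\<rho> / 2\<close>, gives 32 as 4 times 4 times 2. The constant depends on
  \<open>F\<close> only through \<open>M\<close>, so it is uniform over families with a common
  bound.\<close>

lemma difference_quotient_estimate:
  assumes F: "F holomorphic_on ball \<zeta> \<rho>" and M: "\<And>t. t \<in> ball \<zeta> \<rho> \<Longrightarrow> cmod (F t) \<le> M"
    and h: "h \<noteq> 0" "cmod h < \<rho> / 4"
  shows "cmod ((F (\<zeta> + h) - F \<zeta>) / h - deriv F \<zeta>) \<le> 32 * M / \<rho>\<^sup>2 * cmod h"
proof -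
  have \<rho>: "0 < \<rho>" using h by (smt (verit) norm_ge_zero divide_nonpos_pos)
  define G where "G t = F (\<zeta> + t)" for t
  have G: "G holomorphic_on ball 0 \<rho>"
    unfolding G_def by (rule holomorphic_on_compose_gen[OF _ F, unfolded o_def])
      (auto intro!: holomorphic_intros simp: dist_norm)
  have GM: "cmod (G t) \<le> M" if "t \<in> ball 0 \<rho>" for t
    unfolding G_def by (rule M) (use that in \<open>auto simp: dist_norm\<close>)
  define k where "k t = (if t = 0 then deriv G 0 else (G t - G 0) / (t - 0))" for t
  have k: "k holomorphic_on ball 0 (\<rho> / 2)"
    unfolding k_def using pole_lemma_open[OF G, of 0] by (rule holomorphic_on_subset) (use \<rho> in auto)
  have bd: "cmod (k t) \<le> 4 * M / \<rho>" if "t \<in> ball 0 (\<rho> / 2) - {0}" for t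
    using holomorphic_lipschitz_at_0[OF G GM, of t] that
    by (auto simp: k_def norm_divide divide_le_eq)
  have "isCont k 0"
    using k \<rho> by (intro continuous_on_interior[OF holomorphic_on_imp_continuous_on[OF k]]) auto
  then have "(k \<longlongrightarrow> k 0) (at 0)" by (simp add: isCont_def)
  then have "cmod (k 0) \<le> 4 * M / \<rho>"
  proof (rule Lim_norm_ubound[rotated])
    show "\<forall>\<^sub>F t in at 0. cmod (k t) \<le> 4 * M / \<rho>"
      unfolding eventually_at using bd \<rho> by (intro exI[of _ "\<rho> / 2"]) auto
  qed auto
  then have "cmod (k h - k 0) \<le> 4 * (4 * M / \<rho>) / (\<rho> / 2) * cmod h"
    using bd h by (intro holomorphic_lipschitz_at_0[OF k]) auto
  moreover have "deriv G 0 = deriv F \<zeta>"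
  proof -
    have "(F has_field_derivative deriv F \<zeta>) (at (\<zeta> + 0))"
      using holomorphic_derivI[OF F, of \<zeta>] \<rho> by simp
    then have "(G has_field_derivative deriv F \<zeta>) (at 0)"
      unfolding G_def by (subst (asm) add.commute, subst (asm) DERIV_shift) (simp add: add.commute)
    then show ?thesis by (rule DERIV_imp_deriv)
  qed
  ultimately show ?thesis using h(1) by (simp add: k_def G_def power2_eq_square field_simps)
qed

section \<open>Seminorm description of the topology and of continuity\<close>

context lcs
begin

text \<open>Finite sums make the defining family of seminorms directed.\<close>

definition SP :: "('y \<Rightarrow> real) set" where
  "SP = {q. \<exists>F. finite F \<and> F \<subseteq> P \<and> q = (\<lambda>x. \<Sum>p\<in>F. p x)}"

lemma SP_seminorm: "q \<in> SP \<Longrightarrow> seminorm sc q"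
proof -
  assume "q \<in> SP"
  then obtain F where F: "finite F" "F \<subseteq> P" "q = (\<lambda>x. \<Sum>p\<in>F. p x)" by (auto simp: SP_def)
  then have sn: "\<And>p. p \<in> F \<Longrightarrow> seminorm sc p" using seminorm_P by auto
  show ?thesis unfolding seminorm_def F(3)
  proof (intro conjI allI)
    fix x y c
    show "0 \<le> (\<Sum>p\<in>F. p x)" using sn by (intro sum_nonneg) (simp add: seminorm_def)
    show "(\<Sum>p\<in>F. p (x + y)) \<le> (\<Sum>p\<in>F. p x) + (\<Sum>p\<in>F. p y)"
      unfolding sum.distrib[symmetric] using sn by (intro sum_mono) (simp add: seminorm_def)
    show "(\<Sum>p\<in>F. p (sc c x)) = cmod c * (\<Sum>p\<in>F. p x)"
      unfolding sum_distrib_left using sn by (intro sum.cong) (simp_all add: seminorm_def)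
  qed
qed

lemma SP_props:
  assumes "q \<in> SP"
  shows SP_nonneg: "0 \<le> q x" and SP_add: "q (x + y) \<le> q x + q y"
    and SP_sc: "q (sc c x) = cmod c * q x" and SP_zero: "q 0 = 0"
    and SP_commute: "q (x - y) = q (y - x)" and SP_diff: "\<bar>q x - q y\<bar> \<le> q (x - y)"
proof -
  note s = SP_seminorm[OF assms]
  show sc: "q (sc c x) = cmod c * q x" for c x using s by (simp add: seminorm_def)
  show add: "q (x + y) \<le> q x + q y" for x y using s by (simp add: seminorm_def)
  show "0 \<le> q x" using s by (simp add: seminorm_def)
  show "q 0 = 0" using sc[of 0 0] by simp
  have minus: "q (- x) = q x" for x using sc[of "-1" x] by (simp add: sc_minus_left)
  show c: "q (x - y) = q (y - x)" for x y using minus[of "x - y"] by simp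
  show "\<bar>q x - q y\<bar> \<le> q (x - y)" using add[of "x - y" y] add[of "y - x" x] c[of x y] by simp
qed

lemma P_SP: "p \<in> P \<Longrightarrow> p \<in> SP"
  unfolding SP_def by (intro CollectI exI[of _ "{p}"]) auto

lemma SP_dominating:
  assumes "finite S" "S \<subseteq> SP"
  obtains q where "q \<in> SP" "\<And>s x. s \<in> S \<Longrightarrow> s x \<le> q x"
  using assms
proof (induction S arbitrary: thesis rule: finite_induct)
  case empty
  have "(\<lambda>x. 0) \<in> SP" unfolding SP_def by (intro CollectI exI[of _ "{}"]) auto
  then show ?case using empty by blast
next
  case (insert s S)
  obtain q where q: "q \<in> SP" "\<And>s x. s \<in> S \<Longrightarrow> s x \<le> q x" using insert by blast
  obtain F where F: "finite F" "F \<subseteq> P" "q = (\<lambda>x. \<Sum>p\<in>F. p x)" using q(1) by (auto simp: SP_def)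
  obtain G where G: "finite G" "G \<subseteq> P" "s = (\<lambda>x. \<Sum>p\<in>G. p x)" using insert.prems by (auto simp: SP_def)
  define r where "r = (\<lambda>x. \<Sum>p\<in>F \<union> G. p x)"
  have le: "(\<Sum>p\<in>H. p x) \<le> r x" if "H \<subseteq> F \<union> G" for H x
    unfolding r_def using that F G seminorm_P by (intro sum_mono2) (auto simp: seminorm_def)
  have "r \<in> SP" unfolding SP_def r_def using F G by (intro CollectI exI[of _ "F \<union> G"]) auto
  moreover have "t x \<le> r x" if "t \<in> insert s S" for t x
    using that le[of F x] le[of G x] q(2)[of t x] F(3) G(3) by fastforce
  ultimately show ?case using insert.prems by blast
qed

lemma openin_lc: "openin (lc_topology P) S \<longleftrightarrow> (\<forall>x\<in>S. \<exists>q\<in>SP. \<exists>e>0. \<forall>y. q (y - x) < e \<longrightarrow> y \<in> S)"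
proof -
  have "openin (lc_topology P) S \<longleftrightarrow> lc_open P S"
    by (simp add: lc_topology_def topology_inverse' istopology_lc_open)
  also have "\<dots> \<longleftrightarrow> (\<forall>x\<in>S. \<exists>q\<in>SP. \<exists>e>0. \<forall>y. q (y - x) < e \<longrightarrow> y \<in> S)"
    unfolding lc_open_def
  proof (intro ball_cong refl iffI)
    fix x assume "\<exists>F e. finite F \<and> F \<subseteq> P \<and> e > 0 \<and> {y. \<forall>p\<in>F. p (y - x) < e} \<subseteq> S"
    then obtain F e where F: "finite F" "F \<subseteq> P" "e > 0" "{y. \<forall>p\<in>F. p (y - x) < e} \<subseteq> S" by blast
    define q where "q = (\<lambda>x. \<Sum>p\<in>F. p x)"
    have "p y \<le> q y" if "p \<in> F" for p y
      unfolding q_def using that F seminorm_P by (intro member_le_sum) (auto simp: seminorm_def)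
    then have "\<forall>p\<in>F. p (y - x) < e" if "q (y - x) < e" for y
      using that le_less_trans by blast
    then have "\<forall>y. q (y - x) < e \<longrightarrow> y \<in> S" using F(4) by blast
    moreover have "q \<in> SP" using F by (auto simp: SP_def q_def)
    ultimately show "\<exists>q\<in>SP. \<exists>e>0. \<forall>y. q (y - x) < e \<longrightarrow> y \<in> S" using F(3) by blast
  next
    fix x assume "\<exists>q\<in>SP. \<exists>e>0. \<forall>y. q (y - x) < e \<longrightarrow> y \<in> S"
    then obtain F e where F: "finite F" "F \<subseteq> P" "e > 0" "\<forall>y. (\<Sum>p\<in>F. p (y - x)) < e \<longrightarrow> y \<in> S"
      by (auto simp: SP_def)
    \<comment> \<open>Adding 1 to \<open>card F\<close> makes the final estimate strict and covers
      the empty family.\<close>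
    have "y \<in> S" if y: "\<forall>p\<in>F. p (y - x) < e / (card F + 1)" for y
    proof -
      have "(\<Sum>p\<in>F. p (y - x)) \<le> card F * (e / (card F + 1))"
        using y by (intro sum_bounded_above) auto
      also have "\<dots> < e" using F(3) by (simp add: field_simps)
      finally show ?thesis using F(4) by blast
    qed
    moreover have "e / (card F + 1) > 0" using F(3) by simp
    ultimately show "\<exists>F e. finite F \<and> F \<subseteq> P \<and> e > 0 \<and> {y. \<forall>p\<in>F. p (y - x) < e} \<subseteq> S"
      using F(1,2) by blast
  qed
  finally show ?thesis .
qed

lemma topspace_lc [simp]: "topspace (lc_topology P) = UNIV"
proof -
  obtain q where "q \<in> SP" by (rule SP_dominating[of "{}"]) auto
  then have "openin (lc_topology P) UNIV"
    unfolding openin_lc by (intro ballI bexI[of _ q] exI[of _ 1]) auto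
  then show ?thesis using openin_subset by blast
qed

lemma openin_SP_ball: "q \<in> SP \<Longrightarrow> openin (lc_topology P) {y. q (y - a) < e}"
  unfolding openin_lc
proof
  fix x assume q: "q \<in> SP" and "x \<in> {y. q (y - a) < e}"
  then have "e - q (x - a) > 0" by simp
  moreover have "q (y - a) < e" if "q (y - x) < e - q (x - a)" for y
    using SP_add[OF q, of "y - x" "x - a"] that by simp
  ultimately show "\<exists>r\<in>SP. \<exists>d>0. \<forall>y. r (y - x) < d \<longrightarrow> y \<in> {y. q (y - a) < e}" using q by blast
qed

lemma lc_continuous_iff:
  fixes f :: "'a::metric_space \<Rightarrow> 'y"
  shows "continuous_map (top_of_set S) (lc_topology P) f \<longleftrightarrow>
    (\<forall>q\<in>SP. \<forall>x\<in>S. ((\<lambda>w. q (f w - f x)) \<longlongrightarrow> 0) (at x within S))"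
proof
  assume f: "continuous_map (top_of_set S) (lc_topology P) f"
  show "\<forall>q\<in>SP. \<forall>x\<in>S. ((\<lambda>w. q (f w - f x)) \<longlongrightarrow> 0) (at x within S)"
  proof (intro ballI tendstoI)
    fix q x and e :: real assume q: "q \<in> SP" and x: "x \<in> S" and e: "0 < e"
    have "openin (top_of_set S) {w \<in> topspace (top_of_set S). f w \<in> {y. q (y - f x) < e}}"
      using f openin_SP_ball[OF q] by (rule openin_continuous_map_preimage)
    moreover have "x \<in> {w \<in> topspace (top_of_set S). f w \<in> {y. q (y - f x) < e}}"
      using x e SP_zero[OF q] by simp
    ultimately obtain d where d: "d > 0"
        "\<forall>w\<in>S. dist w x < d \<longrightarrow> w \<in> {w \<in> topspace (top_of_set S). f w \<in> {y. q (y - f x) < e}}"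
      unfolding openin_euclidean_subtopology_iff by blast
    have "dist (q (f w - f x)) 0 < e" if "w \<in> S" "dist w x < d" for w
      using d(2) that SP_nonneg[OF q] by simp
    then show "\<forall>\<^sub>F w in at x within S. dist (q (f w - f x)) 0 < e"
      using d(1) unfolding eventually_at by blast
  qed
next
  assume f: "\<forall>q\<in>SP. \<forall>x\<in>S. ((\<lambda>w. q (f w - f x)) \<longlongrightarrow> 0) (at x within S)"
  show "continuous_map (top_of_set S) (lc_topology P) f"
    unfolding continuous_map openin_euclidean_subtopology_iff
  proof (intro conjI allI impI ballI)
    fix U x assume U: "openin (lc_topology P) U" and x: "x \<in> {x \<in> topspace (top_of_set S). f x \<in> U}"
    then obtain q e where q: "q \<in> SP" "e > 0" "\<And>y. q (y - f x) < e \<Longrightarrow> y \<in> U"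
      unfolding openin_lc by blast
    have "((\<lambda>w. q (f w - f x)) \<longlongrightarrow> 0) (at x within S)" using f q(1) x by auto
    then have "\<forall>\<^sub>F w in at x within S. dist (q (f w - f x)) 0 < e" using q(2) by (rule tendstoD)
    then obtain d where d: "d > 0" "\<And>w. w \<in> S \<Longrightarrow> w \<noteq> x \<Longrightarrow> dist w x < d \<Longrightarrow> q (f w - f x) < e"
    proof -
      assume *: "\<And>d. d > 0 \<Longrightarrow> (\<And>w. w \<in> S \<Longrightarrow> w \<noteq> x \<Longrightarrow> dist w x < d \<Longrightarrow> q (f w - f x) < e) \<Longrightarrow> thesis"
      assume "\<forall>\<^sub>F w in at x within S. dist (q (f w - f x)) 0 < e"
      then obtain d where "d > 0" "\<forall>w\<in>S. w \<noteq> x \<and> dist w x < d \<longrightarrow> dist (q (f w - f x)) 0 < e"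
        unfolding eventually_at by blast
      then show thesis by (intro *[of d]) (auto simp: dist_norm)
    qed
    show "\<exists>d>0. \<forall>x'\<in>S. dist x' x < d \<longrightarrow> x' \<in> {x \<in> topspace (top_of_set S). f x \<in> U}"
    proof (intro exI[of _ d] conjI ballI impI d(1))
      fix w assume "w \<in> S" "dist w x < d"
      then show "w \<in> {x \<in> topspace (top_of_set S). f x \<in> U}" using d(2)[of w] q(3) x by (cases "w = x") auto
    qed
  qed (use topspace_lc in auto)
qed

lemma functional_continuous_iff:
  assumes D: "openin (lc_topology P) D"
  shows "continuous_map (subtopology (lc_topology P) D) euclidean g \<longleftrightarrow>
    (\<forall>y\<in>D. \<forall>\<epsilon>>0. \<exists>q\<in>SP. \<exists>d>0. \<forall>y'. q (y' - y) < d \<longrightarrow> y' \<in> D \<and> dist (g y') (g y) < \<epsilon>)"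
    (is "?l \<longleftrightarrow> ?r")
proof
  assume g: ?l
  show ?r
  proof (intro ballI allI impI)
    fix y and \<epsilon> :: real assume y: "y \<in> D" and \<epsilon>: "\<epsilon> > 0"
    have "openin (subtopology (lc_topology P) D)
        {x \<in> topspace (subtopology (lc_topology P) D). g x \<in> ball (g y) \<epsilon>}"
      using g by (rule openin_continuous_map_preimage) (simp flip: open_openin)
    then have "openin (lc_topology P) {x \<in> D. g x \<in> ball (g y) \<epsilon>}"
      using D by (simp add: openin_open_subtopology)
    moreover have "y \<in> {x \<in> D. g x \<in> ball (g y) \<epsilon>}" using y \<epsilon> by simp
    ultimately obtain q d where "q \<in> SP" "d > 0"
        "\<forall>y'. q (y' - y) < d \<longrightarrow> y' \<in> {x \<in> D. g x \<in> ball (g y) \<epsilon>}"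
      unfolding openin_lc by blast
    then show "\<exists>q\<in>SP. \<exists>d>0. \<forall>y'. q (y' - y) < d \<longrightarrow> y' \<in> D \<and> dist (g y') (g y) < \<epsilon>"
      by (intro bexI[of _ q] exI[of _ d]) (auto simp: dist_commute)
  qed
next
  assume r: ?r
  have "openin (lc_topology P) {x \<in> D. g x \<in> U}" if U: "open U" for U
    unfolding openin_lc
  proof
    fix x assume x: "x \<in> {x \<in> D. g x \<in> U}"
    then obtain \<epsilon> where "\<epsilon> > 0" "ball (g x) \<epsilon> \<subseteq> U" using openE[OF U, of "g x"] by blast
    then show "\<exists>q\<in>SP. \<exists>e>0. \<forall>y. q (y - x) < e \<longrightarrow> y \<in> {x \<in> D. g x \<in> U}"
    proof -
      assume e: "\<epsilon> > 0" "ball (g x) \<epsilon> \<subseteq> U"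
      obtain q d where "q \<in> SP" "d > 0" "\<And>y'. q (y' - x) < d \<Longrightarrow> y' \<in> D \<and> dist (g y') (g x) < \<epsilon>"
        using bspec[OF r, of x] x e(1) by blast
      moreover have "a \<in> U" if "dist a (g x) < \<epsilon>" for a using e(2) that by (auto simp: dist_commute)
      ultimately show ?thesis by (intro bexI[of _ q] exI[of _ d]) auto
    qed
  qed
  then show ?l unfolding continuous_map openin_open_subtopology[OF D]
    by (auto simp: open_openin[symmetric])
qed

text \<open>The local radius \<open>2 * d\<close> at the centre \<open>c\<close> of a finite
  subcover splits into one \<open>d\<close> for \<open>f z - f c\<close> and one for the increment
  \<open>y\<close>; both values of \<open>g\<close> are compared with \<open>g (f c)\<close>, whence
  \<open>\<epsilon> / 2\<close>. A single seminorm dominating the finitely many local ones serves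
  all of \<open>L\<close>.\<close>

lemma uniform_near_compact:
  fixes f :: "'a::metric_space \<Rightarrow> 'y"
  assumes L: "compact L" and f: "continuous_map (top_of_set L) (lc_topology P) f" "f ` L \<subseteq> D"
    and D: "openin (lc_topology P) D"
    and g: "continuous_map (subtopology (lc_topology P) D) euclidean g" and \<epsilon>: "\<epsilon> > 0"
  obtains q d where "q \<in> SP" "d > 0"
    "\<And>z y. z \<in> L \<Longrightarrow> q y < d \<Longrightarrow> f z + y \<in> D \<and> dist (g (f z + y)) (g (f z)) < \<epsilon>"
proof -
  have "\<exists>q d. q \<in> SP \<and> d > 0 \<and> (\<forall>y. q (y - f z) < 2 * d \<longrightarrow> y \<in> D \<and> dist (g y) (g (f z)) < \<epsilon> / 2)"
    if "z \<in> L" for z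
  proof -
    have "f z \<in> D" "\<epsilon> / 2 > 0" using f(2) that \<epsilon> by auto
    then obtain q d where "q \<in> SP" "d > 0"
        "\<forall>y. q (y - f z) < d \<longrightarrow> y \<in> D \<and> dist (g y) (g (f z)) < \<epsilon> / 2"
      using g unfolding functional_continuous_iff[OF D] by blast
    then show ?thesis by (intro exI[of _ q] exI[of _ "d / 2"]) auto
  qed
  then obtain q d where qd: "\<forall>z\<in>L. q z \<in> SP \<and> d z > 0 \<and>
      (\<forall>y. q z (y - f z) < 2 * d z \<longrightarrow> y \<in> D \<and> dist (g y) (g (f z)) < \<epsilon> / 2)"
    by metis
  then have q: "\<And>z. z \<in> L \<Longrightarrow> q z \<in> SP" "\<And>z. z \<in> L \<Longrightarrow> d z > 0"
      "\<And>z y. z \<in> L \<Longrightarrow> q z (y - f z) < 2 * d z \<Longrightarrow> y \<in> D \<and> dist (g y) (g (f z)) < \<epsilon> / 2"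
    by auto
  have "\<forall>z\<in>L. \<exists>r. r > 0 \<and> (\<forall>w\<in>L. dist w z < r \<longrightarrow> q z (f w - f z) < d z)"
  proof
    fix z assume z: "z \<in> L"
    have "((\<lambda>w. q z (f w - f z)) \<longlongrightarrow> 0) (at z within L)"
      using f(1) z q(1) unfolding lc_continuous_iff by blast
    then have "\<forall>\<^sub>F w in at z within L. dist (q z (f w - f z)) 0 < d z" using q(2) z tendstoD by blast
    then obtain r where "r > 0" "\<And>w. w \<in> L \<Longrightarrow> w \<noteq> z \<Longrightarrow> dist w z < r \<Longrightarrow> q z (f w - f z) < d z"
      using SP_nonneg[OF q(1)[OF z]] by (auto simp: eventually_at)
    moreover have "q z (f z - f z) < d z" using q(1,2)[OF z] SP_zero[of "q z"] by simp
    ultimately have "q z (f w - f z) < d z" if "w \<in> L" "dist w z < r" for w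
      using that by (cases "w = z") auto
    then show "\<exists>r. r > 0 \<and> (\<forall>w\<in>L. dist w z < r \<longrightarrow> q z (f w - f z) < d z)"
      using \<open>r > 0\<close> by blast
  qed
  from bchoice[OF this] obtain r
    where "\<forall>z\<in>L. r z > 0 \<and> (\<forall>w\<in>L. dist w z < r z \<longrightarrow> q z (f w - f z) < d z)" ..
  then have r: "\<And>z. z \<in> L \<Longrightarrow> r z > 0"
      "\<And>z w. z \<in> L \<Longrightarrow> w \<in> L \<Longrightarrow> dist w z < r z \<Longrightarrow> q z (f w - f z) < d z" by auto
  obtain C where C: "C \<subseteq> L" "finite C" "L \<subseteq> (\<Union>c\<in>C. ball c (r c))"
  proof (rule compactE_image[OF L, of L "\<lambda>c. ball c (r c)"])
    show "L \<subseteq> (\<Union>c\<in>L. ball c (r c))" using r(1) by force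
  qed auto
  obtain Q where Q: "Q \<in> SP" "\<And>c x. c \<in> C \<Longrightarrow> q c x \<le> Q x"
  proof (rule SP_dominating[of "q ` C"])
    show "q ` C \<subseteq> SP" using C(1) q(1) by auto
  qed (use C(2) in auto)
  define \<delta> where "\<delta> = Min (insert 1 (d ` C))"
  have \<delta>: "\<delta> > 0" "\<And>c. c \<in> C \<Longrightarrow> \<delta> \<le> d c" using C q(2) by (auto simp: \<delta>_def)
  show thesis
  proof (rule that[OF Q(1) \<delta>(1)])
    fix z y assume z: "z \<in> L" and y: "Q y < \<delta>"
    obtain c where c: "c \<in> C" "dist z c < r c" using C(3) z by (auto simp: dist_commute)
    then have cL: "c \<in> L" using C by auto
    have 1: "q c (f z - f c) < d c" using r(2)[OF cL z c(2)] .
    have "q c y < d c" using Q(2)[OF c(1), of y] \<delta>(2)[OF c(1)] y by linarith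
    then have "q c (f z + y - f c) < 2 * d c"
      using SP_add[OF q(1)[OF cL], of "f z - f c" y] 1 by (simp add: algebra_simps)
    from q(3)[OF cL this] have "f z + y \<in> D" "dist (g (f z + y)) (g (f c)) < \<epsilon> / 2" by auto
    moreover have "dist (g (f z)) (g (f c)) < \<epsilon> / 2"
      using q(3)[OF cL, of "f z"] 1 q(2)[OF cL] by linarith
    ultimately show "f z + y \<in> D \<and> dist (g (f z + y)) (g (f z)) < \<epsilon>"
      using dist_triangle2[of "g (f z + y)" "g (f z)" "g (f c)"] by linarith
  qed
qed

lemma lc_dual_continuous:
  assumes "Vector_Spaces.linear sc (*) \<phi>" "q \<in> SP" "\<And>x. cmod (\<phi> x) \<le> q x"
  shows "lc_dual sc P \<phi>"
  unfolding lc_dual_def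
proof
  have diff: "\<phi> (x - y) = \<phi> x - \<phi> y" for x y
    using assms(1) by (simp add: Vector_Spaces.linear_iff module_hom_iff)
      (metis add_diff_cancel diff_add_cancel)
  have "continuous_map (subtopology (lc_topology P) UNIV) euclidean \<phi>"
  proof (subst functional_continuous_iff; (intro ballI allI impI)?)
    show "openin (lc_topology P) UNIV" using openin_topspace[of "lc_topology P"] by simp
    fix y :: 'y and \<epsilon> :: real assume "0 < \<epsilon>"
    then show "\<exists>q\<in>SP. \<exists>d>0. \<forall>y'. q (y' - y) < d \<longrightarrow> y' \<in> UNIV \<and> dist (\<phi> y') (\<phi> y) < \<epsilon>"
      using assms(2) le_less_trans[OF assms(3)]
      by (intro bexI[of _ q] exI[of _ \<epsilon>]) (auto simp: dist_norm simp flip: diff)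
  qed
  then show "continuous_map (lc_topology P) euclidean \<phi>" by (simp add: subtopology_UNIV)
qed (use assms in auto)

text \<open>An estimate of \<open>\<phi>\<close> valid for all functionals with
  \<open>cmod (\<phi> x) \<le> q x\<close> becomes an estimate in \<open>q\<close> once
  \<open>\<phi>\<close> is chosen to attain \<open>q\<close> at the vector in question.\<close>

lemma norming_functional:
  assumes "q \<in> SP"
  obtains \<phi> where "lc_dual sc P \<phi>" "Vector_Spaces.linear sc (*) \<phi>" "\<And>x. cmod (\<phi> x) \<le> q x"
    "\<phi> a = of_real (q a)"
  using hahn_banach[OF SP_seminorm[OF assms], of a] lc_dual_continuous[OF _ assms] by metis

section \<open>Strong differentiability of weakly holomorphic curves\<close>

definition weak_hol :: "complex set \<Rightarrow> (complex \<Rightarrow> 'y) \<Rightarrow> bool" where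
  "weak_hol U f \<longleftrightarrow> continuous_map (top_of_set U) (lc_topology P) f \<and>
     (\<forall>\<phi>. lc_dual sc P \<phi> \<longrightarrow> (\<lambda>t. \<phi> (f t)) holomorphic_on U)"

lemma SP_bounded_on_compact:
  fixes f :: "'a::metric_space \<Rightarrow> 'y"
  assumes "compact L" "continuous_map (top_of_set L) (lc_topology P) f" "q \<in> SP"
  obtains M where "\<And>z. z \<in> L \<Longrightarrow> q (f z) \<le> M"
proof -
  have "continuous_on L (\<lambda>z. q (f z))"
    unfolding continuous_on_def
  proof
    fix x assume x: "x \<in> L"
    have "((\<lambda>w. q (f w - f x)) \<longlongrightarrow> 0) (at x within L)"
      using assms(2,3) x unfolding lc_continuous_iff by blast
    then have "((\<lambda>w. q (f w) - q (f x)) \<longlongrightarrow> 0) (at x within L)"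
      by (rule Lim_null_comparison[rotated]) (use SP_diff[OF assms(3)] in auto)
    then show "((\<lambda>z. q (f z)) \<longlongrightarrow> q (f x)) (at x within L)" by (rule Lim_null[THEN iffD2])
  qed
  then have "bounded ((\<lambda>z. q (f z)) ` L)" using assms(1) compact_continuous_image compact_imp_bounded by blast
  then obtain M where "\<forall>x\<in>(\<lambda>z. q (f z)) ` L. norm x \<le> M" unfolding bounded_iff by blast
  then show thesis using that[of M] by force
qed

lemma continuous_map_subset:
  "continuous_map (top_of_set S) X f \<Longrightarrow> T \<subseteq> S \<Longrightarrow> continuous_map (top_of_set T) X f"
  using continuous_map_from_subtopology_mono by blast

text \<open>The functional is chosen to norm the difference of the two quotients and hence depends
  on \<open>h\<close> and \<open>k\<close>. The constant does not: whatever the functional, its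
  composition with \<open>f\<close> is bounded by a bound of \<open>q (f z)\<close> on the closed
  disc.\<close>

lemma weak_hol_quotient_Cauchy:
  assumes f: "weak_hol U f" and U: "cball \<zeta> \<rho> \<subseteq> U" "0 < \<rho>" and q: "q \<in> SP"
  obtains C where "C \<ge> 0" "\<And>h k. h \<noteq> 0 \<Longrightarrow> k \<noteq> 0 \<Longrightarrow> cmod h < \<rho> / 4 \<Longrightarrow> cmod k < \<rho> / 4 \<Longrightarrow>
    q (sc (1 / h) (f (\<zeta> + h) - f \<zeta>) - sc (1 / k) (f (\<zeta> + k) - f \<zeta>)) \<le> C * (cmod h + cmod k)"
proof -
  have "continuous_map (top_of_set (cball \<zeta> \<rho>)) (lc_topology P) f"
    using f U(1) continuous_map_subset unfolding weak_hol_def by blast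
  then obtain M where M: "\<And>z. z \<in> cball \<zeta> \<rho> \<Longrightarrow> q (f z) \<le> M"
    using SP_bounded_on_compact[OF compact_cball _ q] by blast
  have M0: "0 \<le> M" using M[of \<zeta>] SP_nonneg[OF q, of "f \<zeta>"] U(2) by simp
  show thesis
  proof (rule that)
    show "0 \<le> 32 * M / \<rho>\<^sup>2" using M0 by simp
    fix h k :: complex assume hk: "h \<noteq> 0" "k \<noteq> 0" "cmod h < \<rho> / 4" "cmod k < \<rho> / 4"
    define v where "v h = sc (1 / h) (f (\<zeta> + h) - f \<zeta>)" for h
    obtain \<phi> where \<phi>: "lc_dual sc P \<phi>" "Vector_Spaces.linear sc (*) \<phi>" "\<And>x. cmod (\<phi> x) \<le> q x"
      "\<phi> (v h - v k) = of_real (q (v h - v k))"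
      using norming_functional[OF q] by metis
    have add: "\<phi> (x + y) = \<phi> x + \<phi> y" and scal: "\<phi> (sc c x) = c * \<phi> x" for x y c
      using \<phi>(2) by (auto simp: Vector_Spaces.linear_iff)
    have diff: "\<phi> (x - y) = \<phi> x - \<phi> y" for x y using add[of "x - y" y] by simp
    define F where "F t = \<phi> (f t)" for t
    have F: "F holomorphic_on ball \<zeta> \<rho>"
      using f \<phi>(1) U(1) unfolding F_def weak_hol_def by (meson ball_subset_cball holomorphic_on_subset order_trans)
    have FM: "cmod (F t) \<le> M" if "t \<in> ball \<zeta> \<rho>" for t
      using \<phi>(3)[of "f t"] M[of t] that unfolding F_def by fastforce
    have \<phi>v: "\<phi> (v h) = (F (\<zeta> + h) - F \<zeta>) / h" for h by (simp add: v_def scal diff F_def)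
    have "cmod (\<phi> (v h - v k)) \<le> cmod (\<phi> (v h) - deriv F \<zeta>) + cmod (\<phi> (v k) - deriv F \<zeta>)"
      unfolding diff by (metis dist_norm dist_triangle2)
    also have "\<dots> \<le> 32 * M / \<rho>\<^sup>2 * cmod h + 32 * M / \<rho>\<^sup>2 * cmod k"
      unfolding \<phi>v using hk by (intro add_mono difference_quotient_estimate[OF F FM]) auto
    finally show "q (sc (1 / h) (f (\<zeta> + h) - f \<zeta>) - sc (1 / k) (f (\<zeta> + k) - f \<zeta>))
        \<le> 32 * M / \<rho>\<^sup>2 * (cmod h + cmod k)"
      using \<phi>(4) SP_nonneg[OF q] unfolding v_def by (simp add: distrib_left)
  qed
qed

text \<open>Sequential completeness yields a limit along one sequence of increments tending to 0.
  The Cauchy estimate then compares an arbitrary small increment with the members of this sequence,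
  which upgrades it to a limit over all increments.\<close>

lemma weak_hol_differentiable:
  assumes f: "weak_hol U f" and U: "open U" "\<zeta> \<in> U" and sc: "lc_seq_complete P"
  obtains v where
    "\<And>q. q \<in> SP \<Longrightarrow> ((\<lambda>h. q (sc (1 / h) (f (\<zeta> + h) - f \<zeta>) - v)) \<longlongrightarrow> 0) (at 0)"
proof -
  obtain \<rho> where \<rho>: "0 < \<rho>" "cball \<zeta> \<rho> \<subseteq> U" using U open_contains_cball by blast
  define w where "w h = sc (1 / h) (f (\<zeta> + h) - f \<zeta>)" for h
  \<comment> \<open>The factor 1/8 keeps every increment below the \<open>\<rho> / 4\<close>
    required by the Cauchy estimate.\<close>
  define \<eta> where "\<eta> n = complex_of_real (\<rho> / 8 * inverse (real (Suc n)))" for n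
  have \<eta>0: "\<eta> n \<noteq> 0" "cmod (\<eta> n) < \<rho> / 4" for n
  proof -
    show "\<eta> n \<noteq> 0" unfolding \<eta>_def of_real_eq_0_iff using \<rho> by simp
    have "inverse (real (Suc n)) \<le> 1" by (simp add: field_simps)
    then have "\<rho> / 8 * inverse (real (Suc n)) \<le> \<rho> / 8 * 1" using \<rho> by (intro mult_left_mono) auto
    moreover have "cmod (\<eta> n) = \<rho> / 8 * inverse (real (Suc n))"
      unfolding \<eta>_def norm_of_real using \<rho> by simp
    ultimately show "cmod (\<eta> n) < \<rho> / 4" using \<rho> by linarith
  qed
  have "\<eta> \<longlonglongrightarrow> of_real (\<rho> / 8 * 0)"
    unfolding \<eta>_def by (intro tendsto_intros LIMSEQ_inverse_real_of_nat)
  then have \<eta>: "(\<lambda>n. cmod (\<eta> n)) \<longlonglongrightarrow> 0" using tendsto_norm_zero by simp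
  have "\<exists>v. \<forall>p\<in>P. (\<lambda>n. p (w (\<eta> n) - v)) \<longlonglongrightarrow> 0"
    using sc unfolding lc_seq_complete_def
  proof (elim allE[of _ "\<lambda>n. w (\<eta> n)"] mp, intro ballI allI impI)
    fix p and e :: real assume p: "p \<in> P" and e: "0 < e"
    obtain C where C: "C \<ge> 0" "\<And>h k. h \<noteq> 0 \<Longrightarrow> k \<noteq> 0 \<Longrightarrow> cmod h < \<rho> / 4 \<Longrightarrow> cmod k < \<rho> / 4 \<Longrightarrow>
        p (w h - w k) \<le> C * (cmod h + cmod k)"
      using weak_hol_quotient_Cauchy[OF f \<rho>(2,1) P_SP[OF p]] unfolding w_def by blast
    have "\<forall>\<^sub>F n in sequentially. dist (cmod (\<eta> n)) 0 < e / (2 * (C + 1))"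
      by (rule tendstoD[OF \<eta>]) (use e C(1) in simp)
    then obtain N where N: "\<And>n. n \<ge> N \<Longrightarrow> cmod (\<eta> n) < e / (2 * (C + 1))"
      unfolding eventually_sequentially by auto
    show "\<exists>N. \<forall>m\<ge>N. \<forall>n\<ge>N. p (w (\<eta> m) - w (\<eta> n)) < e"
    proof (intro exI[of _ N] allI impI)
      fix m n assume "N \<le> m" "N \<le> n"
      then have s: "cmod (\<eta> m) + cmod (\<eta> n) < e / (C + 1)"
        using N[of m] N[of n] C(1) by (simp add: field_simps)
      have "p (w (\<eta> m) - w (\<eta> n)) \<le> C * (cmod (\<eta> m) + cmod (\<eta> n))" using \<eta>0 by (intro C(2))
      also have "\<dots> \<le> (C + 1) * (cmod (\<eta> m) + cmod (\<eta> n))" by (intro mult_right_mono) auto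
      also have "\<dots> < (C + 1) * (e / (C + 1))" using s C(1) by (intro mult_strict_left_mono) auto
      also have "\<dots> = e" using C(1) by simp
      finally show "p (w (\<eta> m) - w (\<eta> n)) < e" .
    qed
  qed
  then obtain v where v: "\<And>p. p \<in> P \<Longrightarrow> (\<lambda>n. p (w (\<eta> n) - v)) \<longlonglongrightarrow> 0" by blast
  show thesis
  proof (rule that[of v])
    fix q assume q: "q \<in> SP"
    then obtain F where F: "finite F" "F \<subseteq> P" "q = (\<lambda>x. \<Sum>p\<in>F. p x)" by (auto simp: SP_def)
    have "(\<lambda>n. \<Sum>p\<in>F. p (w (\<eta> n) - v)) \<longlonglongrightarrow> (\<Sum>p\<in>F. 0)" using F v by (intro tendsto_sum) auto
    then have qv: "(\<lambda>n. q (w (\<eta> n) - v)) \<longlonglongrightarrow> 0" by (simp add: F(3))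
    obtain C where C: "C \<ge> 0" "\<And>h k. h \<noteq> 0 \<Longrightarrow> k \<noteq> 0 \<Longrightarrow> cmod h < \<rho> / 4 \<Longrightarrow> cmod k < \<rho> / 4 \<Longrightarrow>
        q (w h - w k) \<le> C * (cmod h + cmod k)"
      using weak_hol_quotient_Cauchy[OF f \<rho>(2,1) q] unfolding w_def by blast
    \<comment> \<open>Triangle inequality through \<open>w (\<eta> n)\<close>, then \<open>n\<close>
      tends to infinity.\<close>
    have bound: "q (w h - v) \<le> C * cmod h" if h: "h \<noteq> 0" "cmod h < \<rho> / 4" for h
    proof (rule tendsto_lowerbound)
      show "(\<lambda>n. C * (cmod h + cmod (\<eta> n)) + q (w (\<eta> n) - v)) \<longlonglongrightarrow> C * cmod h"
      proof -
        have "(\<lambda>n. C * (cmod h + cmod (\<eta> n)) + q (w (\<eta> n) - v)) \<longlonglongrightarrow> C * (cmod h + 0) + 0"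
          by (intro tendsto_intros \<eta> qv)
        then show ?thesis by simp
      qed
      have "q (w h - v) \<le> C * (cmod h + cmod (\<eta> n)) + q (w (\<eta> n) - v)" for n
        using SP_add[OF q, of "w h - w (\<eta> n)" "w (\<eta> n) - v"] C(2)[OF h(1) \<eta>0(1)[of n] h(2) \<eta>0(2)[of n]] by simp
      then show "\<forall>\<^sub>F n in sequentially. q (w h - v) \<le> C * (cmod h + cmod (\<eta> n)) + q (w (\<eta> n) - v)"
        by simp
    qed simp
    show "((\<lambda>h. q (sc (1 / h) (f (\<zeta> + h) - f \<zeta>) - v)) \<longlongrightarrow> 0) (at 0)"
      unfolding w_def[symmetric]
    proof (rule Lim_null_comparison)
      show "\<forall>\<^sub>F h in at 0. norm (q (w h - v)) \<le> C * cmod h"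
        unfolding eventually_at using bound \<rho>(1) SP_nonneg[OF q] by (intro exI[of _ "\<rho> / 4"]) auto
      show "((\<lambda>h. C * cmod h) \<longlongrightarrow> 0) (at 0)"
      proof -
        have "((\<lambda>h::complex. C * cmod h) \<longlongrightarrow> C * cmod 0) (at 0)" by (intro tendsto_intros)
        then show ?thesis by simp
      qed
    qed
  qed
qed

lemma gateaux_on_line:
  assumes g: "gateaux_hol sc P D g" and S: "open S" "\<And>t. t \<in> S \<Longrightarrow> y + sc t v \<in> D"
  shows "(\<lambda>t. g (y + sc t v)) holomorphic_on S"
  unfolding holomorphic_on_open[OF S(1)]
proof
  fix t assume t: "t \<in> S"
  obtain r where r: "r > 0" "(\<lambda>s. g ((y + sc t v) + sc s v)) holomorphic_on ball 0 r"
    using g S(2)[OF t] unfolding gateaux_hol_def by blast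
  have eq: "(y + sc t v) + sc s v = y + sc (s + t) v" for s by (simp add: sc_simps add.commute add.left_commute)
  have "((\<lambda>s. g (y + sc (s + t) v)) has_field_derivative deriv (\<lambda>s. g (y + sc (s + t) v)) 0) (at 0)"
    using holomorphic_derivI[OF r(2)[unfolded eq], of 0] r(1) by simp
  then show "\<exists>d. ((\<lambda>t. g (y + sc t v)) has_field_derivative d) (at t)"
    using DERIV_shift[of "\<lambda>t. g (y + sc t v)" _ 0 t] by auto
qed

text \<open>Strong differentiability of \<^term>\<open>f\<close> reduces the chain rule to letting the direction
  \<open>v(h)\<close> vary in \<open>g(y + h v(h))\<close>; the Cauchy estimate makes this uniform.\<close>

lemma gateaux_comp_holomorphic:
  assumes g: "gateaux_hol sc P D g" and D: "openin (lc_topology P) D"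
    and f: "weak_hol U f" "f ` U \<subseteq> D" and U: "open U" and seq: "lc_seq_complete P"
  shows "(\<lambda>t. g (f t)) holomorphic_on U"
  unfolding holomorphic_on_open[OF U]
proof
  fix \<zeta> assume \<zeta>: "\<zeta> \<in> U"
  obtain v where v: "\<And>q. q \<in> SP \<Longrightarrow>
      ((\<lambda>h. q (sc (1 / h) (f (\<zeta> + h) - f \<zeta>) - v)) \<longlongrightarrow> 0) (at 0)"
    using weak_hol_differentiable[OF f(1) U \<zeta> seq] by blast
  define w where "w h = sc (1 / h) (f (\<zeta> + h) - f \<zeta>)" for h
  define y where "y = f \<zeta>"
  have fw: "f (\<zeta> + h) = y + sc h (w h)" if "h \<noteq> 0" for h using that by (simp add: y_def w_def)
  have gc: "continuous_map (subtopology (lc_topology P) D) euclidean g" using g by (simp add: gateaux_hol_def)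
  have yD: "y \<in> D" using f(2) \<zeta> by (auto simp: y_def)
  obtain r where r: "r > 0" "\<And>t. t \<in> ball 0 r \<Longrightarrow> y + sc t v \<in> D"
      "(\<lambda>t. g (y + sc t v)) holomorphic_on ball 0 r"
    using g yD unfolding gateaux_hol_def by blast
  \<comment> \<open>\<open>\<phi>\<close> follows the fixed limiting direction \<open>v\<close>; its
    derivative at 0 will be that of \<open>g (f t)\<close> at \<open>\<zeta>\<close>.\<close>
  define \<phi> where "\<phi> t = g (y + sc t v)" for t
  define \<rho> where "\<rho> = r / 2"
  have \<rho>: "\<rho> > 0" "cball 0 \<rho> \<subseteq> ball 0 r" using r(1) by (auto simp: \<rho>_def)
  have \<phi>: "\<phi> holomorphic_on ball 0 \<rho>"
    unfolding \<phi>_def using r(3) by (rule holomorphic_on_subset) (use \<rho> in auto)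
  have cm: "continuous_map (top_of_set (cball 0 \<rho>)) (lc_topology P) (\<lambda>t. y + sc t v)"
    unfolding lc_continuous_iff
  proof (intro ballI)
    fix q x assume q: "q \<in> SP"
    have "((\<lambda>w. cmod (w - x) * q v) \<longlongrightarrow> cmod (x - x) * q v) (at x within cball 0 \<rho>)"
      by (intro tendsto_intros)
    then show "((\<lambda>w. q (y + sc w v - (y + sc x v))) \<longlongrightarrow> 0) (at x within cball 0 \<rho>)"
      using SP_sc[OF q] by (simp flip: sc_diff_left)
  qed
  have small: "\<forall>\<^sub>F h in at 0. cmod ((g (f (\<zeta> + h)) - \<phi> h) / h) \<le> 4 * \<epsilon> / \<rho>" if \<epsilon>: "\<epsilon> > 0" for \<epsilon>
  proof -
    have "(\<lambda>t. y + sc t v) ` cball 0 \<rho> \<subseteq> D" using r(2) \<rho>(2) by blast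
    then obtain q d where q: "q \<in> SP" "d > 0"
      and near: "\<And>t z. t \<in> cball 0 \<rho> \<Longrightarrow> q z < d \<Longrightarrow>
        y + sc t v + z \<in> D \<and> dist (g (y + sc t v + z)) (g (y + sc t v)) < \<epsilon>"
      using uniform_near_compact[OF compact_cball cm _ D gc \<epsilon>] by metis
    have "\<forall>\<^sub>F h in at 0. dist (q (w h - v)) 0 < d / \<rho>"
      by (rule tendstoD[OF v[OF q(1)], folded w_def]) (use q \<rho> in simp)
    moreover have "\<forall>\<^sub>F h in at 0. h \<noteq> 0 \<and> cmod h < \<rho> / 2"
      unfolding eventually_at by (intro exI[of _ "\<rho> / 2"]) (use \<rho> in auto)
    ultimately show ?thesis
    proof eventually_elim
      case (elim h)
      then have h: "h \<noteq> 0" "cmod h < \<rho> / 2" and qw: "q (w h - v) < d / \<rho>" by auto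
      have near': "y + sc t (w h) \<in> D \<and> dist (g (y + sc t (w h))) (\<phi> t) < \<epsilon>" if t: "t \<in> cball 0 \<rho>" for t
      proof -
        have "q (sc t (w h - v)) \<le> \<rho> * q (w h - v)"
          unfolding SP_sc[OF q(1)] using t SP_nonneg[OF q(1)] by (intro mult_right_mono) auto
        also have "\<dots> < d" using qw \<rho> by (simp add: field_simps)
        finally show ?thesis using near[OF t, of "sc t (w h - v)"] by (simp add: \<phi>_def sc_diff_right)
      qed
      \<comment> \<open>The difference of \<open>g\<close> along the two directions
        \<open>w h\<close> and \<open>v\<close>. It is at most \<open>\<epsilon>\<close> on the
        whole disc and vanishes at 0, so at the parameter \<open>h\<close> it is of order
        \<open>\<epsilon>\<close> times \<open>cmod h\<close>; this is what survives the division by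
        \<open>h\<close>.\<close>
      define k where "k t = g (y + sc t (w h)) - \<phi> t" for t
      have "k holomorphic_on ball 0 \<rho>"
        unfolding k_def using near' by (intro holomorphic_intros \<phi> gateaux_on_line[OF g]) auto
      moreover have "cmod (k t) \<le> \<epsilon>" if "t \<in> ball 0 \<rho>" for t
        using near'[of t] that by (simp add: k_def dist_norm)
      ultimately have "cmod (k h - k 0) \<le> 4 * \<epsilon> / \<rho> * cmod h"
        using h(2) by (intro holomorphic_lipschitz_at_0) auto
      moreover have "k 0 = 0" by (simp add: k_def \<phi>_def)
      ultimately show ?case using h(1) by (simp add: k_def fw norm_divide divide_le_eq)
    qed
  qed
  have "((\<lambda>h. (g (f (\<zeta> + h)) - \<phi> h) / h) \<longlongrightarrow> 0) (at 0)"
  proof (rule tendstoI)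
    fix e :: real assume e: "e > 0"
    \<comment> \<open>With \<open>e * \<rho> / 8\<close> for \<open>\<epsilon>\<close> the bound
      \<open>4 * \<epsilon> / \<rho>\<close> becomes \<open>e / 2\<close>.\<close>
    then have "e * \<rho> / 8 > 0" using \<rho> by simp
    from small[OF this] show "\<forall>\<^sub>F h in at 0. dist ((g (f (\<zeta> + h)) - \<phi> h) / h) 0 < e"
    proof eventually_elim
      case (elim h)
      moreover have "4 * (e * \<rho> / 8) / \<rho> < e" using \<rho>(1) e by (simp add: field_simps)
      ultimately show ?case by (simp add: dist_norm)
    qed
  qed
  moreover have "((\<lambda>h. (\<phi> (0 + h) - \<phi> 0) / h) \<longlongrightarrow> deriv \<phi> 0) (at 0)"
    using holomorphic_derivI[OF \<phi> open_ball, of 0 UNIV] \<rho>(1)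
    unfolding DERIV_def by (simp only: centre_in_ball simp_thms)
  ultimately have "((\<lambda>h. (g (f (\<zeta> + h)) - \<phi> h) / h + (\<phi> (0 + h) - \<phi> 0) / h) \<longlongrightarrow> 0 + deriv \<phi> 0) (at 0)"
    by (rule tendsto_add)
  moreover have "(g (f (\<zeta> + h)) - \<phi> h) / h + (\<phi> (0 + h) - \<phi> 0) / h = (g (f (\<zeta> + h)) - g (f \<zeta>)) / h" for h
    by (simp add: \<phi>_def y_def field_simps diff_divide_distrib)
  ultimately show "\<exists>d. ((\<lambda>t. g (f t)) has_field_derivative d) (at \<zeta>)"
    by (auto simp: DERIV_def)
qed

end

section \<open>Functions holomorphic along complex lines\<close>

text \<open>The counterpart of \<open>gateaux_hol\<close> on subsets of C^n. Differentiability at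
  parameter 0 covers the whole trace of a line in \<open>U\<close>, because each of its points may
  serve as base point. In this form it can be verified by Morera's theorem on single lines.\<close>

definition line_hol :: "(complex ^ 'n) set \<Rightarrow> (complex ^ 'n \<Rightarrow> complex) \<Rightarrow> bool" where
  "line_hol U F \<longleftrightarrow> continuous_on U F \<and>
     (\<forall>z\<in>U. \<forall>v. \<exists>d. ((\<lambda>t. F (z + t *s v)) has_field_derivative d) (at 0))"

lemma line_hol_subset: "line_hol U F \<Longrightarrow> V \<subseteq> U \<Longrightarrow> line_hol V F"
  unfolding line_hol_def using continuous_on_subset by blast

lemma continuous_on_line: "continuous_on S (\<lambda>t. z + t *s (v :: complex ^ 'n))"
  unfolding vector_scalar_mult_def by (intro continuous_intros continuous_on_vec_lambda)

lemma open_line_preimage: "open U \<Longrightarrow> open {t. z + t *s (v :: complex ^ 'n) \<in> U}"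
  using continuous_on_line[of UNIV z v] by (simp add: continuous_on_open_vimage[OF open_UNIV] vimage_def)

lemma line_hol_on_line:
  assumes "line_hol U F" "open S" "\<And>t. t \<in> S \<Longrightarrow> z + t *s v \<in> U"
  shows "(\<lambda>t. F (z + t *s v)) holomorphic_on S"
  unfolding holomorphic_on_open[OF assms(2)]
proof
  fix t assume "t \<in> S"
  then obtain d where "((\<lambda>s. F ((z + t *s v) + s *s v)) has_field_derivative d) (at 0)"
    using assms(1,3) unfolding line_hol_def by blast
  moreover have "(z + t *s v) + s *s v = z + (s + t) *s v" for s
    by (simp add: algebra_simps)
  ultimately show "\<exists>d. ((\<lambda>t. F (z + t *s v)) has_field_derivative d) (at t)"
    using DERIV_shift[of "\<lambda>t. F (z + t *s v)" _ 0 t] by auto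
qed

lemma line_hol_cong_open:
  assumes "line_hol U F" "open U" "\<And>z. z \<in> U \<Longrightarrow> G z = F z"
  shows "line_hol U G"
  unfolding line_hol_def
proof (intro conjI ballI allI)
  show "continuous_on U G" using assms continuous_on_cong[of U U G F] by (simp add: line_hol_def)
  fix z v assume z: "z \<in> U"
  then obtain d where d: "((\<lambda>t. F (z + t *s v)) has_field_derivative d) (at 0)"
    using assms(1) by (auto simp: line_hol_def)
  have "\<forall>\<^sub>F t in nhds 0. t \<in> {t. z + t *s v \<in> U}"
    using open_line_preimage[OF assms(2)] z by (intro eventually_nhds_in_open) auto
  then have ev: "\<forall>\<^sub>F t in nhds 0. G (z + t *s v) = F (z + t *s v)"
    by eventually_elim (use assms(3) in auto)
  show "\<exists>d. ((\<lambda>t. G (z + t *s v)) has_field_derivative d) (at 0)"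
    using d DERIV_cong_ev[OF refl ev refl] by auto
qed

lemma line_hol_local:
  assumes "\<And>z. z \<in> U \<Longrightarrow> \<exists>V. open V \<and> z \<in> V \<and> line_hol V F"
  shows "line_hol U F"
  unfolding line_hol_def
proof (intro conjI ballI allI)
  show "continuous_on U F"
  proof (rule continuous_at_imp_continuous_on, rule ballI)
    fix z assume "z \<in> U"
    then obtain V where "open V" "z \<in> V" "line_hol V F" using assms by blast
    then show "isCont F z" by (auto simp: line_hol_def continuous_on_eq_continuous_at)
  qed
qed (use assms in \<open>auto simp: line_hol_def\<close>)

lemma line_hol_const_mult: "line_hol U F \<Longrightarrow> line_hol U (\<lambda>z. c * F z)"
  unfolding line_hol_def using DERIV_cmult by (auto intro!: continuous_intros) blast

lemma line_hol_diff: "line_hol U F \<Longrightarrow> line_hol U G \<Longrightarrow> line_hol U (\<lambda>z. F z - G z)"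
  unfolding line_hol_def using DERIV_diff by (auto intro!: continuous_intros) blast

lemma line_hol_sum:
  assumes "finite A" "\<And>x. x \<in> A \<Longrightarrow> line_hol U (F x)"
  shows "line_hol U (\<lambda>z. \<Sum>x\<in>A. F x z)"
  using assms
proof (induction A rule: finite_induct)
  case (insert x A)
  have "line_hol U (\<lambda>z. F x z + (\<Sum>x\<in>A. F x z))" if "line_hol U (F x)" "line_hol U (\<lambda>z. \<Sum>x\<in>A. F x z)"
    using that unfolding line_hol_def using DERIV_add by (auto intro!: continuous_intros) blast
  then show ?case using insert by simp
qed (auto simp: line_hol_def intro!: exI[of _ 0])

text \<open>The interior of the zero set is relatively closed: a ball about a limit point contains
  some \<open>y\<close> of it, any \<open>w\<close> in the ball lies on a complex line through
  \<open>y\<close> whose trace in the ball is convex, and the one-variable identity theorem carries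
  the zeros from near \<open>y\<close> to \<open>w\<close>.\<close>

lemma line_hol_identity:
  assumes F: "line_hol U F" and U: "open U" "connected U"
    and W: "open W" "W \<noteq> {}" "W \<subseteq> U" "\<And>z. z \<in> W \<Longrightarrow> F z = 0" and z: "z \<in> U"
  shows "F z = 0"
proof -
  define Z where "Z = interior {z \<in> U. F z = 0}"
  have WZ: "W \<subseteq> Z" unfolding Z_def using W by (intro interior_maximal) auto
  have ZU: "Z \<subseteq> U" unfolding Z_def using interior_subset by blast
  have "closedin (top_of_set U) Z"
    unfolding closedin_limpt
  proof (intro conjI allI impI ZU)
    fix x assume x: "x islimpt Z \<and> x \<in> U"
    then obtain r where r: "r > 0" "ball x r \<subseteq> U" using U(1) openE by blast
    obtain y where y: "y \<in> Z" "y \<in> ball x r"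
      using x r(1) by (meson centre_in_ball islimptE open_ball)
    have "F w = 0" if w: "w \<in> ball x r" for w
    proof -
      define S where "S = {t. y + t *s (w - y) \<in> ball x r}"
      define N where "N = {t. y + t *s (w - y) \<in> Z \<inter> ball x r}"
      have oN: "open N" unfolding N_def Z_def by (intro open_line_preimage) auto
      have oS: "open S" unfolding S_def by (intro open_line_preimage) auto
      have "convex S"
        unfolding convex_alt S_def
      proof (intro ballI allI impI)
        fix s t u assume "s \<in> {t. y + t *s (w - y) \<in> ball x r}" "t \<in> {t. y + t *s (w - y) \<in> ball x r}"
          and u: "0 \<le> u \<and> u \<le> (1::real)"
        then have st: "y + s *s (w - y) \<in> ball x r" "y + t *s (w - y) \<in> ball x r" by blast+
        have "y + ((1 - u) *\<^sub>R s + u *\<^sub>R t) *s (w - y) =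
            (1 - u) *\<^sub>R (y + s *s (w - y)) + u *\<^sub>R (y + t *s (w - y))"
          by (simp add: vec_eq_iff scaleR_conv_of_real[where 'a = complex] algebra_simps)
        moreover have "(1 - u) *\<^sub>R (y + s *s (w - y)) + u *\<^sub>R (y + t *s (w - y)) \<in> ball x r"
          using st u convex_ball[of x r, unfolded convex_alt] by blast
        ultimately show "(1 - u) *\<^sub>R s + u *\<^sub>R t \<in> {t. y + t *s (w - y) \<in> ball x r}"
          unfolding mem_Collect_eq by metis
      qed
      then have cS: "connected S" by (rule convex_connected)
      have hol: "(\<lambda>t. F (y + t *s (w - y))) holomorphic_on S"
        using oS r(2) by (intro line_hol_on_line[OF F]) (auto simp: S_def)
      have 0: "0 \<in> N" "0 \<in> S" "1 \<in> S" using y w by (auto simp: N_def S_def)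
      have N0: "F (y + t *s (w - y)) = 0" if "t \<in> N" for t
        using that interior_subset unfolding N_def Z_def by blast
      have "F (y + 1 *s (w - y)) = 0"
      proof (rule analytic_continuation[OF hol oS cS _ 0(2) _ N0 0(3)])
        show "N \<subseteq> S" by (auto simp: N_def S_def)
        show "0 islimpt N" using oN 0(1) by (rule interior_limit_point[OF interior_open[THEN equalityD2, THEN subsetD]])
      qed
      then show ?thesis by simp
    qed
    then have "ball x r \<subseteq> Z" unfolding Z_def using r(2) by (intro interior_maximal) auto
    then show "x \<in> Z" using r(1) by auto
  qed
  moreover have "openin (top_of_set U) Z" using ZU by (simp add: Z_def openin_open_eq U(1))
  ultimately have "Z = U" using U(2) W(2) WZ unfolding connected_clopen by blast
  then show ?thesis using z interior_subset unfolding Z_def by blast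
qed

subsection \<open>Integrals with a parameter\<close>

lemma continuous_on_contour_integral_linepath:
  assumes "continuous_on (U \<times> closed_segment a b) (\<lambda>(x, \<zeta>). \<Phi> x \<zeta>)"
  shows "continuous_on U (\<lambda>x. contour_integral (linepath a b) (\<Phi> x))"
proof -
  have "continuous_on (U \<times> cbox 0 (1::real)) (\<lambda>(x, t). \<Phi> x (linepath a b t) * (b - a))"
  proof -
    have "continuous_on (U \<times> cbox 0 (1::real)) ((\<lambda>(x, \<zeta>). \<Phi> x \<zeta>) \<circ> (\<lambda>(x, t). (x, linepath a b t)))"
    proof (rule continuous_on_compose)
      show "continuous_on (U \<times> cbox 0 (1::real)) (\<lambda>(x, t). (x, linepath a b t))"
        unfolding linepath_def case_prod_unfold by (intro continuous_intros)
      show "continuous_on ((\<lambda>(x, t). (x, linepath a b t)) ` (U \<times> cbox 0 1)) (\<lambda>(x, \<zeta>). \<Phi> x \<zeta>)"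
        using assms by (rule continuous_on_subset) (auto simp: linepath_in_path)
    qed
    then have "continuous_on (U \<times> cbox 0 (1::real)) (\<lambda>(x, t). \<Phi> x (linepath a b t))"
      by (simp add: o_def case_prod_unfold)
    then show ?thesis unfolding case_prod_unfold by (intro continuous_intros)
  qed
  then have "continuous_on U (\<lambda>x. integral (cbox 0 1) (\<lambda>t. \<Phi> x (linepath a b t) * (b - a)))"
    by (rule integral_continuous_on_param)
  then show ?thesis unfolding contour_integral_integral by simp
qed

text \<open>Morera's theorem: around a triangle the order of integration may be exchanged, and for
  each fixed \<open>\<zeta>\<close> the inner integrals sum to zero by Cauchy's theorem.\<close>

lemma holomorphic_on_contour_integral_linepath:
  assumes U: "open U" and c: "continuous_on (U \<times> closed_segment a b) (\<lambda>(t, \<zeta>). \<Phi> t \<zeta>)"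
    and h: "\<And>\<zeta>. \<zeta> \<in> closed_segment a b \<Longrightarrow> (\<lambda>t. \<Phi> t \<zeta>) holomorphic_on U"
  shows "(\<lambda>t. contour_integral (linepath a b) (\<Phi> t)) holomorphic_on U"
proof -
  have "(\<lambda>t. contour_integral (linepath a b) (\<Phi> t)) analytic_on U"
  proof (rule Morera_triangle[OF continuous_on_contour_integral_linepath[OF c] U], rule impI)
    fix x y z assume sub: "convex hull {x, y, z} \<subseteq> U"
    have seg: "closed_segment x y \<subseteq> U" "closed_segment y z \<subseteq> U" "closed_segment z x \<subseteq> U"
      using sub segments_subset_convex_hull(1)[of x y z] segments_subset_convex_hull(3)[of y z x]
        segments_subset_convex_hull(5)[of z x y]
      by blast+
    have swap: "contour_integral (linepath u v) (\<lambda>t. contour_integral (linepath a b) (\<Phi> t)) =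
        contour_integral (linepath a b) (\<lambda>\<zeta>. contour_integral (linepath u v) (\<lambda>t. \<Phi> t \<zeta>))"
      if "closed_segment u v \<subseteq> U" for u v
      using continuous_on_subset[OF c, of "closed_segment u v \<times> closed_segment a b"] that
      by (intro contour_integral_swap) auto
    have ci: "(\<lambda>\<zeta>. contour_integral (linepath u v) (\<lambda>t. \<Phi> t \<zeta>)) contour_integrable_on linepath a b"
      if "closed_segment u v \<subseteq> U" for u v
    proof (rule contour_integrable_continuous_linepath, rule continuous_on_contour_integral_linepath)
      have "continuous_on (closed_segment u v \<times> closed_segment a b) (\<lambda>(t, \<zeta>). \<Phi> t \<zeta>)"
        by (rule continuous_on_subset[OF c]) (use that in blast)
      then show "continuous_on (closed_segment a b \<times> closed_segment u v) (\<lambda>(\<zeta>, t). \<Phi> t \<zeta>)"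
        by (rule continuous_on_swap_args[of _ _ "\<lambda>t \<zeta>. \<Phi> t \<zeta>"])
    qed
    have zero: "contour_integral (linepath x y) (\<lambda>t. \<Phi> t \<zeta>) + contour_integral (linepath y z) (\<lambda>t. \<Phi> t \<zeta>)
        + contour_integral (linepath z x) (\<lambda>t. \<Phi> t \<zeta>) = 0" if \<zeta>: "\<zeta> \<in> closed_segment a b" for \<zeta>
    proof -
      have hc: "(\<lambda>t. \<Phi> t \<zeta>) holomorphic_on convex hull {x, y, z}" using h[OF \<zeta>] sub by (rule holomorphic_on_subset)
      have cs: "(\<lambda>t. \<Phi> t \<zeta>) contour_integrable_on linepath u v" if "closed_segment u v \<subseteq> U" for u v
        using h[OF \<zeta>] that by (intro contour_integrable_continuous_linepath holomorphic_on_imp_continuous_on)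
          (auto intro: holomorphic_on_subset)
      show ?thesis
        using contour_integral_unique[OF Cauchy_theorem_triangle[OF hc]] cs seg by (simp add: add.assoc)
    qed
    have "contour_integral (linepath x y) (\<lambda>t. contour_integral (linepath a b) (\<Phi> t)) +
        contour_integral (linepath y z) (\<lambda>t. contour_integral (linepath a b) (\<Phi> t)) +
        contour_integral (linepath z x) (\<lambda>t. contour_integral (linepath a b) (\<Phi> t)) =
        contour_integral (linepath a b) (\<lambda>\<zeta>. contour_integral (linepath x y) (\<lambda>t. \<Phi> t \<zeta>) +
          contour_integral (linepath y z) (\<lambda>t. \<Phi> t \<zeta>) + contour_integral (linepath z x) (\<lambda>t. \<Phi> t \<zeta>))"
      using seg by (simp add: swap ci contour_integral_add contour_integrable_add)
    also have "\<dots> = contour_integral (linepath a b) (\<lambda>\<zeta>. 0)"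
      by (rule contour_integral_cong[OF refl]) (use zero in simp)
    finally show "contour_integral (linepath x y) (\<lambda>t. contour_integral (linepath a b) (\<Phi> t)) +
        contour_integral (linepath y z) (\<lambda>t. contour_integral (linepath a b) (\<Phi> t)) +
        contour_integral (linepath z x) (\<lambda>t. contour_integral (linepath a b) (\<Phi> t)) = 0"
      by simp
  qed
  then show ?thesis by (rule analytic_imp_holomorphic)
qed

lemma line_hol_contour_integral_linepath:
  assumes U: "open U" and c: "continuous_on (U \<times> closed_segment a b) (\<lambda>(z, \<zeta>). \<Phi> z \<zeta>)"
    and h: "\<And>\<zeta>. \<zeta> \<in> closed_segment a b \<Longrightarrow> line_hol U (\<lambda>z. \<Phi> z \<zeta>)"
  shows "line_hol U (\<lambda>z. contour_integral (linepath a b) (\<Phi> z))"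
  unfolding line_hol_def
proof (intro conjI ballI allI)
  show "continuous_on U (\<lambda>z. contour_integral (linepath a b) (\<Phi> z))"
    by (rule continuous_on_contour_integral_linepath[OF c])
  fix z v assume z: "z \<in> U"
  define S where "S = {t. z + t *s v \<in> U}"
  have S: "open S" unfolding S_def by (rule open_line_preimage[OF U])
  have "(\<lambda>t. contour_integral (linepath a b) (\<Phi> (z + t *s v))) holomorphic_on S"
  proof (rule holomorphic_on_contour_integral_linepath[OF S])
    have "continuous_on (S \<times> closed_segment a b) ((\<lambda>(z, \<zeta>). \<Phi> z \<zeta>) \<circ> (\<lambda>(t, \<zeta>). (z + t *s v, \<zeta>)))"
    proof (rule continuous_on_compose)
      have "continuous_on (S \<times> closed_segment a b) ((\<lambda>t. z + t *s v) \<circ> fst)"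
        by (intro continuous_on_compose continuous_on_fst continuous_on_id continuous_on_line)
      then have "continuous_on (S \<times> closed_segment a b) (\<lambda>p. (z + fst p *s v, snd p))"
        unfolding o_def by (rule continuous_on_Pair) (intro continuous_on_snd continuous_on_id)
      then show "continuous_on (S \<times> closed_segment a b) (\<lambda>(t, \<zeta>). (z + t *s v, \<zeta>))"
        by (simp add: case_prod_unfold)
      show "continuous_on ((\<lambda>(t, \<zeta>). (z + t *s v, \<zeta>)) ` (S \<times> closed_segment a b)) (\<lambda>(z, \<zeta>). \<Phi> z \<zeta>)"
        using c by (rule continuous_on_subset) (auto simp: S_def)
    qed
    then show "continuous_on (S \<times> closed_segment a b) (\<lambda>(t, \<zeta>). \<Phi> (z + t *s v) \<zeta>)"
      by (simp add: o_def case_prod_unfold)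
    show "(\<lambda>t. \<Phi> (z + t *s v) \<zeta>) holomorphic_on S" if "\<zeta> \<in> closed_segment a b" for \<zeta>
      using line_hol_on_line[OF h[OF that] S] by (auto simp: S_def)
  qed
  moreover have "0 \<in> S" using z by (simp add: S_def)
  ultimately show "\<exists>d. ((\<lambda>t. contour_integral (linepath a b) (\<Phi> (z + t *s v))) has_field_derivative d) (at 0)"
    unfolding holomorphic_on_open[OF S] by blast
qed

section \<open>Cauchy integrals over square grids\<close>

locale grid =
  fixes c :: complex and \<delta> :: real
  assumes \<delta>: "0 < \<delta>"
begin

definition pt :: "int \<times> int \<Rightarrow> complex" where
  "pt x = c + of_real \<delta> * Complex (of_int (fst x)) (of_int (snd x))"

definition right :: "int \<times> int \<Rightarrow> int \<times> int" where "right x = (fst x + 1, snd x)"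

definition up :: "int \<times> int \<Rightarrow> int \<times> int" where "up x = (fst x, snd x + 1)"

definition square :: "int \<times> int \<Rightarrow> complex set" where
  "square x = cbox (pt x) (pt (right (up x)))"

definition hor :: "int \<times> int \<Rightarrow> (complex \<Rightarrow> complex) \<Rightarrow> complex" where
  "hor x G = contour_integral (linepath (pt x) (pt (right x))) G"

definition ver :: "int \<times> int \<Rightarrow> (complex \<Rightarrow> complex) \<Rightarrow> complex" where
  "ver x G = contour_integral (linepath (pt x) (pt (up x))) G"

text \<open>The counterclockwise boundary integral, kept as four edge integrals: sums over squares
  then cancel by reindexing along \<open>up\<close> and \<open>right\<close>, even where the
  integrand is not continuous.\<close>

definition square_integral :: "int \<times> int \<Rightarrow> (complex \<Rightarrow> complex) \<Rightarrow> complex" where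
  "square_integral x G = hor x G + ver (right x) G - hor (up x) G - ver x G"

definition grid_integral :: "(int \<times> int) set \<Rightarrow> (complex \<Rightarrow> complex) \<Rightarrow> complex" where
  "grid_integral A G = (\<Sum>x\<in>A. square_integral x G)"

text \<open>Squares are closed, so touching counts: an edge that also belongs to a square outside
  \<open>meeting T\<close> is disjoint from \<open>T\<close>.\<close>

definition meeting :: "complex set \<Rightarrow> (int \<times> int) set" where
  "meeting T = {x. square x \<inter> T \<noteq> {}}"

lemma pt_Re_Im [simp]: "Re (pt x) = Re c + \<delta> * of_int (fst x)" "Im (pt x) = Im c + \<delta> * of_int (snd x)"
  by (simp_all add: pt_def)

lemma right_up_simps [simp]: "fst (right x) = fst x + 1" "snd (right x) = snd x"
    "fst (up x) = fst x" "snd (up x) = snd x + 1"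
  by (simp_all add: right_def up_def)

lemma mem_square: "w \<in> square x \<longleftrightarrow>
    \<delta> * of_int (fst x) \<le> Re w - Re c \<and> Re w - Re c \<le> \<delta> * of_int (fst x) + \<delta> \<and>
    \<delta> * of_int (snd x) \<le> Im w - Im c \<and> Im w - Im c \<le> \<delta> * of_int (snd x) + \<delta>"
  by (auto simp: square_def in_cbox_complex_iff algebra_simps)

lemma inj_right: "inj right" and inj_up: "inj up"
  by (auto simp: inj_def right_def up_def prod_eq_iff)

lemma square_diam: "w \<in> square x \<Longrightarrow> w' \<in> square x \<Longrightarrow> dist w w' \<le> 2 * \<delta>"
proof -
  assume "w \<in> square x" "w' \<in> square x"
  then have "\<bar>Re (w - w')\<bar> \<le> \<delta>" "\<bar>Im (w - w')\<bar> \<le> \<delta>" by (auto simp: mem_square abs_le_iff)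
  then show ?thesis using cmod_le[of "w - w'"] unfolding dist_norm by linarith
qed

lemma compact_square [simp]: "compact (square x)" and convex_square [simp]: "convex (square x)"
  by (simp_all add: square_def)

lemma finite_meeting:
  assumes "bounded T"
  shows "finite (meeting T)"
proof -
  obtain B where B: "\<And>w. w \<in> T \<Longrightarrow> cmod w \<le> B" using assms bounded_iff by metis
  define N where "N = \<lceil>(B + cmod c) / \<delta>\<rceil> + 1"
  have "meeting T \<subseteq> {-N..N} \<times> {-N..N}"
  proof
    fix x assume "x \<in> meeting T"
    then obtain w where w: "w \<in> square x" "w \<in> T" by (auto simp: meeting_def)
    have b: "cmod (w - c) \<le> B + cmod c" using norm_triangle_ineq4[of w c] B[OF w(2)] by linarith
    have "\<bar>k\<bar> \<le> N" if k: "\<delta> * of_int k \<le> a" "a \<le> \<delta> * of_int k + \<delta>" "\<bar>a\<bar> \<le> B + cmod c" for k a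
    proof -
      have "\<bar>\<delta> * of_int k\<bar> \<le> B + cmod c + \<delta>" using k \<delta> by linarith
      then have "\<delta> * \<bar>of_int k\<bar> \<le> B + cmod c + \<delta>" using \<delta> by (simp add: abs_mult)
      then have "\<bar>of_int k\<bar> \<le> (B + cmod c) / \<delta> + 1" using \<delta> by (simp add: field_simps)
      then show ?thesis unfolding N_def by linarith
    qed
    from this[of "fst x" "Re w - Re c"] this[of "snd x" "Im w - Im c"]
    have "\<bar>fst x\<bar> \<le> N" "\<bar>snd x\<bar> \<le> N"
      using w(1) b abs_Re_le_cmod[of "w - c"] abs_Im_le_cmod[of "w - c"] by (auto simp: mem_square)
    then show "x \<in> {-N..N} \<times> {-N..N}" by (cases x) auto
  qed
  then show ?thesis by (rule finite_subset) auto
qed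

text \<open>Integrals over edges shared by two squares of \<^term>\<open>A\<close> cancel, whatever their value.\<close>

lemma grid_integral_boundary:
  assumes "finite A"
  shows "grid_integral A G = (\<Sum>x\<in>A - up ` A. hor x G) - (\<Sum>x\<in>up ` A - A. hor x G)
    - ((\<Sum>x\<in>A - right ` A. ver x G) - (\<Sum>x\<in>right ` A - A. ver x G))"
proof -
  \<comment> \<open>Terms common to \<open>A\<close> and its shift occur with both signs and drop
    out.\<close>
  have *: "(\<Sum>x\<in>A. h x) - (\<Sum>x\<in>A. h (s x)) = (\<Sum>x\<in>A - s ` A. h x) - (\<Sum>x\<in>s ` A - A. h x)"
    if "inj s" for h :: "int \<times> int \<Rightarrow> complex" and s
  proof -
    have "(\<Sum>x\<in>A. h (s x)) = (\<Sum>x\<in>s ` A. h x)"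
      using that by (subst sum.reindex) (auto intro: inj_on_subset)
    moreover have "(\<Sum>x\<in>A. h x) = (\<Sum>x\<in>A - s ` A. h x) + (\<Sum>x\<in>A \<inter> s ` A. h x)"
      using assms by (metis sum.Int_Diff add.commute)
    moreover have "(\<Sum>x\<in>s ` A. h x) = (\<Sum>x\<in>s ` A - A. h x) + (\<Sum>x\<in>A \<inter> s ` A. h x)"
      using assms sum.Int_Diff[of "s ` A" h A] by (simp add: add.commute Int_commute)
    ultimately show ?thesis by simp
  qed
  have "grid_integral A G = ((\<Sum>x\<in>A. hor x G) - (\<Sum>x\<in>A. hor (up x) G)) -
      ((\<Sum>x\<in>A. ver x G) - (\<Sum>x\<in>A. ver (right x) G))"
    by (simp add: grid_integral_def square_integral_def sum.distrib sum_subtractf)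
  then show ?thesis
    unfolding *[OF inj_up, of "\<lambda>x. hor x G"] *[OF inj_right, of "\<lambda>x. ver x G"] .
qed

lemma edge_in_square:
  "closed_segment (pt x) (pt (right x)) \<subseteq> square x"
  "closed_segment (pt (up x)) (pt (right (up x))) \<subseteq> square x"
  "closed_segment (pt x) (pt (up x)) \<subseteq> square x"
  "closed_segment (pt (right x)) (pt (up (right x))) \<subseteq> square x"
  by (rule closed_segment_subset[OF _ _ convex_square]; use \<delta> in \<open>simp add: mem_square algebra_simps\<close>)+

text \<open>A surviving edge separates a square of \<open>A\<close> from one outside
  \<open>A\<close>. For \<open>A = meeting T\<close> the former keeps the edge close to
  \<open>T\<close> and the latter keeps it off \<open>T\<close>.\<close>

lemma boundary_edges:
  "x \<in> A - up ` A \<or> x \<in> up ` A - A \<Longrightarrow> \<exists>y\<in>A. \<exists>z. z \<notin> A \<and>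
    closed_segment (pt x) (pt (right x)) \<subseteq> square y \<and> closed_segment (pt x) (pt (right x)) \<subseteq> square z"
  "x \<in> A - right ` A \<or> x \<in> right ` A - A \<Longrightarrow> \<exists>y\<in>A. \<exists>z. z \<notin> A \<and>
    closed_segment (pt x) (pt (up x)) \<subseteq> square y \<and> closed_segment (pt x) (pt (up x)) \<subseteq> square z"
proof -
  have u: "x = up (fst x, snd x - 1)" "x = right (fst x - 1, snd x)" by (auto simp: up_def right_def)
  note e = edge_in_square(1)[of x] edge_in_square(2)[of "(fst x, snd x - 1)", folded u(1)]
  note f = edge_in_square(3)[of x] edge_in_square(4)[of "(fst x - 1, snd x)", folded u(2)]
  show "\<exists>y\<in>A. \<exists>z. z \<notin> A \<and>
    closed_segment (pt x) (pt (right x)) \<subseteq> square y \<and> closed_segment (pt x) (pt (right x)) \<subseteq> square z"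
    if "x \<in> A - up ` A \<or> x \<in> up ` A - A"
    using that
  proof
    assume "x \<in> A - up ` A"
    then show ?thesis using e u(1) by blast
  next
    assume "x \<in> up ` A - A"
    then show ?thesis using e u(1) inj_up by (metis DiffE imageE inj_eq)
  qed
  show "\<exists>y\<in>A. \<exists>z. z \<notin> A \<and>
    closed_segment (pt x) (pt (up x)) \<subseteq> square y \<and> closed_segment (pt x) (pt (up x)) \<subseteq> square z"
    if "x \<in> A - right ` A \<or> x \<in> right ` A - A"
    using that
  proof
    assume "x \<in> A - right ` A"
    then show ?thesis using f u(2) by blast
  next
    assume "x \<in> right ` A - A"
    then show ?thesis using f u(2) inj_right by (metis DiffE imageE inj_eq)
  qed
qed

lemma square_rectpath:
  assumes "continuous_on (path_image (rectpath (pt x) (pt (right (up x))))) G"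
  shows "square_integral x G = contour_integral (rectpath (pt x) (pt (right (up x)))) G"
proof -
  have eq: "Complex (Re (pt (right (up x)))) (Im (pt x)) = pt (right x)"
    "Complex (Re (pt x)) (Im (pt (right (up x)))) = pt (up x)"
    by (simp_all add: complex_eq_iff)
  have rp: "rectpath (pt x) (pt (right (up x))) = linepath (pt x) (pt (right x)) +++
      linepath (pt (right x)) (pt (right (up x))) +++ linepath (pt (right (up x))) (pt (up x)) +++
      linepath (pt (up x)) (pt x)"
    by (simp only: rectpath_def Let_def eq)
  have "continuous_on (closed_segment (pt x) (pt (right x))) G"
    "continuous_on (closed_segment (pt (right x)) (pt (right (up x)))) G"
    "continuous_on (closed_segment (pt (right (up x))) (pt (up x))) G"
    "continuous_on (closed_segment (pt (up x)) (pt x)) G"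
    by (rule continuous_on_subset[OF assms]; simp add: rp path_image_join; blast)+
  then have ci: "G contour_integrable_on linepath (pt x) (pt (right x))"
    "G contour_integrable_on linepath (pt (right x)) (pt (right (up x)))"
    "G contour_integrable_on linepath (pt (right (up x))) (pt (up x))"
    "G contour_integrable_on linepath (pt (up x)) (pt x)"
    by (auto intro: contour_integrable_continuous_linepath)
  have rev: "contour_integral (linepath b a) G = - contour_integral (linepath a b) G" for a b
    using contour_integral_reversepath[OF valid_path_linepath[of a b]] by simp
  have ru: "right (up x) = up (right x)" by (simp add: right_def up_def)
  have "contour_integral (rectpath (pt x) (pt (right (up x)))) G =
      contour_integral (linepath (pt x) (pt (right x))) G +
      (contour_integral (linepath (pt (right x)) (pt (right (up x)))) G +
      (contour_integral (linepath (pt (right (up x))) (pt (up x))) G +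
       contour_integral (linepath (pt (up x)) (pt x)) G))"
    unfolding rp using ci by simp
  then show ?thesis
    unfolding square_integral_def hor_def ver_def
    using rev[of "pt (up x)" "pt (right (up x))"] rev[of "pt x" "pt (up x)"] by (simp add: ru)
qed

lemma pt_le: "Re (pt x) \<le> Re (pt (right (up x)))" "Im (pt x) \<le> Im (pt (right (up x)))"
  using \<delta> by (simp_all add: algebra_simps)

lemma square_integral_zero:
  assumes "G holomorphic_on square x"
  shows "square_integral x G = 0"
proof -
  let ?r = "rectpath (pt x) (pt (right (up x)))"
  have sub: "path_image ?r \<subseteq> square x"
    unfolding square_def by (rule path_image_rectpath_subset_cbox[OF pt_le])
  then have "continuous_on (path_image ?r) G"
    using assms holomorphic_on_imp_continuous_on continuous_on_subset by blast
  moreover have "(G has_contour_integral 0) ?r"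
    using assms sub by (intro Cauchy_theorem_convex_simple[of G "square x"]) auto
  ultimately show ?thesis by (simp add: square_rectpath contour_integral_unique)
qed

lemma square_integral_Cauchy:
  assumes f: "f holomorphic_on square x" and w: "w \<in> box (pt x) (pt (right (up x)))"
  shows "square_integral x (\<lambda>\<zeta>. f \<zeta> / (\<zeta> - w)) = 2 * pi * \<i> * f w"
proof -
  let ?r = "rectpath (pt x) (pt (right (up x)))"
  have sub: "path_image ?r \<subseteq> square x - {w}"
    using path_image_rectpath_cbox_minus_box[OF pt_le] w unfolding square_def by blast
  have "continuous_on (path_image ?r) (\<lambda>\<zeta>. f \<zeta> / (\<zeta> - w))"
    using sub f by (intro continuous_intros continuous_on_subset[OF holomorphic_on_imp_continuous_on]) auto
  moreover have "((\<lambda>\<zeta>. f \<zeta> / (\<zeta> - w)) has_contour_integral (2 * pi * \<i> * winding_number ?r w * f w)) ?r"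
  proof (rule Cauchy_integral_formula_convex_simple[OF convex_square f])
    show "w \<in> interior (square x)" using w by (simp add: square_def interior_cbox)
  qed (use sub in auto)
  ultimately show ?thesis
    using winding_number_rectpath[OF w] by (simp add: square_rectpath contour_integral_unique)
qed

end

section \<open>Hartogs extension by slices\<close>

definition coord_upd :: "'n \<Rightarrow> complex ^ 'n \<Rightarrow> complex \<Rightarrow> complex ^ 'n" where
  "coord_upd i z \<zeta> = (\<chi> j. if j = i then \<zeta> else z $ j)"

definition slice :: "'n \<Rightarrow> (complex ^ 'n) set \<Rightarrow> complex ^ 'n \<Rightarrow> complex set" where
  "slice i T z = {\<zeta>. coord_upd i z \<zeta> \<in> T}"

lemma coord_upd_nth: "coord_upd i z \<zeta> $ j = (if j = i then \<zeta> else z $ j)"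
  by (simp add: coord_upd_def)

lemma coord_upd_same [simp]: "coord_upd i z (z $ i) = z"
  by (simp add: vec_eq_iff coord_upd_nth)

lemma continuous_coord_upd [continuous_intros]:
  assumes "continuous_on S f" "continuous_on S g"
  shows "continuous_on S (\<lambda>x. coord_upd i (f x) (g x))"
  unfolding coord_upd_def
proof (rule continuous_on_vec_lambda)
  show "continuous_on S (\<lambda>x. if j = i then g x else f x $ j)" for j
    using assms by (cases "j = i") (auto intro!: continuous_intros)
qed

lemma dist_coord_upd: "dist (coord_upd i z \<zeta>) (coord_upd i z \<zeta>') = dist \<zeta> \<zeta>'"
proof -
  have "(\<Sum>j\<in>UNIV. (norm ((coord_upd i z \<zeta> - coord_upd i z \<zeta>') $ j))\<^sup>2)
      = (\<Sum>j\<in>UNIV. if j = i then (norm (\<zeta> - \<zeta>'))\<^sup>2 else 0)"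
    by (intro sum.cong) (auto simp: coord_upd_nth)
  then show ?thesis by (simp add: dist_norm norm_vec_def L2_set_def)
qed

lemma coord_upd_line: "coord_upd i (z + t *s v) \<zeta> = coord_upd i z \<zeta> + t *s coord_upd i v 0"
  by (simp add: vec_eq_iff coord_upd_nth)

lemma coord_upd_line': "coord_upd i z \<zeta> = (z - (z $ i) *s axis i 1) + \<zeta> *s axis i 1"
  by (simp add: vec_eq_iff coord_upd_nth axis_def)

lemma slice_bounded:
  assumes "compact T"
  obtains B where "\<And>z. slice i T z \<subseteq> cball 0 B"
proof -
  obtain B where B: "\<And>w. w \<in> T \<Longrightarrow> norm w \<le> B" using compact_imp_bounded[OF assms] bounded_iff by metis
  have "cmod \<zeta> \<le> B" if "\<zeta> \<in> slice i T z" for \<zeta> z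
    using B[of "coord_upd i z \<zeta>"] that Finite_Cartesian_Product.norm_nth_le[of "coord_upd i z \<zeta>" i]
    by (simp add: slice_def coord_upd_nth)
  then show thesis using that[of B] by force
qed

text \<open>The tube lemma. Applied to finitely many squares and edges it allows the contour to stay
  fixed while \<open>z\<close> moves a little.\<close>

lemma open_slice_contains:
  assumes W: "open W" and E: "compact E"
  shows "open {z. E \<subseteq> slice i W z}"
  unfolding open_subopen[of "{z. E \<subseteq> slice i W z}"]
proof
  fix z0 assume z0: "z0 \<in> {z. E \<subseteq> slice i W z}"
  define V where "V = {p. coord_upd i (fst p) (snd p) \<in> W}"
  have "continuous_on UNIV (\<lambda>p. coord_upd i (fst p) (snd p))"
    by (intro continuous_intros)
  then have "open V"
    unfolding V_def using open_vimage[OF W] by (simp add: vimage_def)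
  moreover have "{z0} \<times> E \<subseteq> V" using z0 by (auto simp: V_def slice_def)
  ultimately have "\<exists>X. z0 \<in> X \<and> open X \<and> X \<times> E \<subseteq> V" by (rule Elementary_Topology.tube_lemma[OF E])
  then obtain X where "z0 \<in> X" "open X" "X \<times> E \<subseteq> V" by blast
  then have "X \<subseteq> {z. E \<subseteq> slice i W z}" by (force simp: V_def slice_def)
  then show "\<exists>T. open T \<and> z0 \<in> T \<and> T \<subseteq> {z. E \<subseteq> slice i W z}" using \<open>open X\<close> \<open>z0 \<in> X\<close> by blast
qed

lemma holomorphic_on_slice:
  assumes F: "line_hol W F" and W: "open W" and S: "S \<subseteq> slice i W z"
  shows "(\<lambda>\<zeta>. F (coord_upd i z \<zeta>)) holomorphic_on S"
proof (rule holomorphic_on_subset[OF _ S])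
  have "slice i W z = {t. (z - (z $ i) *s axis i 1) + t *s axis i 1 \<in> W}"
    unfolding slice_def coord_upd_line' ..
  then have "open (slice i W z)" using open_line_preimage[OF W] by simp
  then show "(\<lambda>\<zeta>. F (coord_upd i z \<zeta>)) holomorphic_on slice i W z"
    unfolding coord_upd_line' by (rule line_hol_on_line[OF F]) (simp_all add: slice_def coord_upd_line')
qed

section \<open>Cauchy integrals around slices\<close>

context grid
begin

text \<open>Up to the factor \<open>2 * pi * \<i>\<close>, the Cauchy integral of \<open>F\<close>
  along a contour around the slice of \<open>T\<close>. Only values of \<open>F\<close> on the
  boundary of the union of these squares matter, and that boundary avoids \<open>T\<close>; interior
  edges cancel.\<close>

definition slice_integral ::
  "'n \<Rightarrow> (complex ^ 'n) set \<Rightarrow> (complex ^ 'n \<Rightarrow> complex) \<Rightarrow> complex ^ 'n \<Rightarrow> complex" where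
  "slice_integral i T F z =
     grid_integral (meeting (slice i T z)) (\<lambda>\<zeta>. F (coord_upd i z \<zeta>) / (\<zeta> - z $ i))"

lemma edge_integral_line_hol:
  assumes F: "line_hol W F" and U: "open U" "U \<inter> W = {}"
    and sub: "\<And>z. z \<in> U \<Longrightarrow> closed_segment a b \<subseteq> slice i W z"
  shows "line_hol U (\<lambda>z. contour_integral (linepath a b) (\<lambda>\<zeta>. F (coord_upd i z \<zeta>) / (\<zeta> - z $ i)))"
proof (rule line_hol_contour_integral_linepath[OF U(1)])
  have mem: "coord_upd i z \<zeta> \<in> W" if "z \<in> U" "\<zeta> \<in> closed_segment a b" for z \<zeta>
    using sub[OF that(1)] that(2) by (auto simp: slice_def)
  \<comment> \<open>The pole is not on the edge: \<open>\<zeta> = z $ i\<close> would give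
    \<open>coord_upd i z \<zeta> = z\<close>, a point of both \<open>U\<close> and
    \<open>W\<close>.\<close>
  have ne: "\<zeta> - z $ i \<noteq> 0" if "z \<in> U" "\<zeta> \<in> closed_segment a b" for z \<zeta>
    using mem[OF that] that(1) U(2) by auto
  have cF: "continuous_on W F" using F by (simp add: line_hol_def)
  let ?X = "U \<times> closed_segment a b"
  have "continuous_on ?X (F \<circ> (\<lambda>p. coord_upd i (fst p) (snd p)))"
  proof (rule continuous_on_compose)
    show "continuous_on ?X (\<lambda>p. coord_upd i (fst p) (snd p))" by (intro continuous_intros)
    show "continuous_on ((\<lambda>p. coord_upd i (fst p) (snd p)) ` ?X) F"
      by (rule continuous_on_subset[OF cF]) (use mem in auto)
  qed
  moreover have "continuous_on ?X (\<lambda>p. snd p - fst p $ i)" by (intro continuous_intros)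
  ultimately show "continuous_on ?X (\<lambda>(z, \<zeta>). F (coord_upd i z \<zeta>) / (\<zeta> - z $ i))"
    unfolding case_prod_unfold o_def by (rule continuous_on_divide) (use ne in auto)
  fix \<zeta> assume \<zeta>: "\<zeta> \<in> closed_segment a b"
  show "line_hol U (\<lambda>z. F (coord_upd i z \<zeta>) / (\<zeta> - z $ i))"
    unfolding line_hol_def
  proof (intro conjI ballI allI)
    have "continuous_on U (F \<circ> (\<lambda>z. coord_upd i z \<zeta>))"
    proof (rule continuous_on_compose)
      show "continuous_on U (\<lambda>z. coord_upd i z \<zeta>)" by (intro continuous_intros)
      show "continuous_on ((\<lambda>z. coord_upd i z \<zeta>) ` U) F"
        by (rule continuous_on_subset[OF cF]) (use mem \<zeta> in auto)
    qed
    moreover have "continuous_on U (\<lambda>z. \<zeta> - z $ i)" by (intro continuous_intros)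
    ultimately show "continuous_on U (\<lambda>z. F (coord_upd i z \<zeta>) / (\<zeta> - z $ i))"
      unfolding o_def by (rule continuous_on_divide) (use ne[OF _ \<zeta>] in auto)
    fix z v assume z: "z \<in> U"
    obtain d where d: "((\<lambda>t. F (coord_upd i (z + t *s v) \<zeta>)) has_field_derivative d) (at 0)"
      unfolding coord_upd_line using F mem[OF z \<zeta>] by (auto simp: line_hol_def)
    moreover have "((\<lambda>t. \<zeta> - (z + t *s v) $ i) has_field_derivative - (v $ i)) (at 0)"
      by (auto intro!: derivative_eq_intros)
    moreover have "\<zeta> - (z + 0 *s v) $ i \<noteq> 0" using ne[OF z \<zeta>] by simp
    ultimately show "\<exists>d. ((\<lambda>t. F (coord_upd i (z + t *s v) \<zeta>) / (\<zeta> - (z + t *s v) $ i))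
        has_field_derivative d) (at 0)"
      by (intro exI) (rule DERIV_divide)
  qed
qed

text \<open>Squares have diameter at most \<open>2 * \<delta>\<close>, and changing a single
  coordinate moves the point in C^n by the same distance.\<close>

lemma slice_square_subset:
  assumes near: "(\<Union>w\<in>T. cball w (2 * \<delta>)) \<subseteq> O'" and s: "s \<in> meeting (slice i T z)"
  shows "square s \<subseteq> slice i O' z"
proof
  fix \<zeta> assume \<zeta>: "\<zeta> \<in> square s"
  obtain \<xi> where "\<xi> \<in> square s" "coord_upd i z \<xi> \<in> T" using s by (auto simp: meeting_def slice_def)
  then have "coord_upd i z \<zeta> \<in> (\<Union>w\<in>T. cball w (2 * \<delta>))"
    using square_diam[of \<xi> s \<zeta>] \<zeta> by (intro UN_I[of "coord_upd i z \<xi>"]) (auto simp: dist_coord_upd)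
  with near have "coord_upd i z \<zeta> \<in> O'" by (rule subsetD)
  then show "\<zeta> \<in> slice i O' z" by (simp add: slice_def)
qed

text \<open>Locally in \<^term>\<open>z\<close> the squares meeting the slice of \<^term>\<open>T\<close> may be replaced by a fixed
  set of squares: the additional ones contribute nothing.\<close>

lemma slice_integral_local:
  assumes T: "compact T" and O': "open O'" and near: "(\<Union>w\<in>T. cball w (2 * \<delta>)) \<subseteq> O'"
    and F: "line_hol (O' - T) F" and M: "open M" "M \<inter> (O' - T) = {}" and z0: "z0 \<in> M"
  obtains X where "open X" "z0 \<in> X" "X \<subseteq> M"
    "\<And>z. z \<in> X \<Longrightarrow> slice_integral i T F z =
       grid_integral (meeting (slice i T z0)) (\<lambda>\<zeta>. F (coord_upd i z \<zeta>) / (\<zeta> - z $ i))"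
proof -
  obtain B where B: "\<And>z. slice i T z \<subseteq> cball 0 B" using slice_bounded[OF T] by blast
  define A where "A = meeting (slice i T z0)"
  \<comment> \<open>A finite stock of squares valid for all \<open>z\<close>, so that
    \<open>X\<close> below is a finite intersection of open sets.\<close>
  define C where "C = meeting (cball 0 B)"
  have fin: "finite C" unfolding C_def by (intro finite_meeting) simp
  have AC: "meeting (slice i T z) \<subseteq> C" for z using B[of z] by (auto simp: C_def meeting_def)
  have finA: "finite A" unfolding A_def using AC fin by (rule finite_subset)
  have oT: "open (O' - T)" "open (- T)" using O' T by (auto intro: compact_imp_closed open_Diff)
  \<comment> \<open>The first family prevents new squares from meeting the slice of
    \<open>T\<close>; the second keeps the squares of \<open>A\<close> inside \<open>O'\<close>, so
    that one which ceases to meet \<open>T\<close> lies where \<open>F\<close> is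
    holomorphic.\<close>
  define X where "X = M \<inter> (\<Inter>s\<in>C - A. {z. square s \<subseteq> slice i (- T) z}) \<inter>
      (\<Inter>s\<in>A. {z. square s \<subseteq> slice i O' z})"
  show thesis
  proof (rule that)
    show "open X"
      unfolding X_def using fin finA M(1) O' oT
      by (intro open_Int open_INT ballI open_slice_contains compact_square) auto
    have "square s \<subseteq> slice i (- T) z0" if "s \<in> C - A" for s
      using that by (auto simp: A_def meeting_def slice_def)
    moreover have "square s \<subseteq> slice i O' z0" if "s \<in> A" for s
      using slice_square_subset[OF near] that by (simp add: A_def)
    ultimately show "z0 \<in> X" using z0 by (auto simp: X_def)
    show "X \<subseteq> M" by (auto simp: X_def)
    fix z assume z: "z \<in> X"
    let ?G = "\<lambda>\<zeta>. F (coord_upd i z \<zeta>) / (\<zeta> - z $ i)"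
    have sub: "meeting (slice i T z) \<subseteq> A"
    proof
      fix s assume s: "s \<in> meeting (slice i T z)"
      then have "s \<in> C" using AC by blast
      moreover have "\<not> square s \<subseteq> slice i (- T) z" using s by (auto simp: meeting_def slice_def)
      ultimately show "s \<in> A" using z by (auto simp: X_def)
    qed
    have "square_integral s ?G = 0" if s: "s \<in> A - meeting (slice i T z)" for s
    proof (rule square_integral_zero)
      have sO: "square s \<subseteq> slice i (O' - T) z"
        using z s by (force simp: X_def meeting_def slice_def)
      have "\<zeta> - z $ i \<noteq> 0" if "\<zeta> \<in> square s" for \<zeta>
      proof
        assume "\<zeta> - z $ i = 0"
        then have "z \<in> O' - T" using sO that by (auto simp: slice_def)
        then show False using z M(2) by (auto simp: X_def)
      qed
      then show "?G holomorphic_on square s"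
        by (intro holomorphic_intros holomorphic_on_slice[OF F oT(1) sO]) auto
    qed
    then show "slice_integral i T F z = grid_integral (meeting (slice i T z0)) ?G"
      unfolding slice_integral_def grid_integral_def A_def[symmetric]
      by (intro sum.mono_neutral_left finA sub) auto
  qed
qed

lemma slice_boundary_edge:
  assumes near: "(\<Union>w\<in>T. cball w (2 * \<delta>)) \<subseteq> O'"
    and e: "y \<in> meeting (slice i T z)" "x \<notin> meeting (slice i T z)" "E \<subseteq> square y" "E \<subseteq> square x"
  shows "E \<subseteq> slice i (O' - T) z"
proof -
  have "E \<subseteq> slice i O' z" using slice_square_subset[OF near e(1)] e(3) by blast
  moreover have "square x \<inter> slice i T z = {}" using e(2) by (simp add: meeting_def)
  ultimately show ?thesis using e(4) by (auto simp: slice_def)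
qed

text \<open>Once the squares are fixed near \<open>z0\<close>, cancellation leaves boundary edges
  only, and these lie in the shell \<open>O' - T\<close> for all nearby \<open>z\<close>.
  \<open>M\<close> may run inside \<open>T\<close> or outside \<open>O'\<close>: the former serves
  the integral around \<open>N\<close>, the latter the outer part around \<open>K\<close>.\<close>

lemma slice_integral_line_hol:
  assumes T: "compact T" and O': "open O'" and near: "(\<Union>w\<in>T. cball w (2 * \<delta>)) \<subseteq> O'"
    and F: "line_hol (O' - T) F" and M: "open M" "M \<inter> (O' - T) = {}"
  shows "line_hol M (slice_integral i T F)"
proof (rule line_hol_local)
  fix z0 assume z0: "z0 \<in> M"
  define A where "A = meeting (slice i T z0)"
  obtain X where X: "open X" "z0 \<in> X" "X \<subseteq> M"
    and eq: "\<And>z. z \<in> X \<Longrightarrow> slice_integral i T F z =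
       grid_integral A (\<lambda>\<zeta>. F (coord_upd i z \<zeta>) / (\<zeta> - z $ i))"
    unfolding A_def using slice_integral_local[OF T O' near F M z0] by blast
  obtain B where B: "\<And>z. slice i T z \<subseteq> cball 0 B" using slice_bounded[OF T] by blast
  have finA: "finite A"
    unfolding A_def by (rule finite_meeting[OF bounded_subset[OF bounded_cball B]])
  have oT: "open (O' - T)" using O' T by (intro open_Diff compact_imp_closed)
  define H where "H = (A - up ` A) \<union> (up ` A - A)"
  define V where "V = (A - right ` A) \<union> (right ` A - A)"
  define N where "N = X \<inter> (\<Inter>x\<in>H. {z. closed_segment (pt x) (pt (right x)) \<subseteq> slice i (O' - T) z}) \<inter>
      (\<Inter>x\<in>V. {z. closed_segment (pt x) (pt (up x)) \<subseteq> slice i (O' - T) z})"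
  have fin: "finite H" "finite V" using finA by (auto simp: H_def V_def)
  have oN: "open N"
    unfolding N_def using fin X(1) oT
    by (intro open_Int open_INT ballI open_slice_contains compact_segment) auto
  have "closed_segment (pt x) (pt (right x)) \<subseteq> slice i (O' - T) z0" if "x \<in> H" for x
    using boundary_edges(1)[of x A] that slice_boundary_edge[OF near] unfolding H_def A_def by blast
  moreover have "closed_segment (pt x) (pt (up x)) \<subseteq> slice i (O' - T) z0" if "x \<in> V" for x
    using boundary_edges(2)[of x A] that slice_boundary_edge[OF near] unfolding V_def A_def by blast
  ultimately have zN: "z0 \<in> N" using X(2) by (auto simp: N_def)
  have NM: "N \<inter> (O' - T) = {}" using X(3) M(2) by (auto simp: N_def)
  have hor: "line_hol N (\<lambda>z. hor x (\<lambda>\<zeta>. F (coord_upd i z \<zeta>) / (\<zeta> - z $ i)))" if "x \<in> H" for x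
    unfolding hor_def by (rule edge_integral_line_hol[OF F oN NM]) (use that in \<open>auto simp: N_def\<close>)
  have ver: "line_hol N (\<lambda>z. ver x (\<lambda>\<zeta>. F (coord_upd i z \<zeta>) / (\<zeta> - z $ i)))" if "x \<in> V" for x
    unfolding ver_def by (rule edge_integral_line_hol[OF F oN NM]) (use that in \<open>auto simp: N_def\<close>)
  have "line_hol N (\<lambda>z. grid_integral A (\<lambda>\<zeta>. F (coord_upd i z \<zeta>) / (\<zeta> - z $ i)))"
    unfolding grid_integral_boundary[OF finA]
    by (intro line_hol_diff line_hol_sum hor ver) (use finA in \<open>auto simp: H_def V_def\<close>)
  then have "line_hol N (slice_integral i T F)"
    by (rule line_hol_cong_open[OF _ oN]) (use eq in \<open>auto simp: N_def\<close>)
  then show "\<exists>V. open V \<and> z0 \<in> V \<and> line_hol V (slice_integral i T F)" using oN zN by blast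
qed

lemma box_square_disjoint:
  assumes "w \<in> box (pt x) (pt (right (up x)))" "w \<in> square y"
  shows "y = x"
proof -
  have *: "k = l" if "\<delta> * of_int k < a" "a < \<delta> * of_int k + \<delta>" "\<delta> * of_int l \<le> a" "a \<le> \<delta> * of_int l + \<delta>"
    for k l :: int and a
  proof -
    have "\<delta> * of_int k < \<delta> * (of_int l + 1)" "\<delta> * of_int l < \<delta> * (of_int k + 1)"
      using that by (auto simp: algebra_simps)
    then have "of_int k < (of_int l + 1 :: real)" "of_int l < (of_int k + 1 :: real)" using \<delta> by auto
    then show ?thesis by linarith
  qed
  have "fst x = fst y" by (rule *[of _ "Re w - Re c"]) (use assms in \<open>auto simp: in_box_complex_iff mem_square algebra_simps\<close>)
  moreover have "snd x = snd y" by (rule *[of _ "Im w - Im c"]) (use assms in \<open>auto simp: in_box_complex_iff mem_square algebra_simps\<close>)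
  ultimately show ?thesis by (simp add: prod_eq_iff)
qed

text \<open>The integral over the squares near \<^term>\<open>K\<close> is holomorphic off \<^term>\<open>K\<close> and vanishes where the
  slice of \<^term>\<open>K\<close> is empty, hence on the whole unbounded component. There the integral over the
  squares meeting \<^term>\<open>N\<close> therefore reproduces \<^term>\<open>F\<close>.\<close>

theorem hartogs_slices:
  fixes z :: "complex ^ 'n"
  assumes ij: "i \<noteq> j" and N: "compact N" and K: "compact K" "K \<subseteq> N"
    and O': "open O'" and near: "(\<Union>w\<in>N. cball w (2 * \<delta>)) \<subseteq> O'"
    and r: "2 * \<delta> < r" "(\<Union>w\<in>K. ball w r) \<subseteq> O'"
    and F: "line_hol (O' - K) F"
    and X: "open X" "connected X" "X \<inter> (\<Union>w\<in>K. ball w r) = {}" "\<And>z. R < norm z \<Longrightarrow> z \<in> X"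
    and z: "z \<in> N" "z \<in> X" "z $ i \<in> box (pt s) (pt (right (up s)))"
  shows "slice_integral i N F z = 2 * pi * \<i> * F z"
proof -
  \<comment> \<open>For the integral around \<open>K\<close> the outer set is shrunk from
    \<open>O'\<close> to \<open>U\<close>, so that all of \<open>X\<close> lies outside the
    shell.\<close>
  define U where "U = (\<Union>w\<in>K. ball w r)"
  have KU: "K \<subseteq> U" using r(1) \<delta> by (force simp: U_def)
  have nearU: "(\<Union>w\<in>K. cball w (2 * \<delta>)) \<subseteq> U" using r(1) by (force simp: U_def)
  have FU: "line_hol (U - K) F" using F by (rule line_hol_subset) (use r(2) in \<open>auto simp: U_def\<close>)
  have oU: "open U" by (auto simp: U_def)
  have XU: "X \<inter> U = {}" using X(3) by (simp add: U_def)
  have hol: "line_hol X (slice_integral i K F)"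
    by (rule slice_integral_line_hol[OF K(1) oU nearU FU X(1)]) (use XU in auto)
  obtain B where B: "\<And>w. w \<in> K \<Longrightarrow> norm w \<le> B" using compact_imp_bounded[OF K(1)] bounded_iff by metis
  \<comment> \<open>As \<open>j\<close> differs from \<open>i\<close>, moving along the slice leaves
    coordinate \<open>j\<close> alone; a large \<open>j\<close>-th coordinate thus makes the whole
    slice of \<open>K\<close> empty. This is where a second dimension enters.\<close>
  define W where "W = {w :: complex ^ 'n. max R B < norm (w $ j)}"
  have out: "slice_integral i K F z = 0"
  proof (rule line_hol_identity[OF hol X(1,2) _ _ _ _ z(2), of W])
    show "open W" unfolding W_def by (intro open_Collect_less continuous_intros)
    have "axis j (complex_of_real (\<bar>max R B\<bar> + 1)) \<in> W" by (simp add: W_def) (smt (verit))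
    then show "W \<noteq> {}" by blast
    show "W \<subseteq> X"
      using X(4) Finite_Cartesian_Product.norm_nth_le[of _ j] unfolding W_def
      by (auto intro: order.strict_trans2)
    fix w assume w: "w \<in> W"
    have "slice i K w = {}"
    proof (rule ccontr)
      assume "slice i K w \<noteq> {}"
      then obtain \<zeta> where "coord_upd i w \<zeta> \<in> K" by (auto simp: slice_def)
      from B[OF this] Finite_Cartesian_Product.norm_nth_le[of "coord_upd i w \<zeta>" j] w ij
      show False by (auto simp: W_def coord_upd_nth)
    qed
    then show "slice_integral i K F w = 0" by (simp add: slice_integral_def meeting_def grid_integral_def)
  qed
  let ?G = "\<lambda>\<zeta>. F (coord_upd i z \<zeta>) / (\<zeta> - z $ i)"
  define AN where "AN = meeting (slice i N z)"
  define AK where "AK = meeting (slice i K z)"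
  obtain C where C: "\<And>z. slice i N z \<subseteq> cball 0 C" using slice_bounded[OF N] by blast
  have finN: "finite AN"
    unfolding AN_def by (rule finite_meeting[OF bounded_subset[OF bounded_cball C]])
  have sub: "AK \<subseteq> AN" using K(2) by (force simp: AK_def AN_def meeting_def slice_def)
  have oK: "open (O' - K)" using O' K(1) by (intro open_Diff compact_imp_closed)
  have sq: "square t \<subseteq> slice i (O' - K) z" if "t \<in> AN - AK" for t
    using slice_square_subset[OF near, of t i z] that by (fastforce simp: AN_def AK_def meeting_def slice_def)
  have zs: "z $ i \<in> square s" using z(3) box_subset_cbox unfolding square_def by blast
  have "s \<in> AN" using zs z(1) by (force simp: AN_def meeting_def slice_def)
  \<comment> \<open>A square meeting the slice of \<open>K\<close> stays in \<open>U\<close>,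
    whereas \<open>z\<close> lies in \<open>X\<close> and so off \<open>U\<close>.\<close>
  moreover have "s \<notin> AK"
  proof
    assume "s \<in> AK"
    then have "square s \<subseteq> slice i U z" unfolding AK_def by (rule slice_square_subset[OF nearU])
    then have "coord_upd i z (z $ i) \<in> U" using zs unfolding slice_def by blast
    then show False using z(2) XU by auto
  qed
  ultimately have s: "s \<in> AN - AK" by blast
  \<comment> \<open>\<open>z $ i\<close> is interior to the square \<open>s\<close>, so no other
    closed square contains the pole.\<close>
  have "square_integral t ?G = 0" if t: "t \<in> AN - AK - {s}" for t
  proof (rule square_integral_zero)
    have "\<zeta> - z $ i \<noteq> 0" if "\<zeta> \<in> square t" for \<zeta>
      using box_square_disjoint[OF z(3), of t] that t by auto
    then show "?G holomorphic_on square t"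
      using t by (intro holomorphic_intros holomorphic_on_slice[OF F oK sq]) auto
  qed
  then have "(\<Sum>t\<in>AN - AK. square_integral t ?G) = square_integral s ?G"
    using sum.remove[OF _ s, of "\<lambda>t. square_integral t ?G"] finN by simp
  also have "\<dots> = 2 * pi * \<i> * F (coord_upd i z (z $ i))"
    by (rule square_integral_Cauchy[OF holomorphic_on_slice[OF F oK sq[OF s]] z(3)])
  finally have "(\<Sum>t\<in>AN - AK. square_integral t ?G) = 2 * pi * \<i> * F z" by simp
  moreover have "slice_integral i N F z = slice_integral i K F z + (\<Sum>t\<in>AN - AK. square_integral t ?G)"
    unfolding slice_integral_def grid_integral_def AN_def[symmetric] AK_def[symmetric]
    using sum.subset_diff[OF sub finN] by (simp add: add.commute)
  ultimately show ?thesis using out by simp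
qed

end

section \<open>Vector-valued maps composed with scalar functions\<close>

lemma holo_n_line:
  assumes "holo_n g U" "z + t *s v \<in> U"
  shows "\<exists>d. ((\<lambda>t. g (z + t *s v)) has_field_derivative d) (at t)"
proof -
  obtain L where L: "(g has_derivative L) (at (z + t *s v))" "\<And>c v. L (c *s v) = c * L v"
    using assms unfolding holo_n_def by blast
  have "linear (\<lambda>s. s *s v)"
    by (rule linearI) (simp_all add: vec_eq_iff algebra_simps)
  then have "((\<lambda>s. z + s *s v) has_derivative (\<lambda>s. s *s v)) (at t)"
    by (auto intro!: derivative_eq_intros bounded_linear_imp_has_derivative simp: linear_conv_bounded_linear)
  from diff_chain_at[OF this L(1)]
  have "((\<lambda>s. g (z + s *s v)) has_derivative (\<lambda>s. s * L v)) (at t)" by (simp add: o_def L(2))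
  then have "((\<lambda>s. g (z + s *s v)) has_field_derivative L v) (at t)"
    by (simp add: has_field_derivative_def mult.commute[of _ "L v"])
  then show ?thesis ..
qed

context lcs
begin

lemma continuous_map_add:
  fixes f h :: "'a::metric_space \<Rightarrow> 'y"
  assumes "continuous_map (top_of_set S) (lc_topology P) f"
    and "continuous_map (top_of_set S) (lc_topology P) h"
  shows "continuous_map (top_of_set S) (lc_topology P) (\<lambda>x. f x + h x)"
  unfolding lc_continuous_iff
proof (intro ballI)
  fix q x assume q: "q \<in> SP" and x: "x \<in> S"
  have "((\<lambda>w. q (f w - f x) + q (h w - h x)) \<longlongrightarrow> 0 + 0) (at x within S)"
    using assms q x unfolding lc_continuous_iff by (intro tendsto_add) auto
  then have "((\<lambda>w. q (f w - f x) + q (h w - h x)) \<longlongrightarrow> 0) (at x within S)" by simp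
  then show "((\<lambda>w. q (f w + h w - (f x + h x))) \<longlongrightarrow> 0) (at x within S)"
  proof (rule Lim_null_comparison[rotated])
    have "norm (q (f w + h w - (f x + h x))) \<le> q (f w - f x) + q (h w - h x)" for w
      using SP_nonneg[OF q] SP_add[OF q, of "f w - f x" "h w - h x"] by (simp add: algebra_simps)
    then show "\<forall>\<^sub>F w in at x within S. norm (q (f w + h w - (f x + h x))) \<le> q (f w - f x) + q (h w - h x)"
      by simp
  qed
qed

lemma continuous_map_const_lc:
  "continuous_map (top_of_set S) (lc_topology P) (\<lambda>x. y)"
  by simp

lemma continuous_map_sc:
  fixes k :: "'a::metric_space \<Rightarrow> complex"
  assumes "continuous_on S k"
  shows "continuous_map (top_of_set S) (lc_topology P) (\<lambda>x. sc (k x) v)"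
  unfolding lc_continuous_iff
proof (intro ballI)
  fix q x assume q: "q \<in> SP" and x: "x \<in> S"
  have "(k \<longlongrightarrow> k x) (at x within S)" using assms x by (simp add: continuous_on_def)
  then have "((\<lambda>w. cmod (k w - k x) * q v) \<longlongrightarrow> cmod (k x - k x) * q v) (at x within S)"
    by (intro tendsto_intros)
  then show "((\<lambda>w. q (sc (k w) v - sc (k x) v)) \<longlongrightarrow> 0) (at x within S)"
    using SP_sc[OF q] by (simp flip: sc_diff_left)
qed

lemma continuous_map_compose_on:
  fixes h :: "'a::topological_space \<Rightarrow> 'b::topological_space"
  assumes "continuous_map (top_of_set T) X f" "continuous_on S h" "h ` S \<subseteq> T"
  shows "continuous_map (top_of_set S) X (\<lambda>x. f (h x))"
proof -
  have "continuous_map (top_of_set S) (top_of_set T) h"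
    using assms(2,3) by (auto simp: continuous_map_in_subtopology)
  from continuous_map_compose[OF this assms(1)] show ?thesis by (simp add: o_def)
qed

lemma continuous_on_functional_compose:
  fixes f :: "'a::topological_space \<Rightarrow> 'y"
  assumes "continuous_map (top_of_set S) (lc_topology P) f" "f ` S \<subseteq> D"
    and "continuous_map (subtopology (lc_topology P) D) euclidean g"
  shows "continuous_on S (\<lambda>x. g (f x))"
proof -
  have "continuous_map (top_of_set S) (subtopology (lc_topology P) D) f"
    using assms(1,2) by (auto simp: continuous_map_in_subtopology)
  from continuous_map_compose[OF this assms(3)] show ?thesis by (simp add: o_def)
qed

lemma lc_dual_linear:
  assumes "lc_dual sc P \<phi>"
  shows "\<phi> (x + y) = \<phi> x + \<phi> y" "\<phi> (sc a x) = a * \<phi> x"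
  using assms by (auto simp: lc_dual_def Vector_Spaces.linear_iff)

text \<open>On each complex line \<open>f + y\<close> is a weakly holomorphic curve, to which the
  chain rule for \<open>g\<close> applies.\<close>

lemma holo_vec_compose_line_hol:
  assumes f: "holo_vec sc P U f" and U: "open U" "W \<subseteq> U" "open W"
    and g: "gateaux_hol sc P D g" and D: "openin (lc_topology P) D" and seq: "lc_seq_complete P"
    and fD: "\<And>z. z \<in> W \<Longrightarrow> f z + y \<in> D"
  shows "line_hol W (\<lambda>z. g (f z + y))"
  unfolding line_hol_def
proof (intro conjI ballI allI)
  have cf: "continuous_map (top_of_set W) (lc_topology P) f"
    using f U(2) continuous_map_subset unfolding holo_vec_def by blast
  have gc: "continuous_map (subtopology (lc_topology P) D) euclidean g" using g by (simp add: gateaux_hol_def)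
  show "continuous_on W (\<lambda>z. g (f z + y))"
    by (rule continuous_on_functional_compose[OF continuous_map_add[OF cf continuous_map_const_lc] _ gc])
      (use fD in auto)
  fix z v assume z: "z \<in> W"
  define S where "S = {t. z + t *s v \<in> W}"
  have S: "open S" unfolding S_def by (rule open_line_preimage[OF U(3)])
  have "weak_hol S (\<lambda>t. f (z + t *s v) + y)"
    unfolding weak_hol_def
  proof (intro conjI allI impI)
    show "continuous_map (top_of_set S) (lc_topology P) (\<lambda>t. f (z + t *s v) + y)"
      by (intro continuous_map_add continuous_map_const_lc continuous_map_compose_on[OF cf] continuous_on_line)
        (auto simp: S_def)
    fix \<phi> assume \<phi>: "lc_dual sc P \<phi>"
    have "holo_n (\<phi> \<circ> f) U" using f \<phi> by (simp add: holo_vec_def)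
    then have "(\<lambda>t. \<phi> (f (z + t *s v))) holomorphic_on S"
      unfolding holomorphic_on_open[OF S] using holo_n_line[of "\<phi> \<circ> f" U] U(2) by (auto simp: S_def)
    then show "(\<lambda>t. \<phi> (f (z + t *s v) + y)) holomorphic_on S"
      by (simp add: lc_dual_linear[OF \<phi>] holomorphic_on_add)
  qed
  then have "(\<lambda>t. g (f (z + t *s v) + y)) holomorphic_on S"
    by (rule gateaux_comp_holomorphic[OF g D _ _ S seq]) (use fD in \<open>auto simp: S_def\<close>)
  moreover have "0 \<in> S" using z by (simp add: S_def)
  ultimately show "\<exists>d. ((\<lambda>t. g (f (z + t *s v) + y)) has_field_derivative d) (at 0)"
    unfolding holomorphic_on_open[OF S] by blast
qed

section \<open>Gateaux holomorphic functions on seminorm balls\<close>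

lemma openin_SP_ball0: "q \<in> SP \<Longrightarrow> openin (lc_topology P) {y. q y < e}"
  using openin_SP_ball[of q 0 e] by simp

lemma connectedin_SP_ball:
  assumes q: "q \<in> SP" shows "connectedin (lc_topology P) {y. q (y - a) < e}"
proof (rule path_connectedin_imp_connectedin)
  show "path_connectedin (lc_topology P) {y. q (y - a) < e}"
    unfolding path_connectedin
  proof (intro conjI ballI)
    fix x y assume xy: "x \<in> {y. q (y - a) < e}" "y \<in> {y. q (y - a) < e}"
    define \<gamma> where "\<gamma> t = x + sc (of_real t) (y - x)" for t
    have "continuous_map (top_of_set {0..1}) (lc_topology P) \<gamma>"
      unfolding \<gamma>_def by (intro continuous_map_add continuous_map_const_lc continuous_map_sc continuous_intros)
    moreover have "\<gamma> t \<in> {y. q (y - a) < e}" if t: "t \<in> {0..1}" for t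
    proof -
      have "\<gamma> t - a = sc (of_real (1 - t)) (x - a) + sc (of_real t) (y - a)"
        by (simp add: \<gamma>_def sc_diff_right sc_diff_left algebra_simps)
      then have "q (\<gamma> t - a) \<le> (1 - t) * q (x - a) + t * q (y - a)"
        using SP_add[OF q, of "sc (of_real (1 - t)) (x - a)" "sc (of_real t) (y - a)"] t
        unfolding SP_sc[OF q] norm_of_real by simp
      also have "\<dots> < e" using convex_bound_lt[of "q (x - a)" e "q (y - a)" "1 - t" t] xy t by simp
      finally show ?thesis by simp
    qed
    ultimately show "\<exists>g. pathin (lc_topology P) g \<and> g \<in> {0..1} \<rightarrow> {y. q (y - a) < e} \<and> g 0 = x \<and> g 1 = y"
      unfolding pathin_def by (intro exI[of _ \<gamma>]) (auto simp: \<gamma>_def)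
  qed auto
qed

lemma openin_line:
  assumes "openin (lc_topology P) V" "y \<in> V"
  obtains r where "r > 0" "\<And>t. t \<in> ball 0 r \<Longrightarrow> y + sc t v \<in> V"
proof -
  obtain q e where q: "q \<in> SP" "e > 0" "\<And>y'. q (y' - y) < e \<Longrightarrow> y' \<in> V"
    using assms unfolding openin_lc by blast
  show thesis
  proof (rule that)
    show r: "e / (q v + 1) > 0" using q(2) SP_nonneg[OF q(1), of v] by simp
    fix t :: complex assume t: "t \<in> ball 0 (e / (q v + 1))"
    have "cmod t * q v \<le> cmod t * (q v + 1)" by (simp add: mult_left_mono)
    also have "\<dots> < e" using t SP_nonneg[OF q(1), of v] by (simp add: field_simps)
    finally show "y + sc t v \<in> V" using q(3)[of "y + sc t v"] SP_sc[OF q(1)] by simp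
  qed
qed

lemma gateaux_holI:
  assumes V: "openin (lc_topology P) V" and c: "continuous_map (subtopology (lc_topology P) V) euclidean g"
    and h: "\<And>y v r. r > 0 \<Longrightarrow> (\<And>t. t \<in> ball 0 r \<Longrightarrow> y + sc t v \<in> V) \<Longrightarrow>
      (\<lambda>t. g (y + sc t v)) holomorphic_on ball 0 r"
  shows "gateaux_hol sc P V g"
  unfolding gateaux_hol_def
proof (intro conjI ballI allI c)
  fix y v assume "y \<in> V"
  then obtain r where "r > 0" "\<And>t. t \<in> ball 0 r \<Longrightarrow> y + sc t v \<in> V" using openin_line[OF V] by blast
  with h[of r y v] show "\<exists>r>0. (\<forall>t\<in>ball 0 r. y + sc t v \<in> V) \<and> (\<lambda>t. g (y + sc t v)) holomorphic_on ball 0 r"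
    by (intro exI[of _ r]) auto
qed

lemma gateaux_hol_continuous:
  "gateaux_hol sc P V g \<Longrightarrow> continuous_map (subtopology (lc_topology P) V) euclidean g"
  by (simp add: gateaux_hol_def)

lemma gateaux_hol_const_mult:
  assumes V: "openin (lc_topology P) V" and g: "gateaux_hol sc P V g"
  shows "gateaux_hol sc P V (\<lambda>y. k * g y)"
proof (rule gateaux_holI[OF V])
  have "continuous_map (subtopology (lc_topology P) V) euclidean ((\<lambda>w. k * w) \<circ> g)"
    by (rule continuous_map_compose[OF gateaux_hol_continuous[OF g]]) (auto intro!: continuous_intros)
  then show "continuous_map (subtopology (lc_topology P) V) euclidean (\<lambda>y. k * g y)" by (simp add: o_def)
qed (intro holomorphic_intros gateaux_on_line[OF g]; auto)

lemma gateaux_hol_diff: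
  assumes V: "openin (lc_topology P) V" and g: "gateaux_hol sc P V g" and h: "gateaux_hol sc P V h"
  shows "gateaux_hol sc P V (\<lambda>y. g y - h y)"
  by (rule gateaux_holI[OF V])
    (auto intro!: continuous_map_diff gateaux_hol_continuous[OF g] gateaux_hol_continuous[OF h]
      holomorphic_on_diff gateaux_on_line[OF g] gateaux_on_line[OF h])

lemma gateaux_hol_sum:
  assumes V: "openin (lc_topology P) V" and A: "finite A" "\<And>x. x \<in> A \<Longrightarrow> gateaux_hol sc P V (g x)"
  shows "gateaux_hol sc P V (\<lambda>y. \<Sum>x\<in>A. g x y)"
  by (rule gateaux_holI[OF V])
    (auto intro!: continuous_map_sum A(1) gateaux_hol_continuous[OF A(2)] holomorphic_on_sum
      gateaux_on_line[OF A(2)])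

lemma gateaux_hol_translate:
  assumes g: "gateaux_hol sc P {y. q y < e} g" and q: "q \<in> SP"
  shows "gateaux_hol sc P {y. q (y - a) < e} (\<lambda>y. g (y - a))"
proof (rule gateaux_holI[OF openin_SP_ball[OF q]])
  show "continuous_map (subtopology (lc_topology P) {y. q (y - a) < e}) euclidean (\<lambda>y. g (y - a))"
    unfolding functional_continuous_iff[OF openin_SP_ball[OF q]]
  proof (intro ballI allI impI)
    fix y and \<epsilon> :: real assume y: "y \<in> {y. q (y - a) < e}" and \<epsilon>: "\<epsilon> > 0"
    then obtain p d where p: "p \<in> SP" "d > 0"
      "\<And>y'. p (y' - (y - a)) < d \<Longrightarrow> y' \<in> {y. q y < e} \<and> dist (g y') (g (y - a)) < \<epsilon>"
      using gateaux_hol_continuous[OF g]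
      unfolding functional_continuous_iff[OF openin_SP_ball0[OF q]] by blast
    have "y' \<in> {y. q (y - a) < e} \<and> dist (g (y' - a)) (g (y - a)) < \<epsilon>" if "p (y' - y) < d" for y'
      using p(3)[of "y' - a"] that by simp
    then show "\<exists>p\<in>SP. \<exists>d>0. \<forall>y'. p (y' - y) < d \<longrightarrow>
        y' \<in> {y. q (y - a) < e} \<and> dist (g (y' - a)) (g (y - a)) < \<epsilon>"
      using p(1,2) by blast
  qed
  fix y v and r :: real assume "\<And>t. t \<in> ball 0 r \<Longrightarrow> y + sc t v \<in> {y. q (y - a) < e}"
  then have "(\<lambda>t. g ((y - a) + sc t v)) holomorphic_on ball 0 r"
    by (intro gateaux_on_line[OF g]) (auto simp: algebra_simps)
  then show "(\<lambda>t. g (y + sc t v - a)) holomorphic_on ball 0 r" by (simp add: algebra_simps)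
qed

text \<open>The edge is fixed and the perturbation \<open>y\<close> is the parameter. Continuity in
  \<open>y\<close> needs \<open>g\<close> to vary uniformly along the edge, which compactness
  provides; holomorphy along lines in \<open>y\<close> is that of an integral with a complex
  parameter.\<close>

lemma gateaux_hol_edge_integral:
  assumes g: "gateaux_hol sc P D g" and D: "openin (lc_topology P) D"
    and f: "continuous_map (top_of_set (closed_segment a b)) (lc_topology P) f"
    and q: "q \<in> SP" and fD: "\<And>\<zeta> y. \<zeta> \<in> closed_segment a b \<Longrightarrow> q y < e \<Longrightarrow> f \<zeta> + y \<in> D"
    and k: "continuous_on (closed_segment a b) k" "\<And>\<zeta>. \<zeta> \<in> closed_segment a b \<Longrightarrow> k \<zeta> \<noteq> 0"
  shows "gateaux_hol sc P {y. q y < e} (\<lambda>y. contour_integral (linepath a b) (\<lambda>\<zeta>. g (f \<zeta> + y) / k \<zeta>))"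
proof (rule gateaux_holI[OF openin_SP_ball0[OF q]])
  let ?S = "closed_segment a b"
  note gc = gateaux_hol_continuous[OF g]
  have fy: "continuous_map (top_of_set ?S) (lc_topology P) (\<lambda>\<zeta>. f \<zeta> + y)" for y
    by (intro continuous_map_add f continuous_map_const_lc)
  have int: "(\<lambda>\<zeta>. g (f \<zeta> + y) / k \<zeta>) contour_integrable_on linepath a b" if "q y < e" for y
    by (intro contour_integrable_continuous_linepath continuous_on_divide k
        continuous_on_functional_compose[OF fy _ gc]) (use fD that k(2) in auto)
  have "continuous_on ?S (\<lambda>\<zeta>. 1 / k \<zeta>)" using k by (intro continuous_intros) auto
  then have "bounded ((\<lambda>\<zeta>. 1 / k \<zeta>) ` ?S)" by (intro compact_imp_bounded compact_continuous_image) auto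
  then obtain B where B: "B > 0" "\<forall>w\<in>(\<lambda>\<zeta>. 1 / k \<zeta>) ` ?S. cmod w \<le> B" unfolding bounded_pos by blast
  show "continuous_map (subtopology (lc_topology P) {y. q y < e}) euclidean
      (\<lambda>y. contour_integral (linepath a b) (\<lambda>\<zeta>. g (f \<zeta> + y) / k \<zeta>))"
    unfolding functional_continuous_iff[OF openin_SP_ball0[OF q]]
  proof (intro ballI allI impI)
    fix y and \<epsilon> :: real assume y: "y \<in> {y. q y < e}" and \<epsilon>: "\<epsilon> > 0"
    \<comment> \<open>Chosen so that \<open>\<eta> * B\<close> times the length of the edge stays
      strictly below \<open>\<epsilon>\<close>, even for a degenerate edge.\<close>
    define \<eta> where "\<eta> = \<epsilon> / (B * (cmod (b - a) + 1))"
    have \<eta>: "\<eta> > 0" using \<epsilon> B(1) by (simp add: \<eta>_def add_nonneg_pos)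
    obtain p d where p: "p \<in> SP" "d > 0"
      and near: "\<And>\<zeta> w. \<zeta> \<in> ?S \<Longrightarrow> p w < d \<Longrightarrow>
        f \<zeta> + y + w \<in> D \<and> dist (g (f \<zeta> + y + w)) (g (f \<zeta> + y)) < \<eta>"
      by (rule uniform_near_compact[OF compact_segment fy[of y] _ D gc \<eta>]) (use fD y in blast)+
    \<comment> \<open>\<open>q\<close> keeps \<open>y'\<close> in the ball and \<open>p\<close>
      controls \<open>g\<close> along the edge; one seminorm must do both.\<close>
    obtain s where s0: "s \<in> SP" "\<And>t x. t \<in> {q, p} \<Longrightarrow> t x \<le> s x"
      by (rule SP_dominating[of "{q, p}"]) (use q p(1) in auto)
    have s: "s \<in> SP" "\<And>x. q x \<le> s x" "\<And>x. p x \<le> s x" using s0(1) s0(2)[of q] s0(2)[of p] by auto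
    have main: "y' \<in> {y. q y < e} \<and> dist (contour_integral (linepath a b) (\<lambda>\<zeta>. g (f \<zeta> + y') / k \<zeta>))
        (contour_integral (linepath a b) (\<lambda>\<zeta>. g (f \<zeta> + y) / k \<zeta>)) < \<epsilon>"
      if s': "s (y' - y) < min d (e - q y)" for y'
    proof
      have "q y' \<le> q (y' - y) + q y" using SP_add[OF q, of "y' - y" y] by simp
      then show qy': "y' \<in> {y. q y < e}" using s(2)[of "y' - y"] s' by simp
      have pd: "p (y' - y) < d" using s(3)[of "y' - y"] s' by simp
      have "cmod (contour_integral (linepath a b) (\<lambda>\<zeta>. g (f \<zeta> + y') / k \<zeta> - g (f \<zeta> + y) / k \<zeta>))
          \<le> \<eta> * B * cmod (b - a)"
      proof (rule contour_integral_bound_linepath)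
        show "(\<lambda>\<zeta>. g (f \<zeta> + y') / k \<zeta> - g (f \<zeta> + y) / k \<zeta>) contour_integrable_on linepath a b"
          using int y qy' by (intro contour_integrable_diff) auto
        show "0 \<le> \<eta> * B" using \<eta> B(1) by simp
        fix \<zeta> assume \<zeta>: "\<zeta> \<in> ?S"
        have "cmod (g (f \<zeta> + y') - g (f \<zeta> + y)) \<le> \<eta>" "cmod (1 / k \<zeta>) \<le> B"
          using near[OF \<zeta> pd] B(2) \<zeta> by (auto simp: dist_norm algebra_simps)
        then have "cmod ((g (f \<zeta> + y') - g (f \<zeta> + y)) * (1 / k \<zeta>)) \<le> \<eta> * B"
          unfolding norm_mult using \<eta> by (intro mult_mono) auto
        then show "cmod (g (f \<zeta> + y') / k \<zeta> - g (f \<zeta> + y) / k \<zeta>) \<le> \<eta> * B"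
          by (simp add: diff_divide_distrib)
      qed
      also have "\<dots> < \<eta> * B * (cmod (b - a) + 1)" using \<eta> B(1) by simp
      also have "\<dots> = \<epsilon>"
      proof -
        have "B * (cmod (b - a) + 1) \<noteq> 0"
          using B(1) norm_ge_zero[of "b - a"] by (metis add_nonneg_pos mult_eq_0_iff less_irrefl zero_less_one)
        then show ?thesis by (simp add: \<eta>_def mult.assoc)
      qed
      finally show "dist (contour_integral (linepath a b) (\<lambda>\<zeta>. g (f \<zeta> + y') / k \<zeta>))
        (contour_integral (linepath a b) (\<lambda>\<zeta>. g (f \<zeta> + y) / k \<zeta>)) < \<epsilon>"
        using int y qy' by (simp add: dist_norm contour_integral_diff)
    qed
    show "\<exists>p\<in>SP. \<exists>d>0. \<forall>y'. p (y' - y) < d \<longrightarrow> y' \<in> {y. q y < e} \<and>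
        dist (contour_integral (linepath a b) (\<lambda>\<zeta>. g (f \<zeta> + y') / k \<zeta>))
        (contour_integral (linepath a b) (\<lambda>\<zeta>. g (f \<zeta> + y) / k \<zeta>)) < \<epsilon>"
      using main p(2) y by (intro bexI[OF _ s(1)] exI[of _ "min d (e - q y)"] conjI) auto
  qed
  fix y v and r :: real assume V: "\<And>t. t \<in> ball 0 r \<Longrightarrow> y + sc t v \<in> {y. q y < e}"
  show "(\<lambda>t. contour_integral (linepath a b) (\<lambda>\<zeta>. g (f \<zeta> + (y + sc t v)) / k \<zeta>)) holomorphic_on ball 0 r"
  proof (rule holomorphic_on_contour_integral_linepath[OF open_ball])
    let ?X = "ball 0 r \<times> ?S"
    have "continuous_map (top_of_set ?X) (lc_topology P) (\<lambda>p. f (snd p) + (y + sc (fst p) v))"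
      by (intro continuous_map_add continuous_map_const_lc continuous_map_sc
          continuous_map_compose_on[OF f] continuous_intros) auto
    then have "continuous_on ?X (\<lambda>p. g (f (snd p) + (y + sc (fst p) v)))"
      by (rule continuous_on_functional_compose[OF _ _ gc]) (use fD V in auto)
    moreover have "continuous_on ?X (\<lambda>p. k (snd p))"
      by (rule continuous_on_compose2[OF k(1)]) (auto intro!: continuous_intros)
    ultimately show "continuous_on ?X (\<lambda>(t, \<zeta>). g (f \<zeta> + (y + sc t v)) / k \<zeta>)"
      unfolding case_prod_unfold by (rule continuous_on_divide) (use k(2) in auto)
    fix \<zeta> assume \<zeta>: "\<zeta> \<in> ?S"
    have "(\<lambda>t. g ((f \<zeta> + y) + sc t v)) holomorphic_on ball 0 r"
      by (rule gateaux_on_line[OF g open_ball]) (use fD[OF \<zeta>] V in \<open>auto simp: add.assoc\<close>)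
    then show "(\<lambda>t. g (f \<zeta> + (y + sc t v)) / k \<zeta>) holomorphic_on ball 0 r"
      using k(2)[OF \<zeta>] by (intro holomorphic_intros) (auto simp: add.assoc)
  qed
qed

end

section \<open>The main theorem\<close>

lemma compact_UN_cball:
  fixes S :: "'a::euclidean_space set"
  assumes "compact S" shows "compact (\<Union>w\<in>S. cball w r)"
proof -
  have "(\<Union>w\<in>S. cball w r) = (\<Union>x\<in>S. \<Union>y\<in>cball 0 r. {x + y})"
  proof (intro equalityI subsetI)
    fix z assume "z \<in> (\<Union>w\<in>S. cball w r)"
    then obtain w where "w \<in> S" "dist w z \<le> r" by auto
    then show "z \<in> (\<Union>x\<in>S. \<Union>y\<in>cball 0 r. {x + y})"
      by (intro UN_I[of w] UN_I[of "z - w"]) (auto simp: dist_norm norm_minus_commute)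
  next
    fix z assume "z \<in> (\<Union>x\<in>S. \<Union>y\<in>cball 0 r. {x + y})"
    then obtain x y where "x \<in> S" "norm y \<le> r" "z = x + y" by auto
    then show "z \<in> (\<Union>w\<in>S. cball w r)" by (intro UN_I[of x]) (auto simp: dist_norm)
  qed
  then show ?thesis using compact_sums'[OF assms compact_cball] by simp
qed

lemma compact_Int_component:
  assumes "compact K" "K \<subseteq> \<Omega>" "\<omega> \<in> components \<Omega>"
  shows "compact (K \<inter> \<omega>)"
proof -
  obtain T where T: "closed T" "\<omega> = \<Omega> \<inter> T"
    using closedin_component[OF assms(3)] by (auto simp: closedin_closed)
  have "K \<inter> \<omega> = K \<inter> T" using assms(2) T(2) by blast
  then show ?thesis using assms(1) T(1) compact_Int_closed by simp
qed

text \<open>Unless it is the whole space, an unbounded component has frontier points; they belong to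
  \<open>K\<close>, hence to the open set \<open>\<omega>\<close>, which therefore meets the
  component. This yields a starting point in the coincidence set.\<close>

lemma unbounded_component_meets:
  fixes K :: "'a::euclidean_space set"
  assumes K: "compact K" "K \<subseteq> \<omega>" and \<omega>: "open \<omega>" "\<omega> \<noteq> {}"
  obtains c a where "c \<in> components (- K)" "\<not> bounded c" "a \<in> \<omega>" "a \<in> c"
proof -
  obtain x where x: "x \<in> - K" "\<not> bounded (connected_component_set (- K) x)"
    using cobounded_unbounded_component[of "- K"] K(1) compact_imp_bounded by auto
  define c where "c = connected_component_set (- K) x"
  have c: "c \<in> components (- K)" "\<not> bounded c" using x by (auto simp: c_def components_def)
  have "\<omega> \<inter> c \<noteq> {}"
  proof (cases "c = UNIV")
    case False
    then have "frontier c \<noteq> {}" using c(2) by (auto simp: frontier_eq_empty)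
    then obtain k where k: "k \<in> frontier c" by blast
    have "frontier c \<subseteq> frontier (- K)" by (rule frontier_of_components_subset[OF c(1)])
    then have "k \<in> K" using k K(1) frontier_subset_compact[of K] by (auto simp: frontier_complement)
    then have "k \<in> \<omega>" "k \<in> closure c" using K(2) k by (auto simp: frontier_def)
    then show ?thesis using \<omega>(1) open_Int_closure_eq_empty by blast
  qed (use \<omega> in auto)
  then show thesis using that c by blast
qed

section \<open>Continuation along a path up to the first exit\<close>

context lcs
begin

text \<open>Here \<open>z\<close> stays fixed and \<open>y\<close> varies. Only boundary edges
  contribute; they lie in \<open>O' - N\<close>, where \<open>f w + y\<close> remains in
  \<open>D\<close>, and \<open>z \<in> N\<close> keeps the pole off them.\<close>

lemma slice_integral_gateaux_hol:
  assumes grid: "grid \<delta>" and N: "compact N" and near: "(\<Union>w\<in>N. cball w (2 * \<delta>)) \<subseteq> O'"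
    and g: "gateaux_hol sc P D g" and D: "openin (lc_topology P) D"
    and f: "continuous_map (top_of_set (O' - N)) (lc_topology P) f"
    and q: "q \<in> SP" and fD: "\<And>w y. w \<in> O' - N \<Longrightarrow> q y < e \<Longrightarrow> f w + y \<in> D"
    and z: "z \<in> N"
  shows "gateaux_hol sc P {y. q y < e} (\<lambda>y. grid.slice_integral c \<delta> i N (\<lambda>w. g (f w + y)) z)"
proof -
  interpret grid c \<delta> by fact
  define A where "A = meeting (slice i N z)"
  obtain B where B: "\<And>z. slice i N z \<subseteq> cball 0 B" using slice_bounded[OF N] by blast
  have finA: "finite A"
    unfolding A_def by (rule finite_meeting[OF bounded_subset[OF bounded_cball B]])
  note V = openin_SP_ball0[OF q]
  have edge: "gateaux_hol sc P {y. q y < e} (\<lambda>y. contour_integral (linepath a b)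
      (\<lambda>\<zeta>. g (f (coord_upd i z \<zeta>) + y) / (\<zeta> - z $ i)))"
    if sub: "closed_segment a b \<subseteq> slice i (O' - N) z" for a b
  proof (rule gateaux_hol_edge_integral[OF g D _ q])
    show "continuous_map (top_of_set (closed_segment a b)) (lc_topology P) (\<lambda>\<zeta>. f (coord_upd i z \<zeta>))"
      by (rule continuous_map_compose_on[OF f]) (use sub in \<open>auto intro!: continuous_intros simp: slice_def\<close>)
    show "continuous_on (closed_segment a b) (\<lambda>\<zeta>. \<zeta> - z $ i)" by (intro continuous_intros)
    fix \<zeta> assume "\<zeta> \<in> closed_segment a b"
    then have \<zeta>: "coord_upd i z \<zeta> \<in> O' - N" using sub by (auto simp: slice_def)
    then show "\<zeta> - z $ i \<noteq> 0" using z by auto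
    show "f (coord_upd i z \<zeta>) + y \<in> D" if "q y < e" for y using fD[OF \<zeta> that] .
  qed
  have hor: "gateaux_hol sc P {y. q y < e} (\<lambda>y. hor x (\<lambda>\<zeta>. g (f (coord_upd i z \<zeta>) + y) / (\<zeta> - z $ i)))"
    if "x \<in> A - up ` A \<or> x \<in> up ` A - A" for x
    unfolding hor_def using boundary_edges(1)[OF that] slice_boundary_edge[OF near] A_def
    by (intro edge) blast
  have ver: "gateaux_hol sc P {y. q y < e} (\<lambda>y. ver x (\<lambda>\<zeta>. g (f (coord_upd i z \<zeta>) + y) / (\<zeta> - z $ i)))"
    if "x \<in> A - right ` A \<or> x \<in> right ` A - A" for x
    unfolding ver_def using boundary_edges(2)[OF that] slice_boundary_edge[OF near] A_def
    by (intro edge) blast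
  show ?thesis
    unfolding slice_integral_def A_def[symmetric] grid_integral_boundary[OF finA]
    by (intro gateaux_hol_diff[OF V] gateaux_hol_sum[OF V] hor ver) (use finA in auto)
qed

lemma openin_preimage_add:
  fixes f :: "'a::metric_space \<Rightarrow> 'y"
  assumes "continuous_map (top_of_set U) (lc_topology P) f" "open U" "openin (lc_topology P) D"
  shows "open {z \<in> U. f z + y \<in> D}"
proof -
  have "continuous_map (top_of_set U) (lc_topology P) (\<lambda>z. f z + y)"
    by (intro continuous_map_add assms continuous_map_const_lc)
  then have "openin (top_of_set U) {z \<in> topspace (top_of_set U). f z + y \<in> D}"
    using assms(3) by (rule openin_continuous_map_preimage)
  then show ?thesis using assms(2) by (simp add: openin_open_eq Collect_conj_eq)
qed

lemma uniform_room:
  fixes f :: "'a::metric_space \<Rightarrow> 'y"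
  assumes "compact L" "continuous_map (top_of_set L) (lc_topology P) f" "f ` L \<subseteq> D"
    and "openin (lc_topology P) D"
  obtains q e where "q \<in> SP" "e > 0" "\<And>z y. z \<in> L \<Longrightarrow> q y < e \<Longrightarrow> f z + y \<in> D"
proof -
  \<comment> \<open>For a constant function the closeness clause is void and only membership in
    \<open>D\<close> remains.\<close>
  have "continuous_map (subtopology (lc_topology P) D) euclidean (\<lambda>_. 0 :: complex)" by simp
  from uniform_near_compact[OF assms this zero_less_one] that show thesis by metis
qed

text \<open>Exit times form a closed set, since \<open>ft\<close> pulls \<open>D\<close> back to an
  open set; the infimum is therefore itself an exit time, and it is positive because the path starts
  in \<open>D\<close>.\<close>

lemma first_exit:
  fixes ft :: "'a::metric_space \<Rightarrow> 'y"
  assumes ft: "continuous_map (top_of_set \<Omega>) (lc_topology P) ft" and \<Omega>: "open \<Omega>"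
    and D: "openin (lc_topology P) D"
    and p: "path p" "path_image p \<subseteq> \<Omega>" "ft (pathstart p) \<in> D" "ft (pathfinish p) \<notin> D"
  obtains t0 where "0 < t0" "t0 \<le> 1" "ft (p t0) \<notin> D" "\<And>t. 0 \<le> t \<Longrightarrow> t < t0 \<Longrightarrow> ft (p t) \<in> D"
proof -
  define W where "W = {z \<in> \<Omega>. ft z \<in> D}"
  have W: "open W" unfolding W_def using openin_preimage_add[OF ft \<Omega> D, of 0] by simp
  define T where "T = {0..1} \<inter> p -` (- W)"
  have "closed T"
    unfolding T_def using p(1) W by (intro continuous_closed_preimage) (auto simp: path_def)
  moreover have "1 \<in> T" using p(4) by (auto simp: T_def W_def pathfinish_def)
  moreover have bdd: "bdd_below T" by (rule bdd_belowI[of _ 0]) (auto simp: T_def)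
  ultimately have inf: "Inf T \<in> T" using closed_contains_Inf by blast
  have mem: "t \<in> T \<longleftrightarrow> ft (p t) \<notin> D" if "t \<in> {0..1}" for t
  proof -
    have "p t \<in> \<Omega>" using that p(2) unfolding path_image_def by blast
    then show ?thesis using that by (simp add: T_def W_def)
  qed
  show thesis
  proof (rule that)
    have 01: "Inf T \<in> {0..1}" using inf by (auto simp: T_def)
    then show "Inf T \<le> 1" "ft (p (Inf T)) \<notin> D" using mem inf by auto
    have "Inf T \<noteq> 0" using mem[OF 01] inf p(3) by (auto simp: pathstart_def)
    then show "0 < Inf T" using 01 by auto
    fix t assume t: "0 \<le> t" "t < Inf T"
    then have "t \<notin> T" using cInf_lower[OF _ bdd] by force
    then show "ft (p t) \<in> D" using mem[of t] t 01 by auto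
  qed
qed

text \<open>The seminorm ball is the same for all \<^term>\<open>t1\<close>; so once \<^term>\<open>p t1\<close> is close
  to the first exit point of \<open>ft \<circ> p\<close> from \<^term>\<open>D\<close>, it reaches outside \<^term>\<open>D\<close>.\<close>

lemma hartogs_continuation:
  fixes \<omega> :: "(complex ^ 'n) set"
  assumes n2: "CARD('n) \<ge> 2" and seq: "lc_seq_complete P"
    and \<omega>: "open \<omega>" and K: "compact K" "K \<subseteq> \<omega>" and c: "c \<in> components (- K)" "\<not> bounded c"
    and a: "a \<in> \<omega>" "a \<in> c"
    and f: "holo_vec sc P (\<omega> - K) f" and ft: "holo_vec sc P \<omega> ft"
    and eq: "\<And>z. z \<in> \<omega> \<Longrightarrow> z \<in> c \<Longrightarrow> ft z = f z"
    and D: "openin (lc_topology P) D" and fD: "f ` (\<omega> - K) \<subseteq> D"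
    and p: "path p" "path_image p \<subseteq> \<omega>" "pathstart p = a"
  obtains q e where "q \<in> SP" "e > 0"
    "\<And>t1. 0 \<le> t1 \<Longrightarrow> t1 \<le> 1 \<Longrightarrow> (\<And>t. 0 \<le> t \<Longrightarrow> t \<le> t1 \<Longrightarrow> ft (p t) \<in> D) \<Longrightarrow>
      \<exists>C. openin (lc_topology P) C \<and> ft (p t1) \<in> C \<and> C \<subseteq> D \<inter> {x. q (x - ft (p t1)) < e} \<and>
        (\<forall>g. gateaux_hol sc P D g \<longrightarrow>
          (\<exists>gb. gateaux_hol sc P {x. q (x - ft (p t1)) < e} gb \<and> (\<forall>x\<in>C. gb x = g x)))"
proof -
  obtain i j :: 'n where ij: "i \<noteq> j"
  proof -
    have "\<not> card (UNIV :: 'n set) \<le> Suc 0" using n2 by simp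
    then show thesis using that by (auto simp: card_le_Suc0_iff_eq)
  qed
  have oc: "open c" using K(1) c(1) open_components compact_imp_closed open_Compl by blast
  have cc: "connected c" using c(1) in_components_connected by blast
  have cK: "c \<inter> K = {}" using in_components_subset[OF c(1)] by blast
  obtain R where R: "\<And>w. w \<in> (\<Union>w\<in>K. cball w 1) \<Longrightarrow> norm w \<le> R"
    using compact_imp_bounded[OF compact_UN_cball[OF K(1), of 1]] bounded_iff by metis
  \<comment> \<open>A path inside \<open>c\<close> to a point beyond radius \<open>R\<close> will
    show that \<open>a\<close> stays linked to infinity after \<open>K\<close> has been
    thickened.\<close>
  obtain b where b: "b \<in> c" "R < norm b" using c(2) unfolding bounded_iff by (meson not_le)
  obtain \<gamma> where \<gamma>: "path \<gamma>" "path_image \<gamma> \<subseteq> c" "pathstart \<gamma> = a" "pathfinish \<gamma> = b"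
    using connected_open_path_connected[OF oc cc] a(2) b(1) unfolding path_connected_def by blast
  \<comment> \<open>The path is added to \<open>K\<close> so that it runs in the interior of
    \<open>N\<close>, where the slice integral is holomorphic.\<close>
  define S where "S = K \<union> path_image p"
  have S: "compact S" "S \<subseteq> \<omega>" using K p(1,2) by (auto simp: S_def compact_path_image)
  obtain d1 where d1: "d1 > 0" "\<And>x y. x \<in> S \<Longrightarrow> y \<in> - \<omega> \<Longrightarrow> d1 \<le> dist x y"
  proof -
    have "closed (- \<omega>)" "S \<inter> - \<omega> = {}" using \<omega> S(2) by auto
    from separate_compact_closed[OF S(1) this] show thesis using that by blast
  qed
  obtain d2 where d2: "d2 > 0" "\<And>x y. x \<in> K \<Longrightarrow> y \<in> path_image \<gamma> \<Longrightarrow> d2 \<le> dist x y"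
  proof -
    have "K \<inter> path_image \<gamma> = {}" using \<gamma>(2) cK by blast
    from separate_compact_closed[OF K(1) closed_path_image[OF \<gamma>(1)] this] show thesis using that by blast
  qed
  \<comment> \<open>\<open>d1\<close> leaves room for the \<open>4 * \<eta>\<close>-neighbourhood of
    \<open>S\<close> in \<open>\<omega>\<close>, \<open>d2\<close> for the
    \<open>3 * \<eta>\<close>-neighbourhood of \<open>K\<close> off the path
    \<open>\<gamma>\<close>, and the bound 1 keeps the latter neighbourhood within radius
    \<open>R\<close>.\<close>
  define \<eta> where "\<eta> = min 1 (min d1 d2) / 8"
  have \<eta>: "\<eta> > 0" "8 * \<eta> \<le> 1" "8 * \<eta> \<le> d1" "8 * \<eta> \<le> d2" using d1(1) d2(1) by (auto simp: \<eta>_def)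
  \<comment> \<open>\<open>K\<close> is thickened because uniform room in \<open>D\<close> requires
    a compact shell: \<open>L\<close> omits an open neighbourhood of \<open>K\<close>, and
    \<open>Kc\<close> contains the points omitted. The radii are nested so that squares of side
    \<open>\<eta> / 2\<close>, hence of diameter at most \<open>\<eta>\<close>, stay in
    \<open>O'\<close> if they meet a slice of \<open>N\<close>.\<close>
  define Kc where "Kc = (\<Union>w\<in>K. cball w \<eta>)"
  define N where "N = (\<Union>w\<in>S. cball w (2 * \<eta>))"
  define O' where "O' = (\<Union>w\<in>S. ball w (4 * \<eta>))"
  define L where "L = (\<Union>w\<in>S. cball w (4 * \<eta>)) - (\<Union>w\<in>K. ball w \<eta>)"
  define X where "X = connected_component_set (- (\<Union>w\<in>K. cball w (3 * \<eta>))) a"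
  have comp: "compact Kc" "compact N" "compact L"
    unfolding Kc_def N_def L_def using K(1) S(1) by (auto intro!: compact_UN_cball compact_diff)
  have oO: "open O'" by (auto simp: O'_def)
  have KN: "Kc \<subseteq> N" using \<eta>(1) by (force simp: Kc_def N_def S_def)
  have near_S: "x \<in> \<omega>" if "w \<in> S" "dist w x \<le> 4 * \<eta>" for w x
    using d1(2)[OF that(1), of x] that(2) \<eta>(1,3) by force
  have L\<omega>: "L \<subseteq> \<omega> - K" using near_S \<eta>(1) by (force simp: L_def)
  have OL: "O' - Kc \<subseteq> L" by (force simp: O'_def Kc_def L_def)
  have pN: "path_image p \<subseteq> interior N"
  proof -
    have "(\<Union>w\<in>S. ball w (2 * \<eta>)) \<subseteq> interior N" unfolding N_def by (rule interior_maximal) force+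
    then show ?thesis using \<eta>(1) by (force simp: S_def)
  qed
  have nearN: "(\<Union>w\<in>N. cball w (2 * (\<eta> / 2))) \<subseteq> O'"
  proof clarify
    fix x w assume "w \<in> N" "x \<in> cball w (2 * (\<eta> / 2))"
    then obtain s where "s \<in> S" "dist s w \<le> 2 * \<eta>" "dist w x \<le> \<eta>" by (auto simp: N_def)
    then show "x \<in> O'" using \<eta>(1) dist_triangle[of s x w] unfolding O'_def by (intro UN_I[of s]) auto
  qed
  have K3: "(\<Union>w\<in>Kc. ball w (2 * \<eta>)) \<subseteq> (\<Union>w\<in>K. cball w (3 * \<eta>))"
  proof clarify
    fix x w assume "w \<in> Kc" "x \<in> ball w (2 * \<eta>)"
    then obtain s where "s \<in> K" "dist s w \<le> \<eta>" "dist w x < 2 * \<eta>" by (auto simp: Kc_def)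
    then show "x \<in> (\<Union>w\<in>K. cball w (3 * \<eta>))" using dist_triangle[of s x w] by (intro UN_I[of s]) auto
  qed
  have K3O: "(\<Union>w\<in>Kc. ball w (2 * \<eta>)) \<subseteq> O'"
    using K3 \<eta>(1) by (force simp: O'_def S_def)
  have oX: "open X"
    unfolding X_def using compact_UN_cball[OF K(1)]
    by (intro open_connected_component open_Compl compact_imp_closed)
  have cX: "connected X" by (simp add: X_def)
  have XK: "X \<inter> (\<Union>w\<in>Kc. ball w (2 * \<eta>)) = {}"
    using K3 connected_component_subset[of "- (\<Union>w\<in>K. cball w (3 * \<eta>))" a] unfolding X_def by blast
  have \<gamma>sub: "path_image \<gamma> \<subseteq> - (\<Union>w\<in>K. cball w (3 * \<eta>))"
    using d2(2) \<eta>(1,4) by force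
  have a\<gamma>: "a \<in> path_image \<gamma>" "b \<in> path_image \<gamma>" using \<gamma>(3,4) by auto
  have \<gamma>X: "path_image \<gamma> \<subseteq> X"
    unfolding X_def by (rule connected_component_maximal[OF a\<gamma>(1) connected_path_image[OF \<gamma>(1)] \<gamma>sub])
  have far: "z \<in> X" if z: "R < norm z" for z
  proof -
    have "connected (- cball (0 :: complex ^ 'n) R)"
      using n2 by (intro connected_complement_bounded_convex) auto
    moreover have "- cball 0 R \<subseteq> - (\<Union>w\<in>K. cball w (3 * \<eta>))"
      using R \<eta>(1,2) by (force simp: not_le)
    ultimately have "- cball 0 R \<subseteq> connected_component_set (- (\<Union>w\<in>K. cball w (3 * \<eta>))) b"
      using b(2) by (intro connected_component_maximal) auto
    also have "\<dots> = X"
      using \<gamma>X a\<gamma>(2) connected_component_eq unfolding X_def by blast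
    finally show ?thesis using z by auto
  qed
  \<comment> \<open>This shift puts \<open>a $ i\<close> at the centre of a square of side
    \<open>\<eta> / 2\<close>, hence off all edges; the same square works for points near
    \<open>a\<close>.\<close>
  define c0 where "c0 = a $ i - Complex (\<eta> / 4) (\<eta> / 4)"
  interpret grid c0 "\<eta> / 2" by unfold_locales (use \<eta>(1) in simp)
  define Bx where "Bx = box (pt (0, 0)) (pt (right (up (0, 0))))"
  have "Re c0 = Re (a $ i) - \<eta> / 4" "Im c0 = Im (a $ i) - \<eta> / 4" by (simp_all add: c0_def)
  then have aB: "a $ i \<in> Bx" using \<eta>(1) by (simp add: Bx_def in_box_complex_iff)
  have cft: "continuous_map (top_of_set \<omega>) (lc_topology P) ft" using ft by (simp add: holo_vec_def)
  have cf: "continuous_map (top_of_set (\<omega> - K)) (lc_topology P) f" using f by (simp add: holo_vec_def)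
  have fL: "continuous_map (top_of_set L) (lc_topology P) f" using cf L\<omega> by (rule continuous_map_subset)
  obtain q e where q: "q \<in> SP" "e > 0" and qD: "\<And>z y. z \<in> L \<Longrightarrow> q y < e \<Longrightarrow> f z + y \<in> D"
    using uniform_room[OF comp(3) fL _ D] fD L\<omega> by blast
  show thesis
  proof (rule that[OF q])
    fix t1 :: real assume t1: "0 \<le> t1" "t1 \<le> 1" and ftD: "\<And>t. 0 \<le> t \<Longrightarrow> t \<le> t1 \<Longrightarrow> ft (p t) \<in> D"
    define Q where "Q = p ` {0..t1}"
    have "continuous_on {0..t1} p"
      using p(1) unfolding path_def by (rule continuous_on_subset) (use t1 in auto)
    then have Qc: "compact Q" "connected Q"
      unfolding Q_def by (auto intro: compact_continuous_image connected_continuous_image)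
    have Qp: "Q \<subseteq> path_image p" using t1 by (auto simp: Q_def path_image_def)
    have aQ: "a \<in> Q" "p t1 \<in> Q" using t1 p(3) by (auto simp: Q_def pathstart_def)
    have "continuous_map (top_of_set Q) (lc_topology P) ft"
      using cft by (rule continuous_map_subset) (use Qp p(2) in blast)
    moreover have "ft ` Q \<subseteq> D" using ftD by (auto simp: Q_def)
    \<comment> \<open>These depend on \<open>t1\<close> and on the piece of path travelled; they
      shrink only the set \<open>C\<close> of agreement, not the ball to which \<open>g\<close> is
      extended.\<close>
    ultimately obtain q' e' where q': "q' \<in> SP" "e' > 0"
      and q'D: "\<And>z y. z \<in> Q \<Longrightarrow> q' y < e' \<Longrightarrow> ft z + y \<in> D"
      using uniform_room[OF Qc(1) _ _ D] by blast
    define z1 where "z1 = p t1"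
    define C where "C = {x. q (x - ft z1) < e} \<inter> {x. q' (x - ft z1) < e'}"
    have z1N: "z1 \<in> interior N" using aQ(2) Qp pN by (auto simp: z1_def)
    show "\<exists>C. openin (lc_topology P) C \<and> ft (p t1) \<in> C \<and> C \<subseteq> D \<inter> {x. q (x - ft (p t1)) < e} \<and>
        (\<forall>g. gateaux_hol sc P D g \<longrightarrow>
          (\<exists>gb. gateaux_hol sc P {x. q (x - ft (p t1)) < e} gb \<and> (\<forall>x\<in>C. gb x = g x)))"
      unfolding z1_def[symmetric]
    proof (intro exI[of _ C] conjI allI impI)
      show "openin (lc_topology P) C"
        unfolding C_def by (intro openin_Int openin_SP_ball q q')
      show "ft z1 \<in> C" using q q' by (simp add: C_def SP_zero)
      show "C \<subseteq> D \<inter> {x. q (x - ft z1) < e}"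
        using q'D[OF aQ(2)] by (force simp: C_def z1_def)
      fix g assume g: "gateaux_hol sc P D g"
      define F where "F y w = g (f w + y)" for y w
      define h where "h y = 1 / (2 * pi * \<i>) * slice_integral i N (F y) z1" for y
      have "gateaux_hol sc P {y. q y < e} h"
        unfolding h_def F_def
      proof (intro gateaux_hol_const_mult openin_SP_ball0 q
          slice_integral_gateaux_hol[OF grid_axioms comp(2) nearN g D _ q(1)])
        show "continuous_map (top_of_set (O' - N)) (lc_topology P) f"
          using fL by (rule continuous_map_subset) (use OL KN in blast)
        show "f w + y \<in> D" if "w \<in> O' - N" "q y < e" for w y using qD that OL KN by blast
        show "z1 \<in> N" using z1N interior_subset by blast
      qed
      then have "gateaux_hol sc P {x. q (x - ft z1) < e} (\<lambda>x. h (x - ft z1))"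
        using q(1) by (rule gateaux_hol_translate)
      moreover have "h (x - ft z1) = g x" if x: "x \<in> C" for x
      proof -
        define y where "y = x - ft z1"
        have y: "q y < e" "q' y < e'" using x by (auto simp: y_def C_def)
        have F: "line_hol (O' - Kc) (F y)"
          unfolding F_def
        proof (rule holo_vec_compose_line_hol[OF f _ _ _ g D seq])
          show "open (\<omega> - K)" "open (O' - Kc)"
            using \<omega> K(1) oO comp(1) by (auto intro: compact_imp_closed)
          show "O' - Kc \<subseteq> \<omega> - K" using OL L\<omega> by blast
          show "f w + y \<in> D" if "w \<in> O' - Kc" for w using qD that OL y(1) by blast
        qed
        have hol1: "line_hol (interior N) (slice_integral i N (F y))"
          by (rule slice_integral_line_hol[OF comp(2) oO nearN line_hol_subset[OF F]])
            (use KN interior_subset in auto)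
        define G0 where "G0 = interior N \<inter> {w \<in> \<omega>. ft w + y \<in> D}"
        have oG0: "open G0" unfolding G0_def by (intro open_Int open_interior openin_preimage_add cft \<omega> D)
        have hol2: "line_hol G0 (\<lambda>w. g (ft w + y))"
          by (rule holo_vec_compose_line_hol[OF ft \<omega> _ oG0 g D seq]) (auto simp: G0_def)
        \<comment> \<open>The component containing the whole initial piece \<open>Q\<close> of the
          path: on it \<open>ft w + y\<close> stays in \<open>D\<close>, and the identity theorem
          leads from \<open>a\<close> to \<open>z1\<close>.\<close>
        define G where "G = connected_component_set G0 a"
        have QG0: "Q \<subseteq> G0" using Qp pN p(2) q'D y(2) by (auto simp: G0_def)
        have QG: "Q \<subseteq> G" unfolding G_def by (rule connected_component_maximal[OF aQ(1) Qc(2) QG0])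
        have oG: "open G" and cG: "connected G" and GG0: "G \<subseteq> G0"
          using oG0 by (auto simp: G_def open_connected_component connected_component_subset)
        have oB: "open {w. w $ i \<in> Bx}"
        proof -
          have "open ((\<lambda>w :: complex ^ 'n. w $ i) -` Bx)"
            by (intro open_vimage continuous_intros) (simp add: Bx_def open_box)
          then show ?thesis by (simp add: vimage_def)
        qed
        \<comment> \<open>Near \<open>a\<close> three conditions hold together: \<open>X\<close>
          admits the Hartogs formula, \<open>c\<close> gives \<open>ft w = f w\<close>, and
          \<open>Bx\<close> keeps the pole inside one square.\<close>
        define W where "W = G \<inter> X \<inter> c \<inter> {w. w $ i \<in> Bx}"
        have "slice_integral i N (F y) z1 - 2 * pi * \<i> * g (ft z1 + y) = 0"
        proof (rule line_hol_identity[of G _ W])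
          show "line_hol G (\<lambda>w. slice_integral i N (F y) w - 2 * pi * \<i> * g (ft w + y))"
            by (intro line_hol_diff line_hol_const_mult line_hol_subset[OF hol1] line_hol_subset[OF hol2] GG0)
              (use GG0 in \<open>auto simp: G0_def\<close>)
          show "open W" unfolding W_def by (intro open_Int oG oX oc oB)
          have "a \<in> W" using aQ(1) QG a\<gamma>(1) \<gamma>X a(2) aB by (auto simp: W_def)
          then show "W \<noteq> {}" by blast
          show "W \<subseteq> G" by (auto simp: W_def)
          show "z1 \<in> G" using aQ(2) QG by (auto simp: z1_def)
          fix w assume w: "w \<in> W"
          then have "w \<in> G0" using GG0 by (auto simp: W_def)
          then have wN: "w \<in> N" "w \<in> \<omega>" using interior_subset by (auto simp: G0_def)
          have "slice_integral i N (F y) w = 2 * pi * \<i> * F y w"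
          proof (rule hartogs_slices[OF ij comp(2,1) KN oO nearN _ K3O F oX cX XK far wN(1)])
            show "2 * (\<eta> / 2) < 2 * \<eta>" using \<eta>(1) by simp
            show "w \<in> X" "w $ i \<in> box (pt (0, 0)) (pt (right (up (0, 0))))"
              using w by (auto simp: W_def Bx_def)
          qed
          then show "slice_integral i N (F y) w - 2 * pi * \<i> * g (ft w + y) = 0"
            using eq[OF wN(2)] w by (simp add: F_def W_def)
        qed (fact oG cG)+
        then have "h y = g (ft z1 + y)" by (simp add: h_def)
        then show ?thesis by (simp add: y_def)
      qed
      ultimately show "\<exists>gb. gateaux_hol sc P {x. q (x - ft z1) < e} gb \<and> (\<forall>x\<in>C. gb x = g x)"
        by blast
    qed
  qed
qed

end

lemma holo_vec_subset: "holo_vec sc P U f \<Longrightarrow> V \<subseteq> U \<Longrightarrow> holo_vec sc P V f"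
  unfolding holo_vec_def holo_n_def using continuous_map_from_subtopology_mono by blast

theorem mainTheorem9:
  fixes sc :: "complex \<Rightarrow> 'y::ab_group_add \<Rightarrow> 'y"
    and P :: "('y \<Rightarrow> real) set"
    and \<Omega> K :: "(complex ^ 'n) set"
    and f ft :: "complex ^ 'n \<Rightarrow> 'y"
  assumes n2: "CARD('n) \<ge> 2"
    and \<Omega>: "open \<Omega>" and K: "compact K" "K \<subseteq> \<Omega>"
    and Y: "lc_space sc P" "lc_hausdorff P" "lc_seq_complete P" "\<exists>y::'y. y \<noteq> 0"
    and f: "holo_vec sc P (\<Omega> - K) f"
    and ft: "holo_vec sc P \<Omega> ft" "\<forall>z\<in>coincidence_set K \<Omega>. ft z = f z"
  shows "\<forall>D. domain_of_holomorphy sc P D \<longrightarrow> f ` (\<Omega> - K) \<subseteq> D \<longrightarrow> ft ` \<Omega> \<subseteq> D"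
proof (intro allI impI subsetI)
  interpret lcs sc P by unfold_locales (fact Y(1))
  fix D x assume dom: "domain_of_holomorphy sc P D" and fD: "f ` (\<Omega> - K) \<subseteq> D" and "x \<in> ft ` \<Omega>"
  then obtain zb where zb: "zb \<in> \<Omega>" "x = ft zb" by blast
  have D: "openin (lc_topology P) D" using dom by (simp add: domain_of_holomorphy_def)
  show "x \<in> D"
  proof (rule ccontr)
    assume xD: "x \<notin> D"
    \<comment> \<open>The coincidence set is built component by component, so the argument takes
      place in the component of the exceptional point, with the part of \<open>K\<close> inside
      it.\<close>
    define \<omega> where "\<omega> = connected_component_set \<Omega> zb"
    have \<omega>: "\<omega> \<in> components \<Omega>" "open \<omega>" "connected \<omega>" "zb \<in> \<omega>" "\<omega> \<subseteq> \<Omega>"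
      using zb(1) \<Omega> by (auto simp: \<omega>_def components_def open_connected_component connected_component_subset)
    have K\<omega>: "compact (K \<inter> \<omega>)" by (rule compact_Int_component[OF K \<omega>(1)])
    have sub: "\<omega> - K \<inter> \<omega> \<subseteq> \<Omega> - K" using \<omega>(5) by blast
    obtain c a where c: "c \<in> components (- (K \<inter> \<omega>))" "\<not> bounded c" and a: "a \<in> \<omega>" "a \<in> c"
      using unbounded_component_meets[OF K\<omega> _ \<omega>(2)] \<omega>(4) by blast
    have eq: "ft z = f z" if "z \<in> \<omega>" "z \<in> c" for z
      using ft(2) that c \<omega>(1) unfolding coincidence_set_def unbounded_comp_def by blast
    obtain p where p: "path p" "path_image p \<subseteq> \<omega>" "pathstart p = a" "pathfinish p = zb"
      using connected_open_path_connected[OF \<omega>(2,3)] a(1) \<omega>(4) unfolding path_connected_def by blast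
    have "a \<in> \<Omega> - K" using a in_components_subset[OF c(1)] \<omega>(5) by blast
    then have ftaD: "ft (pathstart p) \<in> D" using eq[OF a] fD p(3) by auto
    have cft: "continuous_map (top_of_set \<Omega>) (lc_topology P) ft" using ft(1) by (simp add: holo_vec_def)
    obtain t0 where t0: "0 < t0" "t0 \<le> 1" "ft (p t0) \<notin> D"
      and before: "\<And>t. 0 \<le> t \<Longrightarrow> t < t0 \<Longrightarrow> ft (p t) \<in> D"
      using first_exit[OF cft \<Omega> D p(1) _ ftaD] p(2,4) \<omega>(5) xD zb(2) by blast
    have fD': "f ` (\<omega> - K \<inter> \<omega>) \<subseteq> D" using fD sub by blast
    obtain q e where q: "q \<in> SP" "e > 0"
      and cont: "\<And>t1. 0 \<le> t1 \<Longrightarrow> t1 \<le> 1 \<Longrightarrow> (\<And>t. 0 \<le> t \<Longrightarrow> t \<le> t1 \<Longrightarrow> ft (p t) \<in> D) \<Longrightarrow>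
      \<exists>C. openin (lc_topology P) C \<and> ft (p t1) \<in> C \<and> C \<subseteq> D \<inter> {x. q (x - ft (p t1)) < e} \<and>
        (\<forall>g. gateaux_hol sc P D g \<longrightarrow>
          (\<exists>gb. gateaux_hol sc P {x. q (x - ft (p t1)) < e} gb \<and> (\<forall>x\<in>C. gb x = g x)))"
      by (rule hartogs_continuation[OF n2 Y(3) \<omega>(2) K\<omega> _ c a holo_vec_subset[OF f sub]
            holo_vec_subset[OF ft(1) \<omega>(5)] eq D fD' p(1-3)]) auto
    have cp: "continuous_map (top_of_set {0..1}) (lc_topology P) (\<lambda>t. ft (p t))"
      by (rule continuous_map_compose_on[OF cft])
        (use p(1,2) \<omega>(5) in \<open>auto simp: path_def path_image_def\<close>)
    have "((\<lambda>t. q (ft (p t) - ft (p t0))) \<longlongrightarrow> 0) (at t0 within {0..1})"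
      using cp q(1) t0 unfolding lc_continuous_iff by auto
    from tendstoD[OF this q(2)] obtain d where d: "d > 0"
      "\<And>t. t \<in> {0..1} \<Longrightarrow> t \<noteq> t0 \<Longrightarrow> dist t t0 < d \<Longrightarrow> dist (q (ft (p t) - ft (p t0))) 0 < e"
      unfolding eventually_at by blast
    \<comment> \<open>A time shortly before the exit, with \<open>max\<close> keeping it on the
      path. All values up to then lie in \<open>D\<close>, while the ball of radius \<open>e\<close>
      about \<open>ft (p t1)\<close> already contains the exit value
      \<open>ft (p t0)\<close>.\<close>
    define t1 where "t1 = max 0 (t0 - d / 2)"
    have t1: "0 \<le> t1" "t1 < t0" "t1 \<le> 1" "dist t1 t0 < d"
      using t0(1,2) d(1) by (auto simp: t1_def dist_norm)
    define D1 where "D1 = {x. q (x - ft (p t1)) < e}"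
    have "ft (p t0) \<in> D1"
      using d(2)[of t1] t1 SP_commute[OF q(1), of "ft (p t0)"] by (simp add: D1_def dist_norm)
    then have "\<not> D1 \<subseteq> D" using t0(3) by blast
    moreover obtain C where "openin (lc_topology P) C" "ft (p t1) \<in> C" "C \<subseteq> D \<inter> D1"
      "\<forall>g. gateaux_hol sc P D g \<longrightarrow> (\<exists>gb. gateaux_hol sc P D1 gb \<and> (\<forall>x\<in>C. gb x = g x))"
      using cont[OF t1(1,3)] before t1(2) unfolding D1_def by force
    moreover have "openin (lc_topology P) D1" "connectedin (lc_topology P) D1"
      unfolding D1_def by (rule openin_SP_ball[OF q(1)], rule connectedin_SP_ball[OF q(1)])
    ultimately show False using dom unfolding domain_of_holomorphy_def by blast
  qed
qed

end
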